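(* Let $\{\xi_i(x)\}_{i\ge1}$, $x\in X$, be a sequence of centered random fields on $X$ which are martingale differences in the index $i$ with respect to a filtration $\{F(i)\}_{i\ge0}$ with $F(0)$ trivial, such that for some $B\in(2,\infty]$ one has $\sup_i\sup_{x\in X}\left[\mathbf{E}|\xi_i(x)|^p\right]^{1/p}<\infty$ for all $p\in[1,B)$. Let $q>0$ be a constant and put $$\rho_q(x_1,x_2)=\sup_k\|\xi_k(x_1)-\xi_k(x_2)\|_{(q)},\qquad \|\xi\|_{(q)}=\sup_{p\ge2}\frac{\left[\mathbf{E}|\xi|^p\right]^{1/p}}{p^{1/q}}.$$ Assume that $\rho_q$ is bounded on $X\times X$, that $(X,\rho_q)$ is compact, and that $$\sigma^2:=\inf_{x\in X}\sup_n\left[n^{-1}\sum_{k=1}^n\mathrm{Var}(\xi_k(x))\right]<\infty.$$ Suppose in addition that $$\int_0^{D(\rho_q)}H^{(2+q)/(2q)}(X,\rho_q,\epsilon)\,d\epsilon<\infty,$$ where $D(\rho_q)=\sup_{x_1,x_2\in X}\rho_q(x_1,x_2)$. Then the family of distributions of the random fields $$\eta_n(x)=n^{-1/2}\sum_{i=1}^n\xi_i(x),\qquad n=1,2,\ldots,$$ is weakly compact in the space $C(X,\rho_q)$.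
   Context: Setting: $(\Omega,F,\mathbf{P})$ is a probability space with expectation $\mathbf{E}$; $F(0)\subset F(1)\subset F(2)\subset\cdots$ are sub-sigma-algebras of $F$ with $F(0)=\{\emptyset,\Omega\}$. For every $x\in X$ and $i\ge1$, $\xi_i(x)$ is a real random variable with $\mathbf{E}[\xi_i(x)\mid F(k)]=0$ for $k<i$ and $\mathbf{E}[\xi_i(x)\mid F(i)]=\xi_i(x)$ almost surely. Sample-path continuity of the fields is not assumed: under the hypotheses the fields $\xi_i$ (hence $\eta_n$) are almost surely $\rho_q$-continuous, in the usual sense that they are replaced by continuous modifications. Entropy: for a semi-distance $d$ on $X$, $N(X,d,\epsilon)$ is the minimal number of closed $d$-balls of radius $\epsilon$ with centers in $X$ that cover $X$, and $H(X,d,\epsilon)=\log N(X,d,\epsilon)$; $H^{a}(X,d,\epsilon)$ means $(H(X,d,\epsilon))^{a}$. $\rho_q$ is in general only a semi-distance. $C(X,\rho_q)$ is the space of all $\rho_q$-continuous numerical functions on $X$ with the supremum norm. A family of distributions is called weakly compact if it is relatively compact in the topology of weak convergence of probability measures on this space (Prokhorov's sense). *)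

theory Defs
  imports "HOL-Probability.Probability"
begin

subsection \<open>The moment norms and the semi-distance\<close>

text \<open>
  Moment norms are extended nonnegative reals, so that suprema and infinite moments keep their
  usual meaning. The exponent of \<open>ennreal_rpow\<close> is meant to be positive.
\<close>

definition ennreal_rpow :: "ennreal \<Rightarrow> real \<Rightarrow> ennreal" where
  "ennreal_rpow x a = (if x = \<infinity> then \<infinity> else ennreal (enn2real x powr a))"

definition Lp_norm :: "'w measure \<Rightarrow> real \<Rightarrow> ('w \<Rightarrow> real) \<Rightarrow> ennreal" where
  "Lp_norm M p f = ennreal_rpow (\<integral>\<^sup>+ \<omega>. ennreal (\<bar>f \<omega>\<bar> powr p) \<partial>M) (1 / p)"

definition q_norm :: "'w measure \<Rightarrow> real \<Rightarrow> ('w \<Rightarrow> real) \<Rightarrow> ennreal" where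
  "q_norm M q f = (SUP p\<in>{2..}. Lp_norm M p f / ennreal (p powr (1 / q)))"

definition rho_dist ::
  "'w measure \<Rightarrow> (nat \<Rightarrow> 'x \<Rightarrow> 'w \<Rightarrow> real) \<Rightarrow> real \<Rightarrow> 'x \<Rightarrow> 'x \<Rightarrow> ennreal" where
  "rho_dist M \<xi> q x y = (SUP k\<in>{1..}. q_norm M q (\<lambda>\<omega>. \<xi> k x \<omega> - \<xi> k y \<omega>))"

subsection \<open>Semi-distances: topology, diameter, entropy\<close>

definition semidist_topology :: "'x set \<Rightarrow> ('x \<Rightarrow> 'x \<Rightarrow> ennreal) \<Rightarrow> 'x topology" where
  "semidist_topology X d =
     topology (\<lambda>U. U \<subseteq> X \<and> (\<forall>x\<in>U. \<exists>r>0. \<forall>y\<in>X. d x y < ennreal r \<longrightarrow> y \<in> U))"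

lemma openin_semidist_topology:
  "openin (semidist_topology X d) U \<longleftrightarrow>
     U \<subseteq> X \<and> (\<forall>x\<in>U. \<exists>r>0. \<forall>y\<in>X. d x y < ennreal r \<longrightarrow> y \<in> U)"
proof -
  have "istopology (\<lambda>U. U \<subseteq> X \<and> (\<forall>x\<in>U. \<exists>r>0. \<forall>y\<in>X. d x y < ennreal r \<longrightarrow> y \<in> U))"
    (is "istopology ?L")
    unfolding istopology_def
  proof (intro conjI allI impI)
    fix S T assume S: "?L S" and T: "?L T"
    show "S \<inter> T \<subseteq> X" using S by blast
    show "\<forall>x\<in>S \<inter> T. \<exists>r>0. \<forall>y\<in>X. d x y < ennreal r \<longrightarrow> y \<in> S \<inter> T"
    proof
      fix x assume "x \<in> S \<inter> T"
      then have "x \<in> S" "x \<in> T" by auto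
      obtain r where r: "r > 0" "\<forall>y\<in>X. d x y < ennreal r \<longrightarrow> y \<in> S"
        using S \<open>x \<in> S\<close> by blast
      obtain s where s: "s > 0" "\<forall>y\<in>X. d x y < ennreal s \<longrightarrow> y \<in> T"
        using T \<open>x \<in> T\<close> by blast
      have "ennreal (min r s) \<le> ennreal r" "ennreal (min r s) \<le> ennreal s"
        by (auto intro: ennreal_leI)
      then have "\<forall>y\<in>X. d x y < ennreal (min r s) \<longrightarrow> y \<in> S \<inter> T"
        using r(2) s(2) by (auto dest: order_less_le_trans)
      then show "\<exists>r>0. \<forall>y\<in>X. d x y < ennreal r \<longrightarrow> y \<in> S \<inter> T"
        using r(1) s(1) by (intro exI[of _ "min r s"]) simp
    qed
  next
    fix K assume K: "\<forall>U\<in>K. ?L U"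
    show "\<Union>K \<subseteq> X" using K by blast
    show "\<forall>x\<in>\<Union>K. \<exists>r>0. \<forall>y\<in>X. d x y < ennreal r \<longrightarrow> y \<in> \<Union>K"
    proof
      fix x assume "x \<in> \<Union>K"
      then obtain U where U: "U \<in> K" "x \<in> U" by blast
      with K obtain r where "r > 0" "\<forall>y\<in>X. d x y < ennreal r \<longrightarrow> y \<in> U" by meson
      with U(1) show "\<exists>r>0. \<forall>y\<in>X. d x y < ennreal r \<longrightarrow> y \<in> \<Union>K" by blast
    qed
  qed
  then show ?thesis
    by (simp add: semidist_topology_def topology_inverse')
qed

lemma topspace_semidist_topology [simp]: "topspace (semidist_topology X d) = X"
proof (rule equalityI)
  have "openin (semidist_topology X d) (topspace (semidist_topology X d))"
    by (rule openin_topspace)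
  then show "topspace (semidist_topology X d) \<subseteq> X"
    by (rule openin_semidist_topology[THEN iffD1, THEN conjunct1])
  have "\<exists>r>0. \<forall>y\<in>X. d x y < ennreal r \<longrightarrow> y \<in> X" for x
    by (rule exI[of _ 1]) simp
  then have "openin (semidist_topology X d) X"
    by (simp only: openin_semidist_topology subset_refl) simp
  then show "X \<subseteq> topspace (semidist_topology X d)"
    by (rule openin_subset)
qed

definition semidist_diameter :: "'x set \<Rightarrow> ('x \<Rightarrow> 'x \<Rightarrow> ennreal) \<Rightarrow> ennreal" where
  "semidist_diameter X d = (SUP x\<in>X. SUP y\<in>X. d x y)"

definition covering_number :: "'x set \<Rightarrow> ('x \<Rightarrow> 'x \<Rightarrow> ennreal) \<Rightarrow> real \<Rightarrow> enat" where
  "covering_number X d \<epsilon> =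
     (INF A\<in>{A. A \<subseteq> X \<and> finite A \<and> X \<subseteq> (\<Union>a\<in>A. {x\<in>X. d a x \<le> ennreal \<epsilon>})}. enat (card A))"

definition entropy_fun :: "'x set \<Rightarrow> ('x \<Rightarrow> 'x \<Rightarrow> ennreal) \<Rightarrow> real \<Rightarrow> ennreal" where
  "entropy_fun X d \<epsilon> =
     (case covering_number X d \<epsilon> of enat n \<Rightarrow> ennreal (ln (real n)) | \<infinity> \<Rightarrow> \<infinity>)"

subsection \<open>Weak convergence of probability measures on a topological space\<close>

definition borel_of :: "'b topology \<Rightarrow> 'b measure" where
  "borel_of T = sigma (topspace T) {U. openin T U}"

definition prob_measures :: "'b topology \<Rightarrow> 'b measure set" where
  "prob_measures T = {\<mu>. prob_space \<mu> \<and> sets \<mu> = sets (borel_of T)}"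

text \<open>
  The coarsest topology on the Borel probability measures that makes \<open>\<mu> \<mapsto> \<integral>f d\<mu>\<close> continuous
  for every bounded continuous real function \<open>f\<close>.
\<close>

definition weak_topology :: "'b topology \<Rightarrow> 'b measure topology" where
  "weak_topology T = topology_generated_by
     {{\<mu> \<in> prob_measures T. integral\<^sup>L \<mu> f \<in> V} | f V.
        continuous_map T euclideanreal f \<and> bounded (f ` topspace T) \<and> open V}"

lemma topspace_weak_topology [simp]: "topspace (weak_topology T) = prob_measures T"
proof -
  let ?G = "{{\<mu> \<in> prob_measures T. integral\<^sup>L \<mu> f \<in> V} | f V.
        continuous_map T euclideanreal f \<and> bounded (f ` topspace T) \<and> open V}"
  have "{\<mu> \<in> prob_measures T. integral\<^sup>L \<mu> (\<lambda>x. 0) \<in> (UNIV :: real set)} \<in> ?G"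
    by (intro CollectI exI[of _ "\<lambda>x. 0 :: real"] exI[of _ "UNIV :: real set"])
      (auto intro: bounded_subset[of "{0}"])
  then have "prob_measures T \<in> ?G"
    by simp
  then have "\<Union>?G = prob_measures T"
    by (intro equalityI Sup_upper Sup_least) auto
  then show ?thesis
    unfolding weak_topology_def topology_generated_by_topspace .
qed

text \<open>
  The inclusion is stated separately because \<open>closure_of\<close> ignores points outside the space.
\<close>

definition weakly_rel_compact :: "'b topology \<Rightarrow> 'b measure set \<Rightarrow> bool" where
  "weakly_rel_compact T S \<longleftrightarrow>
     S \<subseteq> prob_measures T \<and> compactin (weak_topology T) (weak_topology T closure_of S)"

subsection \<open>Random fields with continuous paths\<close>

text \<open>
  The bounded continuous functions on \<open>X\<close> with the supremum metric; when \<open>(X, d)\<close> is compact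
  these are all the continuous functions. Elements are extensional, i.e. \<open>undefined\<close> off \<open>X\<close>.
\<close>

definition C_space :: "'x set \<Rightarrow> ('x \<Rightarrow> 'x \<Rightarrow> ennreal) \<Rightarrow> ('x \<Rightarrow> real) topology" where
  "C_space X d = mtopology_of (cfunspace (semidist_topology X d) euclidean_metric)"

text \<open>
  A continuous modification is a Borel random element of the function space, so that its
  distribution \<open>distr M (borel_of (C_space X d)) Z\<close> is a genuine probability measure.
\<close>

definition continuous_modification ::
  "'w measure \<Rightarrow> 'x set \<Rightarrow> ('x \<Rightarrow> 'x \<Rightarrow> ennreal) \<Rightarrow> ('x \<Rightarrow> 'w \<Rightarrow> real) \<Rightarrow> ('w \<Rightarrow> 'x \<Rightarrow> real) \<Rightarrow> bool"
where
  "continuous_modification M X d \<zeta> Z \<longleftrightarrow>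
     Z \<in> M \<rightarrow>\<^sub>M borel_of (C_space X d) \<and> (\<forall>x\<in>X. AE \<omega> in M. Z \<omega> x = \<zeta> x \<omega>)"

definition normalized_sum :: "(nat \<Rightarrow> 'x \<Rightarrow> 'w \<Rightarrow> real) \<Rightarrow> nat \<Rightarrow> 'x \<Rightarrow> 'w \<Rightarrow> real" where
  "normalized_sum \<xi> n x \<omega> = real n powr (- 1 / 2) * (\<Sum>i=1..n. \<xi> i x \<omega>)"

end

theory Submission
  imports Defs
begin

text \<open>
  Write \<open>\<gamma> = (2 + q) / (2q) = 1/2 + 1/q\<close>. Two estimates carry the theorem. The first is a moment
  inequality for sums of martingale differences: if the summands have \<open>2m\<close>-th moments at most \<open>c^(2m)\<close>,
  then their sum of length \<open>n\<close> has \<open>2m\<close>-th moment at most \<open>(16 m n c\<^sup>2)^m\<close> (\<open>martingale_even_moment\<close>),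
  so that normalization by \<open>\<surd>n\<close> costs only a factor of order \<open>\<surd>m\<close> in the \<open>L\<^sub>2\<^sub>m\<close>-norm. The semi-distance
  \<open>\<rho>\<close> is made so that \<open>\<xi>\<^sub>i(x) - \<xi>\<^sub>i(y)\<close> has \<open>L\<^sub>2\<^sub>m\<close>-norm at most \<open>(2m) powr (1/q) * \<rho>(x, y)\<close>. Together:
  every \<open>\<eta>\<^sub>n(x) - \<eta>\<^sub>n(y)\<close> has \<open>L\<^sub>2\<^sub>m\<close>-norm at most \<open>3 (2m) powr \<gamma> * \<rho>(x, y)\<close>, with no dependence on \<open>n\<close>.

  The second estimate is chaining. Taking \<open>m\<close> of the order of \<open>ln N\<close>, the largest of \<open>N\<close> such increments
  between points at distance at most \<open>\<epsilon>\<close> has expectation of order \<open>\<epsilon> (ln N) powr \<gamma>\<close> (\<open>expectation_Osc\<close>).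
  For minimal nets at the scales \<open>\<epsilon>\<^sub>j = \<delta> / 2^j\<close> these bounds are summable because the entropy
  integral is finite (\<open>net_chain_exists\<close>). The tails of the random series of oscillations bound the modulus
  of continuity of the field, by which the field has a continuous modification
  (\<open>continuous_modification_exists\<close>). As the expected tails tend to zero uniformly in \<open>n\<close>, and the second
  moments at one point are bounded, the \<open>\<eta>\<^sub>n\<close> are simultaneously concentrated on sets of uniformly
  bounded functions with a common modulus of continuity, which have compact closure by the argument of
  Arzela and Ascoli.

  Tightness implies relative compactness by Prokhorov's theorem, proved here for metrizable spaces
  (\<open>tight_imp_weakly_rel_compact\<close>). Integration maps the measures into a product of compact intervals
  indexed by the bounded continuous functions, so by Tychonoff's theorem only one thing is left to check: every
  functional in the closure of a tight family is again integration against a measure. Tightness gives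
  continuity of such a functional along monotone sequences, and Daniell's upper integral then yields
  the measure.
\<close>

section \<open>Weak compactness of tight families\<close>

definition Cb :: "'b topology \<Rightarrow> ('b \<Rightarrow> real) set" where
  "Cb T = {f. continuous_map T euclideanreal f \<and> bounded (f ` topspace T)}"

lemma CbI:
  assumes "continuous_map T euclideanreal f" "\<And>x. x \<in> topspace T \<Longrightarrow> \<bar>f x\<bar> \<le> c"
  shows "f \<in> Cb T"
  using assms by (auto simp: Cb_def bounded_iff)

lemma Cb_continuous: "f \<in> Cb T \<Longrightarrow> continuous_map T euclideanreal f"
  by (simp add: Cb_def)

lemma CbE:
  assumes "f \<in> Cb T"
  obtains c where "c > 0" "\<And>x. x \<in> topspace T \<Longrightarrow> \<bar>f x\<bar> \<le> c"
  using assms by (auto simp: Cb_def bounded_pos)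

lemma Cb_const: "(\<lambda>_. c) \<in> Cb T"
  by (rule CbI[where c="\<bar>c\<bar>"]) auto

lemma Cb_add:
  assumes "f \<in> Cb T" "g \<in> Cb T" shows "(\<lambda>x. f x + g x) \<in> Cb T"
proof -
  obtain b where b: "\<And>x. x \<in> topspace T \<Longrightarrow> \<bar>f x\<bar> \<le> b" using assms(1) by (elim CbE) blast
  obtain c where c: "\<And>x. x \<in> topspace T \<Longrightarrow> \<bar>g x\<bar> \<le> c" using assms(2) by (elim CbE) blast
  show ?thesis
  proof (rule CbI[where c="b + c"])
    show "continuous_map T euclideanreal (\<lambda>x. f x + g x)"
      using assms by (intro continuous_intros Cb_continuous)
    fix x assume "x \<in> topspace T"
    from b[OF this] c[OF this] show "\<bar>f x + g x\<bar> \<le> b + c" by linarith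
  qed
qed

lemma Cb_mult:
  assumes "f \<in> Cb T" "g \<in> Cb T" shows "(\<lambda>x. f x * g x) \<in> Cb T"
proof -
  obtain b where b: "b > 0" "\<And>x. x \<in> topspace T \<Longrightarrow> \<bar>f x\<bar> \<le> b" using assms(1) by (elim CbE) blast
  obtain c where c: "\<And>x. x \<in> topspace T \<Longrightarrow> \<bar>g x\<bar> \<le> c" using assms(2) by (elim CbE) blast
  show ?thesis
  proof (rule CbI[where c="b*c"])
    show "continuous_map T euclideanreal (\<lambda>x. f x * g x)"
      using assms by (intro continuous_map_real_mult Cb_continuous)
    fix x assume "x \<in> topspace T"
    then show "\<bar>f x * g x\<bar> \<le> b * c"
      unfolding abs_mult by (intro mult_mono b(2) c) (use b(1) in simp_all)
  qed
qed

lemma Cb_cmult: "f \<in> Cb T \<Longrightarrow> (\<lambda>x. c * f x) \<in> Cb T"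
  by (intro Cb_mult Cb_const)

lemma Cb_diff: "f \<in> Cb T \<Longrightarrow> g \<in> Cb T \<Longrightarrow> (\<lambda>x. f x - g x) \<in> Cb T"
  using Cb_add[OF _ Cb_cmult[of g T "-1"]] by simp

lemma Cb_max:
  assumes "f \<in> Cb T" "g \<in> Cb T" shows "(\<lambda>x. max (f x) (g x)) \<in> Cb T"
proof -
  obtain b where b: "\<And>x. x \<in> topspace T \<Longrightarrow> \<bar>f x\<bar> \<le> b" using assms(1) by (elim CbE) blast
  obtain c where c: "\<And>x. x \<in> topspace T \<Longrightarrow> \<bar>g x\<bar> \<le> c" using assms(2) by (elim CbE) blast
  show ?thesis
  proof (rule CbI[where c="max b c"])
    show "continuous_map T euclideanreal (\<lambda>x. max (f x) (g x))"
      using assms by (intro continuous_intros Cb_continuous)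
    fix x assume "x \<in> topspace T"
    from b[OF this] c[OF this] show "\<bar>max (f x) (g x)\<bar> \<le> max b c" by linarith
  qed
qed

lemma Cb_min:
  assumes "f \<in> Cb T" "g \<in> Cb T" shows "(\<lambda>x. min (f x) (g x)) \<in> Cb T"
proof -
  obtain b where b: "\<And>x. x \<in> topspace T \<Longrightarrow> \<bar>f x\<bar> \<le> b" using assms(1) by (elim CbE) blast
  obtain c where c: "\<And>x. x \<in> topspace T \<Longrightarrow> \<bar>g x\<bar> \<le> c" using assms(2) by (elim CbE) blast
  show ?thesis
  proof (rule CbI[where c="max b c"])
    show "continuous_map T euclideanreal (\<lambda>x. min (f x) (g x))"
      using assms by (intro continuous_intros Cb_continuous)
    fix x assume "x \<in> topspace T"
    from b[OF this] c[OF this] show "\<bar>min (f x) (g x)\<bar> \<le> max b c" by linarith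
  qed
qed

lemma Cb_sum: "(\<And>i. i \<in> I \<Longrightarrow> f i \<in> Cb T) \<Longrightarrow> (\<lambda>x. \<Sum>i\<in>I. f i x) \<in> Cb T"
  by (induction I rule: infinite_finite_induct) (auto intro!: Cb_const Cb_add)

lemma space_borel_of [simp]: "space (borel_of T) = topspace T"
  by (simp add: borel_of_def space_measure_of_conv)

lemma sets_borel_of: "sets (borel_of T) = sigma_sets (topspace T) {U. openin T U}"
  unfolding borel_of_def by (rule sets_measure_of) (auto dest: openin_subset)

lemma openin_sets_borel_of: "openin T U \<Longrightarrow> U \<in> sets (borel_of T)"
  by (auto simp: sets_borel_of)

lemma borel_of_measurable_continuous:
  assumes "continuous_map T euclideanreal f"
  shows "f \<in> borel_measurable (borel_of T)"
proof (rule borel_measurableI)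
  fix S :: "real set" assume "open S"
  then have "openin T {x \<in> topspace T. f x \<in> S}"
    using assms by (simp add: continuous_map)
  moreover have "{x \<in> topspace T. f x \<in> S} = f -` S \<inter> space (borel_of T)"
    by auto
  ultimately show "f -` S \<inter> space (borel_of T) \<in> sets (borel_of T)"
    using openin_sets_borel_of by metis
qed

lemma prob_measuresD:
  assumes "\<mu> \<in> prob_measures T"
  shows "prob_space \<mu>" "sets \<mu> = sets (borel_of T)" "space \<mu> = topspace T"
  using assms sets_eq_imp_space_eq[of \<mu> "borel_of T"] by (auto simp: prob_measures_def)

lemma Cb_integrable:
  assumes "\<mu> \<in> prob_measures T" "f \<in> Cb T"
  shows "integrable \<mu> f"
proof -
  interpret prob_space \<mu> using assms(1) by (rule prob_measuresD)
  obtain c where "\<And>x. x \<in> topspace T \<Longrightarrow> \<bar>f x\<bar> \<le> c" using assms(2) by (elim CbE) blast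
  moreover have "f \<in> borel_measurable \<mu>"
    using borel_of_measurable_continuous[OF Cb_continuous[OF assms(2)]] prob_measuresD(2)[OF assms(1)]
    by (simp cong: measurable_cong_sets)
  ultimately show ?thesis
    using prob_measuresD(3)[OF assms(1)] by (intro integrable_const_bound[where B=c]) auto
qed

text \<open>
  The properties of integration against a tight family of probability measures that pass to pointwise limits of
  the functionals. The last condition, that open sets are the positivity sets of continuous functions, is what
  the construction of a representing measure takes from metrizability of the space.
\<close>

locale tight_functional =
  fixes T :: "'b topology" and L :: "('b \<Rightarrow> real) \<Rightarrow> real"
  assumes L_add: "f \<in> Cb T \<Longrightarrow> g \<in> Cb T \<Longrightarrow> L (\<lambda>x. f x + g x) = L f + L g"
    and L_cmult: "f \<in> Cb T \<Longrightarrow> L (\<lambda>x. c * f x) = c * L f"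
    and L_nonneg: "f \<in> Cb T \<Longrightarrow> (\<And>x. x \<in> topspace T \<Longrightarrow> 0 \<le> f x) \<Longrightarrow> 0 \<le> L f"
    and L_one: "L (\<lambda>_. 1) = 1"
    and L_tight: "e > 0 \<Longrightarrow> \<exists>K. compactin T K \<and> (\<forall>f\<in>Cb T. \<forall>c \<delta>.
        (\<forall>x\<in>topspace T. 0 \<le> f x \<and> f x \<le> c) \<longrightarrow> (\<forall>x\<in>K. f x \<le> \<delta>) \<longrightarrow> 0 \<le> \<delta> \<longrightarrow> L f \<le> \<delta> + c * e)"
    and cozero: "openin T U \<Longrightarrow> \<exists>h. continuous_map T euclideanreal h \<and>
        (\<forall>x\<in>topspace T. 0 \<le> h x \<and> (x \<in> U \<longleftrightarrow> 0 < h x))"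
begin

lemma L_zero: "L (\<lambda>_. 0) = 0"
  using L_cmult[OF Cb_const[of 0], of 0] by simp

lemma L_const: "L (\<lambda>_. c) = c"
  using L_cmult[OF Cb_const[of 1], of c] L_one by simp

lemma L_diff:
  assumes "f \<in> Cb T" "g \<in> Cb T" shows "L (\<lambda>x. f x - g x) = L f - L g"
  using L_add[OF assms(1) Cb_cmult[OF assms(2), of "-1"]] L_cmult[OF assms(2), of "-1"] by simp

lemma L_mono:
  assumes "f \<in> Cb T" "g \<in> Cb T" "\<And>x. x \<in> topspace T \<Longrightarrow> f x \<le> g x"
  shows "L f \<le> L g"
  using L_nonneg[OF Cb_diff[OF assms(2,1)]] L_diff[OF assms(2,1)] assms(3) by simp

lemma L_sum:
  "(\<And>i. i \<in> I \<Longrightarrow> f i \<in> Cb T) \<Longrightarrow> L (\<lambda>x. \<Sum>i\<in>I. f i x) = (\<Sum>i\<in>I. L (f i))"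
  by (induction I rule: infinite_finite_induct) (auto simp: L_zero L_add Cb_sum)

definition Cpos :: "('b \<Rightarrow> real) set" where
  "Cpos = {f \<in> Cb T. \<forall>x\<in>topspace T. 0 \<le> f x}"

lemma Cpos_L: "f \<in> Cpos \<Longrightarrow> 0 \<le> L f"
  by (auto simp: Cpos_def intro: L_nonneg)

text \<open>
  Dini's argument: on a compact set that carries almost all mass, finitely many terms of the cover already reach
  \<open>f\<close> up to a small error, and off that set \<open>f\<close> is bounded. This is the only place where tightness enters.
\<close>

lemma L_le_suminf:
  assumes f: "f \<in> Cpos" and fs: "\<And>n. fs n \<in> Cpos"
    and le: "\<And>x. x \<in> topspace T \<Longrightarrow> ennreal (f x) \<le> (\<Sum>n. ennreal (fs n x))"
  shows "ennreal (L f) \<le> (\<Sum>n. ennreal (L (fs n)))"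
proof (rule ennreal_le_epsilon)
  fix e :: real assume e: "0 < e"
  have fC: "f \<in> Cb T" and fsC: "\<And>n. fs n \<in> Cb T" using f fs by (auto simp: Cpos_def)
  have f0: "\<And>x. x \<in> topspace T \<Longrightarrow> 0 \<le> f x" and fs0: "\<And>n x. x \<in> topspace T \<Longrightarrow> 0 \<le> fs n x"
    using f fs by (auto simp: Cpos_def)
  obtain c where c: "c > 0" "\<And>x. x \<in> topspace T \<Longrightarrow> \<bar>f x\<bar> \<le> c" using fC by (elim CbE) blast
  \<comment> \<open>The mass outside the compact set costs \<open>c * d = e / 2\<close>; the other half is the error on it.\<close>
  define d where "d = e / (2 * c)"
  have d: "d > 0" using e c by (simp add: d_def)
  from L_tight[OF d] obtain K where K: "compactin T K" and LK: "\<And>f b \<delta>. f \<in> Cb T \<Longrightarrow>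
      (\<And>x. x \<in> topspace T \<Longrightarrow> 0 \<le> f x \<and> f x \<le> b) \<Longrightarrow> (\<And>x. x \<in> K \<Longrightarrow> f x \<le> \<delta>) \<Longrightarrow> 0 \<le> \<delta> \<Longrightarrow> L f \<le> \<delta> + b * d"
    by meson
  define U where "U N = {x \<in> topspace T. f x - (\<Sum>n<N. fs n x) \<in> {..<e/2}}" for N
  have Uo: "openin T (U N)" for N
    unfolding U_def
    by (rule openin_continuous_map_preimage[where Y=euclideanreal])
       (auto intro!: continuous_intros Cb_continuous fC fsC Cb_diff Cb_sum)
  have "K \<subseteq> (\<Union>N. U N)"
  proof
    fix x assume "x \<in> K"
    then have x: "x \<in> topspace T" using K by (auto dest: compactin_subset_topspace)
    have "\<exists>N. f x - e/2 < (\<Sum>n<N. fs n x)"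
    proof (rule ccontr)
      assume "\<not> ?thesis"
      then have le2: "(\<Sum>n<N. fs n x) \<le> f x - e/2" for N by (auto simp: not_less)
      have "(\<Sum>n. ennreal (fs n x)) \<le> ennreal (f x - e/2)"
        by (intro suminf_le_const summableI) (auto simp: sum_ennreal fs0 x intro!: ennreal_leI le2)
      then have "ennreal (f x) \<le> ennreal (f x - e/2)" using le[OF x] by (rule order_trans[rotated])
      moreover have "0 \<le> f x - e/2" using le2[of 0] by simp
      ultimately show False using e by (simp add: ennreal_le_iff)
    qed
    then obtain N where "f x - e/2 < (\<Sum>n<N. fs n x)" ..
    then have "x \<in> U N" using x by (simp add: U_def)
    then show "x \<in> (\<Union>N. U N)" by blast
  qed
  then obtain F where F: "finite F" "F \<subseteq> range U" "K \<subseteq> \<Union>F"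
    using K Uo unfolding compactin_def by (metis (no_types, lifting) imageE)
  then obtain I where I: "finite I" "F = U ` I" by (meson finite_subset_image)
  define N where "N = Max (insert 0 I)"
  have UN: "U i \<subseteq> U N" if "i \<in> I" for i
  proof -
    have "i \<le> N" using that I by (auto simp: N_def)
    then have "(\<Sum>n<i. fs n x) \<le> (\<Sum>n<N. fs n x)" if "x \<in> topspace T" for x
      by (intro sum_mono2) (auto simp: fs0 that)
    then show ?thesis by (fastforce simp: U_def)
  qed
  have KN: "K \<subseteq> U N" using F(3) I UN by blast
  define h where "h x = max 0 (f x - (\<Sum>n<N. fs n x))" for x
  have hC: "h \<in> Cb T" unfolding h_def by (intro Cb_max Cb_const Cb_diff fC Cb_sum fsC)
  have "L h \<le> e/2 + c * d"
  proof (rule LK[OF hC])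
    fix x assume x: "x \<in> topspace T"
    have "0 \<le> (\<Sum>n<N. fs n x)" by (intro sum_nonneg fs0 x)
    moreover have "f x \<le> c" using c(2)[OF x] by simp
    ultimately show "0 \<le> h x \<and> h x \<le> c" using c(1) by (simp add: h_def max_def)
  next
    fix x assume "x \<in> K"
    then have "f x - (\<Sum>n<N. fs n x) < e/2" using KN by (auto simp: U_def)
    then show "h x \<le> e/2" using e unfolding h_def max_def by auto
  qed (use e in simp)
  also have "\<dots> = e" using c by (simp add: d_def)
  finally have "L h \<le> e" .
  moreover have "L f \<le> L (\<lambda>x. h x + (\<Sum>n<N. fs n x))"
    by (rule L_mono) (auto simp: h_def intro!: fC Cb_add hC[unfolded h_def] Cb_sum fsC)
  then have "L f \<le> L h + (\<Sum>n<N. L (fs n))"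
    by (simp add: L_add L_sum hC fsC Cb_sum)
  ultimately have "ennreal (L f) \<le> ennreal (e + (\<Sum>n<N. L (fs n)))" by (intro ennreal_leI) simp
  also have "\<dots> = (\<Sum>n<N. ennreal (L (fs n))) + ennreal e"
    using e fs by (simp add: Cpos_L sum_nonneg sum_ennreal ennreal_plus add.commute)
  also have "\<dots> \<le> (\<Sum>n. ennreal (L (fs n))) + ennreal e"
    by (intro add_mono sum_le_suminf) auto
  finally show "ennreal (L f) \<le> (\<Sum>n. ennreal (L (fs n))) + ennreal e" .
qed

text \<open>
  Daniell's upper integral. It is defined for functions and not only for sets, because measurability of open sets
  will be obtained by splitting a function with continuous weights.
\<close>

definition covers :: "('b \<Rightarrow> ennreal) \<Rightarrow> (nat \<Rightarrow> 'b \<Rightarrow> real) set" where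
  "covers \<phi> = {fs. (\<forall>n. fs n \<in> Cpos) \<and> (\<forall>x\<in>topspace T. \<phi> x \<le> (\<Sum>n. ennreal (fs n x)))}"

definition upint :: "('b \<Rightarrow> ennreal) \<Rightarrow> ennreal" where
  "upint \<phi> = (INF fs\<in>covers \<phi>. \<Sum>n. ennreal (L (fs n)))"

lemma upint_mono: "(\<And>x. x \<in> topspace T \<Longrightarrow> \<phi> x \<le> \<psi> x) \<Longrightarrow> upint \<phi> \<le> upint \<psi>"
  unfolding upint_def by (rule INF_superset_mono) (auto simp: covers_def intro: order_trans)

lemma L_le_upint:
  assumes "f \<in> Cpos" "\<And>x. x \<in> topspace T \<Longrightarrow> ennreal (f x) \<le> \<phi> x"
  shows "ennreal (L f) \<le> upint \<phi>"
  unfolding upint_def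
proof (rule INF_greatest)
  fix fs assume "fs \<in> covers \<phi>"
  then show "ennreal (L f) \<le> (\<Sum>n. ennreal (L (fs n)))"
    using assms by (intro L_le_suminf) (auto simp: covers_def intro: order_trans)
qed

lemma upint_le_L:
  assumes "f \<in> Cpos" "\<And>x. x \<in> topspace T \<Longrightarrow> \<phi> x \<le> ennreal (f x)"
  shows "upint \<phi> \<le> ennreal (L f)"
proof -
  define fs where "fs n = (if n = 0 then f else (\<lambda>_. 0))" for n :: nat
  have z: "(\<lambda>_. 0) \<in> Cpos" by (auto simp: Cpos_def Cb_const)
  have *: "(\<Sum>n. ennreal (if n = 0 then a else 0)) = ennreal a" for a
    by (subst suminf_finite[of "{0::nat}"]) auto
  have "(\<Sum>n. ennreal (fs n x)) = ennreal (f x)" for x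
    by (rule trans[OF _ *[of "f x"]]) (auto simp: fs_def intro!: suminf_cong)
  then have "fs \<in> covers \<phi>" using assms z by (auto simp: covers_def fs_def)
  then have "upint \<phi> \<le> (\<Sum>n. ennreal (L (fs n)))" unfolding upint_def by (rule INF_lower)
  also have "\<dots> = ennreal (L f)"
    by (rule trans[OF _ *[of "L f"]]) (auto simp: fs_def L_zero intro!: suminf_cong)
  finally show ?thesis .
qed

lemma upint_suminf: "upint (\<lambda>x. \<Sum>k. \<phi> k x) \<le> (\<Sum>k. upint (\<phi> k))"
proof (rule ennreal_le_epsilon)
  fix e :: real assume e: "0 < e" and fin: "(\<Sum>k. upint (\<phi> k)) < top"
  have "\<exists>fs\<in>covers (\<phi> k). (\<Sum>n. ennreal (L (fs n))) \<le> upint (\<phi> k) + ennreal (e * (1/2) ^ Suc k)" for k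
  proof -
    have "upint (\<phi> k) < upint (\<phi> k) + ennreal (e * (1/2) ^ Suc k)"
      using e ennreal_suminf_lessD[OF fin, of k] by (auto simp: less_top)
    then show ?thesis
      unfolding upint_def[of "\<phi> k"] INF_less_iff by (meson less_imp_le)
  qed
  then obtain fs where fs: "\<And>k. fs k \<in> covers (\<phi> k)"
    and le: "\<And>k. (\<Sum>n. ennreal (L (fs k n))) \<le> upint (\<phi> k) + ennreal (e * (1/2) ^ Suc k)"
    by metis
  \<comment> \<open>The double sequence of all covers, enumerated along the pairing of the natural numbers.\<close>
  define gs where "gs i = case_prod fs (prod_decode i)" for i
  have sum2: "(\<Sum>i. G (gs i)) = (\<Sum>k. \<Sum>n. G (fs k n))" for G :: "_ \<Rightarrow> ennreal"
    using suminf_ennreal_2dimen[of "\<lambda>k. \<Sum>n. G (fs k n)" "\<lambda>(k, n). G (fs k n)"]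
    by (simp add: gs_def case_prod_beta)
  have "gs \<in> covers (\<lambda>x. \<Sum>k. \<phi> k x)"
    unfolding covers_def
  proof (intro CollectI conjI allI ballI)
    show "gs i \<in> Cpos" for i using fs by (auto simp: gs_def case_prod_beta covers_def)
    fix x assume "x \<in> topspace T"
    then show "(\<Sum>k. \<phi> k x) \<le> (\<Sum>i. ennreal (gs i x))"
      unfolding sum2[where G="\<lambda>f. ennreal (f x)"] using fs by (intro suminf_le) (auto simp: covers_def)
  qed
  then have "upint (\<lambda>x. \<Sum>k. \<phi> k x) \<le> (\<Sum>i. ennreal (L (gs i)))"
    unfolding upint_def by (rule INF_lower)
  also have "\<dots> = (\<Sum>k. \<Sum>n. ennreal (L (fs k n)))"
    by (rule sum2[where G="\<lambda>f. ennreal (L f)"])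
  also have "\<dots> \<le> (\<Sum>k. upint (\<phi> k) + ennreal (e * (1/2) ^ Suc k))"
    by (intro suminf_le le) auto
  also have "\<dots> = (\<Sum>k. upint (\<phi> k)) + (\<Sum>k. ennreal (e * (1/2) ^ Suc k))"
    by (subst suminf_add[symmetric]) auto
  also have "(\<Sum>k. ennreal (e * (1/2) ^ Suc k)) = ennreal e"
    using e sums_mult[OF power_half_series, of e] by (intro suminf_ennreal_eq) auto
  finally show "upint (\<lambda>x. \<Sum>k. \<phi> k x) \<le> (\<Sum>k. upint (\<phi> k)) + ennreal e" .
qed

text \<open>
  Multiplying a cover of \<open>\<phi>\<close> by the weights \<open>g k\<close> covers the pieces of \<open>\<phi>\<close> at no extra cost.
\<close>

lemma upint_partition:
  assumes g: "\<And>k. k < K \<Longrightarrow> g k \<in> Cpos" and le: "\<And>x. x \<in> topspace T \<Longrightarrow> (\<Sum>k<K. g k x) \<le> 1"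
  shows "(\<Sum>k<K. upint (\<lambda>x. \<phi> x * ennreal (g k x))) \<le> upint \<phi>"
  unfolding upint_def[of \<phi>]
proof (rule INF_greatest)
  fix fs assume fs: "fs \<in> covers \<phi>"
  have fsC: "fs n \<in> Cb T" and fs0: "x \<in> topspace T \<Longrightarrow> 0 \<le> fs n x" for n x
    using fs by (auto simp: covers_def Cpos_def)
  have gC: "g k \<in> Cb T" and g0: "x \<in> topspace T \<Longrightarrow> 0 \<le> g k x" if "k < K" for k x
    using g[OF that] by (auto simp: Cpos_def)
  have fgpos: "(\<lambda>x. fs n x * g k x) \<in> Cpos" if "k < K" for n k
    using that by (auto simp: Cpos_def fs0 g0 intro!: Cb_mult fsC gC)
  have "upint (\<lambda>x. \<phi> x * ennreal (g k x)) \<le> (\<Sum>n. ennreal (L (\<lambda>x. fs n x * g k x)))" if k: "k < K" for k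
  proof -
    have "(\<lambda>n x. fs n x * g k x) \<in> covers (\<lambda>x. \<phi> x * ennreal (g k x))"
      using fs fgpos[OF k] by (auto simp: covers_def ennreal_mult fs0 g0 k intro!: mult_right_mono)
    then show ?thesis unfolding upint_def by (rule INF_lower)
  qed
  then have "(\<Sum>k<K. upint (\<lambda>x. \<phi> x * ennreal (g k x))) \<le> (\<Sum>k<K. \<Sum>n. ennreal (L (\<lambda>x. fs n x * g k x)))"
    by (intro sum_mono) auto
  also have "\<dots> = (\<Sum>n. \<Sum>k<K. ennreal (L (\<lambda>x. fs n x * g k x)))"
    by (rule suminf_sum[symmetric]) auto
  also have "\<dots> \<le> (\<Sum>n. ennreal (L (fs n)))"
  proof (intro suminf_le allI)
    fix n
    have "(\<Sum>k<K. L (\<lambda>x. fs n x * g k x)) = L (\<lambda>x. \<Sum>k<K. fs n x * g k x)"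
      by (intro L_sum[symmetric] Cb_mult fsC gC) auto
    also have "\<dots> \<le> L (fs n)"
    proof (rule L_mono)
      fix x assume x: "x \<in> topspace T"
      show "(\<Sum>k<K. fs n x * g k x) \<le> fs n x"
        using mult_left_mono[OF le[OF x] fs0[OF x, of n]] by (simp add: sum_distrib_left)
    qed (auto intro!: Cb_sum Cb_mult fsC gC)
    finally show "(\<Sum>k<K. ennreal (L (\<lambda>x. fs n x * g k x))) \<le> ennreal (L (fs n))"
      using fgpos by (subst sum_ennreal) (auto intro!: Cpos_L ennreal_leI)
  qed auto
  finally show "(\<Sum>k<K. upint (\<lambda>x. \<phi> x * ennreal (g k x))) \<le> (\<Sum>n. ennreal (L (fs n)))" .
qed

definition outer :: "'b set \<Rightarrow> ennreal" where
  "outer A = upint (indicator A)"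

lemma outer_empty: "outer {} = 0"
  using upint_le_L[of "\<lambda>_. 0" "indicator {}"] by (simp add: outer_def Cpos_def Cb_const L_zero)

lemma outer_mono: "A \<subseteq> B \<Longrightarrow> outer A \<le> outer B"
  unfolding outer_def by (intro upint_mono) (auto simp: indicator_def)

lemma outer_topspace: "outer (topspace T) = 1"
proof (rule antisym)
  have 1: "(\<lambda>_. 1) \<in> Cpos" by (simp add: Cpos_def Cb_const)
  show "outer (topspace T) \<le> 1"
    unfolding outer_def using upint_le_L[OF 1] by (simp add: L_one)
  show "1 \<le> outer (topspace T)"
    unfolding outer_def using L_le_upint[OF 1] by (simp add: L_one)
qed

lemma outer_UN: "outer (\<Union>k. A k) \<le> (\<Sum>k. outer (A k))"
proof -
  have "outer (\<Union>k. A k) \<le> upint (\<lambda>x. \<Sum>k. indicator (A k) x)"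
    unfolding outer_def
  proof (rule upint_mono)
    fix x
    show "indicator (\<Union>k. A k) x \<le> (\<Sum>k. indicator (A k) x :: ennreal)"
    proof (cases "\<exists>k. x \<in> A k")
      case True
      then obtain k where "x \<in> A k" ..
      then have "1 \<le> (\<Sum>k\<in>{k}. indicator (A k) x :: ennreal)" by simp
      also have "\<dots> \<le> (\<Sum>k. indicator (A k) x)" by (rule sum_le_suminf) auto
      finally show ?thesis by (simp add: indicator_def)
    qed simp
  qed
  also have "\<dots> \<le> (\<Sum>k. outer (A k))" unfolding outer_def by (rule upint_suminf)
  finally show ?thesis .
qed

lemma outer_measure_space_outer: "outer_measure_space (Pow (topspace T)) outer"
  unfolding outer_measure_space_def positive_def increasing_def countably_subadditive_def
  using outer_UN by (auto simp: outer_empty intro!: outer_mono)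

text \<open>
  With \<open>U = {h > 0}\<close>, the weights \<open>u k = min 1 (k h)\<close> increase to the indicator of \<open>U\<close>. Their increments
  together with \<open>1 - u K\<close> form a partition of unity: the increments recover \<open>A \<inter> U\<close> by countable
  subadditivity, and \<open>1 - u K\<close> equals one off \<open>U\<close> for every \<open>K\<close>.
\<close>

lemma outer_split_open:
  assumes U: "openin T U" and A: "A \<subseteq> topspace T"
  shows "outer (U \<inter> A) + outer (A - U) \<le> outer A"
proof -
  obtain h where h: "continuous_map T euclideanreal h"
    and h0: "\<And>x. x \<in> topspace T \<Longrightarrow> 0 \<le> h x" and hU: "\<And>x. x \<in> topspace T \<Longrightarrow> x \<in> U \<longleftrightarrow> 0 < h x"
    using cozero[OF U] by blast
  define u where "u k x = min 1 (real k * h x)" for k x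
  define g where "g k x = u (Suc k) x - u k x" for k x
  have u0: "0 \<le> u k x" and u1: "u k x \<le> 1" if "x \<in> topspace T" for k x
    using h0[OF that] by (auto simp: u_def)
  have uC: "u k \<in> Cb T" for k
  proof (rule CbI[where c=1])
    show "continuous_map T euclideanreal (u k)" unfolding u_def[abs_def] by (intro continuous_intros h)
    show "\<bar>u k x\<bar> \<le> 1" if "x \<in> topspace T" for x using u0[OF that, of k] u1[OF that, of k] by simp
  qed
  have g0: "0 \<le> g k x" if "x \<in> topspace T" for k x
    using mult_right_mono[of "real k" "real (Suc k)" "h x"] h0[OF that] by (auto simp: g_def u_def)
  have gp: "g k \<in> Cpos" for k
    using g0 uC by (auto simp: Cpos_def g_def[abs_def] intro!: Cb_diff)
  have gsum: "(\<Sum>k<K. g k x) = u K x" for K x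
    unfolding g_def by (subst sum_lessThan_telescope) (simp add: u_def)
  let ?\<phi> = "indicator A :: 'b \<Rightarrow> ennreal"
  have 1: "outer (U \<inter> A) \<le> (\<Sum>k. upint (\<lambda>x. ?\<phi> x * ennreal (g k x)))"
  proof -
    have "outer (U \<inter> A) \<le> upint (\<lambda>x. \<Sum>k. ?\<phi> x * ennreal (g k x))"
      unfolding outer_def
    proof (rule upint_mono)
      fix x assume x: "x \<in> topspace T"
      show "indicator (U \<inter> A) x \<le> (\<Sum>k. ?\<phi> x * ennreal (g k x))"
      proof (cases "x \<in> U \<inter> A")
        case True
        then have hx: "h x > 0" using hU x by auto
        then obtain K where "1 / h x < real K" using reals_Archimedean2 by blast
        then have "u K x = 1" using hx by (auto simp: u_def field_simps)
        then have "1 \<le> ennreal (\<Sum>k<K. g k x)" by (simp add: gsum)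
        also have "\<dots> = (\<Sum>k<K. ?\<phi> x * ennreal (g k x))"
          using True g0[OF x] by (simp add: sum_ennreal)
        also have "\<dots> \<le> (\<Sum>k. ?\<phi> x * ennreal (g k x))" by (rule sum_le_suminf) auto
        finally show ?thesis using True by simp
      qed simp
    qed
    also have "\<dots> \<le> (\<Sum>k. upint (\<lambda>x. ?\<phi> x * ennreal (g k x)))" by (rule upint_suminf)
    finally show ?thesis .
  qed
  have "(\<Sum>k. upint (\<lambda>x. ?\<phi> x * ennreal (g k x))) + outer (A - U) \<le> outer A"
  proof (rule ennreal_suminf_bound_add)
    fix K
    define g' where "g' k = (if k < K then g k else (\<lambda>x. 1 - u K x))" for k
    have "outer (A - U) \<le> upint (\<lambda>x. ?\<phi> x * ennreal (1 - u K x))"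
      unfolding outer_def
    proof (rule upint_mono)
      fix x assume x: "x \<in> topspace T"
      then have "x \<notin> U \<Longrightarrow> h x = 0" using hU[OF x] h0[OF x] by auto
      then show "indicator (A - U) x \<le> ?\<phi> x * ennreal (1 - u K x)"
        by (auto simp: indicator_def u_def)
    qed
    then have "(\<Sum>k<K. upint (\<lambda>x. ?\<phi> x * ennreal (g k x))) + outer (A - U) \<le>
       (\<Sum>k<Suc K. upint (\<lambda>x. ?\<phi> x * ennreal (g' k x)))"
      by (simp add: g'_def add_left_mono)
    also have "\<dots> \<le> upint ?\<phi>"
    proof (rule upint_partition)
      show "g' k \<in> Cpos" for k
        using gp u1 by (auto simp: g'_def Cpos_def intro!: Cb_diff Cb_const uC)
      show "(\<Sum>k<Suc K. g' k x) \<le> 1" if "x \<in> topspace T" for x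
        by (simp add: g'_def gsum)
    qed
    finally show "(\<Sum>k<K. upint (\<lambda>x. ?\<phi> x * ennreal (g k x))) + outer (A - U) \<le> outer A"
      by (simp add: outer_def)
  qed
  then show ?thesis using add_right_mono[OF 1, of "outer (A - U)"] by (rule order_trans[rotated])
qed

lemma openin_lambda_system:
  assumes "openin T U" shows "U \<in> lambda_system (topspace T) (Pow (topspace T)) outer"
proof -
  have "outer (U \<inter> A) + outer ((topspace T - U) \<inter> A) = outer A" if A: "A \<subseteq> topspace T" for A
  proof (rule antisym)
    have eq: "(topspace T - U) \<inter> A = A - U" using A by auto
    show "outer (U \<inter> A) + outer ((topspace T - U) \<inter> A) \<le> outer A"
      unfolding eq by (rule outer_split_open[OF assms A])
    have "outer A \<le> outer (\<Union>i. if i = 0 then U \<inter> A else if i = Suc 0 then A - U else {})"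
      by (rule outer_mono) (auto split: if_splits)
    also have "\<dots> \<le> (\<Sum>i. outer (if i = 0 then U \<inter> A else if i = Suc 0 then A - U else {}))"
      by (rule outer_UN)
    also have "\<dots> = outer (U \<inter> A) + outer (A - U)"
      by (subst suminf_finite[of "{0, Suc 0}"]) (auto simp: outer_empty)
    finally show "outer A \<le> outer (U \<inter> A) + outer ((topspace T - U) \<inter> A)" unfolding eq .
  qed
  then show ?thesis using openin_subset[OF assms] by (auto simp: lambda_system_def)
qed

definition repr :: "'b measure" where
  "repr = measure_of (topspace T) {U. openin T U} outer"

lemma sets_repr: "sets repr = sets (borel_of T)"
  unfolding repr_def sets_borel_of by (rule sets_measure_of) (auto dest: openin_subset)

lemma space_repr: "space repr = topspace T"
  unfolding repr_def by (simp add: space_measure_of_conv)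

lemma emeasure_repr:
  assumes "A \<in> sets repr" shows "emeasure repr A = outer A"
proof -
  let ?L = "lambda_system (topspace T) (Pow (topspace T)) outer"
  have ms: "measure_space (topspace T) ?L outer"
    by (rule sigma_algebra.caratheodory_lemma[OF sigma_algebra_Pow outer_measure_space_outer])
  have sub: "sigma_sets (topspace T) {U. openin T U} \<subseteq> ?L"
    using ms openin_lambda_system
    by (intro sigma_algebra.sigma_sets_subset) (auto simp: measure_space_def)
  have "measure_space (topspace T) (sigma_sets (topspace T) {U. openin T U}) outer"
    by (rule measure_down[OF ms _ sub], rule sigma_algebra_sigma_sets) (auto dest: openin_subset)
  then show ?thesis
    using assms sets_repr sets_borel_of[of T]
    by (intro emeasure_measure_of[OF repr_def]) (auto simp: measure_space_def sets_repr sets_borel_of dest: openin_subset)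
qed

lemma repr_prob_measures: "repr \<in> prob_measures T"
proof -
  have "topspace T \<in> sets repr" using sets.top[of repr] by (simp add: space_repr)
  then have "emeasure repr (space repr) = 1"
    by (simp add: emeasure_repr space_repr outer_topspace)
  then show ?thesis by (auto simp: prob_measures_def sets_repr intro!: prob_spaceI)
qed

sublocale R: prob_space repr
  using repr_prob_measures by (rule prob_measuresD)

lemma level_set_repr: "f \<in> Cb T \<Longrightarrow> {x \<in> topspace T. a < f x} \<in> sets repr"
  unfolding sets_repr
  using openin_continuous_map_preimage[OF Cb_continuous, of f T "{a<..}"]
  by (auto intro!: openin_sets_borel_of)

text \<open>
  The slices \<open>g j\<close> of \<open>f\<close> between the levels \<open>j/N\<close> and \<open>(j+1)/N\<close> satisfy
  \<open>indicator {f > (j+1)/N} \<le> N * g j \<le> indicator {f > j/N}\<close>. Hence \<open>L (g (j+1)) \<le> \<integral> g j\<close>, and summing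
  over the slices loses at most the bottom one, which is \<open>1/N\<close>.
\<close>

lemma L_le_integral_unit:
  assumes f: "f \<in> Cb T" and f0: "\<And>x. x \<in> topspace T \<Longrightarrow> 0 \<le> f x" and f1: "\<And>x. x \<in> topspace T \<Longrightarrow> f x \<le> 1"
  shows "L f \<le> integral\<^sup>L repr f"
proof (rule field_le_epsilon)
  fix e :: real assume "e > 0"
  then obtain n where n: "1 / real (Suc n) < e" using nat_approx_posE by metis
  define N where "N = Suc n"
  have N: "N > 0" "1 / real N < e" using n by (auto simp: N_def)
  define g where "g j x = min (f x) (real (Suc j) / real N) - min (f x) (real j / real N)" for j x
  have gC: "g j \<in> Cb T" for j unfolding g_def[abs_def] by (intro Cb_diff Cb_min f Cb_const)
  have gint: "integrable repr (g j)" for j by (rule Cb_integrable[OF repr_prob_measures gC])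
  have jN: "real j / real N \<le> real (Suc j) / real N" for j by (simp add: divide_right_mono)
  have jS: "real (Suc j) / real N = 1 / real N + real j / real N" for j by (simp add: add_divide_distrib)
  have g0: "0 \<le> g j x" for j x using jN[of j] by (simp add: g_def)
  have gs: "(\<Sum>j<N. g j x) = f x" if "x \<in> topspace T" for x
    unfolding g_def using f0[OF that] f1[OF that] N by (subst sum_lessThan_telescope) simp
  have mm: "min y (b + a) - min y a \<le> b \<and> (\<not> a < y \<longrightarrow> min y (b + a) - min y a = 0)"
    if "b > 0" for y a b :: real
    using that by (auto simp: min_def)
  define m where "m j = measure repr {x \<in> topspace T. real j / real N < f x}" for j
  have Lg: "real N * L (g j) \<le> m j" for j
  proof -
    have "ennreal (L (\<lambda>x. real N * g j x)) \<le> outer {x \<in> topspace T. real j / real N < f x}"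
      unfolding outer_def
    proof (rule L_le_upint)
      show "(\<lambda>x. real N * g j x) \<in> Cpos" using g0 by (auto simp: Cpos_def intro!: Cb_cmult gC)
      fix x assume x: "x \<in> topspace T"
      have "g j x \<le> 1 / real N" "\<not> real j / real N < f x \<Longrightarrow> g j x = 0"
        using mm[of "1 / real N" "f x" "real j / real N"] N(1) unfolding g_def jS by auto
      then show "ennreal (real N * g j x) \<le> indicator {x \<in> topspace T. real j / real N < f x} x"
        using x N by (auto simp: indicator_def field_simps intro!: ennreal_le_1[THEN iffD2])
    qed
    also have "\<dots> = ennreal (m j)"
      unfolding m_def using emeasure_repr[OF level_set_repr[OF f]] by (simp add: R.emeasure_eq_measure)
    finally show ?thesis
      by (simp add: L_cmult[OF gC] m_def ennreal_le_iff)
  qed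
  have Ig: "m (Suc j) \<le> real N * integral\<^sup>L repr (g j)" for j
  proof -
    have "m (Suc j) = (\<integral>x. indicator {x \<in> topspace T. real (Suc j) / real N < f x} x \<partial>repr)"
      unfolding m_def using level_set_repr[OF f] by simp
    also have "\<dots> \<le> (\<integral>x. real N * g j x \<partial>repr)"
    proof (rule integral_mono)
      show "integrable repr (indicat_real {x \<in> topspace T. real (Suc j) / real N < f x})"
        using level_set_repr[OF f] by (intro integrable_real_indicator) (auto simp: R.emeasure_eq_measure)
      fix x assume "x \<in> space repr"
      show "indicat_real {x \<in> topspace T. real (Suc j) / real N < f x} x \<le> real N * g j x"
      proof (cases "x \<in> topspace T \<and> real (Suc j) / real N < f x")
        case True
        moreover have "real j / real N < f x" using True jN[of j] by linarith
        ultimately have "g j x = 1 / real N" unfolding g_def jS by (simp add: min_def)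
        then show ?thesis using N(1) by (simp add: indicator_def)
      qed (use g0[of j x] in \<open>auto simp: indicator_def\<close>)
    qed (auto intro: gint)
    finally show ?thesis by simp
  qed
  have "real N * L f = (\<Sum>j<N. real N * L (g j))"
  proof -
    have "L f = L (\<lambda>x. \<Sum>j<N. g j x)"
      by (rule antisym; rule L_mono) (auto simp: gs intro!: f Cb_sum gC)
    then show ?thesis by (simp add: L_sum gC sum_distrib_left)
  qed
  also have "\<dots> \<le> (\<Sum>j<N. m j)" by (intro sum_mono Lg)
  also have "\<dots> = m 0 + (\<Sum>j<n. m (Suc j))" unfolding N_def by (rule sum.lessThan_Suc_shift)
  also have "\<dots> \<le> 1 + (\<Sum>j<n. real N * integral\<^sup>L repr (g j))"
    by (intro add_mono sum_mono Ig) (simp add: m_def)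
  also have "\<dots> \<le> 1 + (\<Sum>j<N. real N * integral\<^sup>L repr (g j))"
    by (auto simp: N_def intro!: mult_nonneg_nonneg Bochner_Integration.integral_nonneg g0)
  also have "\<dots> = 1 + real N * (\<Sum>j<N. integral\<^sup>L repr (g j))" by (simp add: sum_distrib_left)
  also have "(\<Sum>j<N. integral\<^sup>L repr (g j)) = integral\<^sup>L repr (\<lambda>x. \<Sum>j<N. g j x)"
    by (rule Bochner_Integration.integral_sum[symmetric]) (rule gint)
  also have "\<dots> = integral\<^sup>L repr f"
    by (intro Bochner_Integration.integral_cong) (auto simp: gs space_repr)
  finally have "L f \<le> 1 / real N + integral\<^sup>L repr f"
    using N by (simp add: field_simps)
  then show "L f \<le> integral\<^sup>L repr f + e" using N by simp
qed

text \<open>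
  For \<open>0 \<le> f \<le> 1\<close> the inequality for \<open>f\<close> and for \<open>1 - f\<close> gives equality; the general case is affine.
\<close>

lemma L_eq_integral:
  assumes f: "f \<in> Cb T" shows "integral\<^sup>L repr f = L f"
proof -
  have unit: "integral\<^sup>L repr g = L g"
    if g: "g \<in> Cb T" and g01: "\<And>x. x \<in> topspace T \<Longrightarrow> 0 \<le> g x \<and> g x \<le> 1" for g
  proof (rule antisym)
    show "L g \<le> integral\<^sup>L repr g" using g01 by (intro L_le_integral_unit g) auto
    have "L (\<lambda>x. 1 - g x) \<le> integral\<^sup>L repr (\<lambda>x. 1 - g x)"
      using g01 by (intro L_le_integral_unit Cb_diff Cb_const g) auto
    then show "integral\<^sup>L repr g \<le> L g"
      by (simp add: L_diff Cb_const g L_const Cb_integrable[OF repr_prob_measures] R.prob_space)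
  qed
  obtain c where c: "c > 0" "\<And>x. x \<in> topspace T \<Longrightarrow> \<bar>f x\<bar> \<le> c" using f by (elim CbE) blast
  define g where "g x = (1 / (2 * c)) * (f x + c)" for x
  have gC: "g \<in> Cb T" unfolding g_def[abs_def] by (intro Cb_cmult Cb_add f Cb_const)
  have "integral\<^sup>L repr g = L g"
    using c by (intro unit gC) (force simp: g_def field_simps abs_le_iff)
  moreover have "L g = (1 / (2 * c)) * (L f + c)"
    unfolding g_def by (simp only: L_cmult L_add f Cb_const Cb_add L_const)
  moreover have "integral\<^sup>L repr g = (1 / (2 * c)) * (integral\<^sup>L repr f + c)"
    unfolding g_def by (simp add: Cb_integrable[OF repr_prob_measures] f R.prob_space)
  ultimately show ?thesis using c by simp
qed

end

text \<open>
  The distance to the complement of \<open>U\<close> is Lipschitz and vanishes exactly off \<open>U\<close>.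
\<close>

lemma metrizable_cozero:
  assumes "metrizable_space T" "openin T U"
  obtains h where "continuous_map T euclideanreal h"
    "\<And>x. x \<in> topspace T \<Longrightarrow> 0 \<le> h x \<and> (x \<in> U \<longleftrightarrow> 0 < h x)"
proof -
  obtain M d where Md: "Metric_space M d" and T: "T = Metric_space.mtopology M d"
    using assms(1) by (auto simp: metrizable_space_def)
  interpret Metric_space M d by (rule Md)
  define h where "h x = (if U = M then 1 else Inf (d x ` (M - U)))" for x
  have UM: "U \<subseteq> M" using openin_subset[OF assms(2)] by (simp add: T)
  have bdd: "bdd_below (d x ` A)" for x A by (rule bdd_belowI[where m=0]) auto
  have lip: "h x \<le> h y + d x y" if "x \<in> M" "y \<in> M" for x y
  proof (cases "U = M")
    case False
    then have ne: "M - U \<noteq> {}" using UM by auto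
    have "Inf (d x ` (M - U)) - d x y \<le> Inf (d y ` (M - U))"
    proof (rule cINF_greatest[OF ne])
      fix z assume z: "z \<in> M - U"
      have "Inf (d x ` (M - U)) \<le> d x z" by (rule cINF_lower[OF bdd z])
      then show "Inf (d x ` (M - U)) - d x y \<le> d y z" using triangle[of x y z] that z by auto
    qed
    then show ?thesis using False by (simp add: h_def)
  qed (use that in \<open>simp add: h_def\<close>)
  have "continuous_map mtopology euclideanreal h"
  proof -
    have "continuous_map mtopology Met_TC.mtopology h"
    proof (subst metric_continuous_map[OF Met_TC.Metric_space_axioms], intro conjI ballI allI impI)
      fix a e assume "a \<in> M" "0 < (e::real)"
      then show "\<exists>\<delta>>0. \<forall>x. x \<in> M \<and> d a x < \<delta> \<longrightarrow> dist (h a) (h x) < e"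
        using lip by (intro exI[of _ e]) (force simp: dist_real_def abs_less_iff commute)
    qed auto
    then show ?thesis by (simp add: mtopology_is_euclidean)
  qed
  moreover have "0 \<le> h x \<and> (x \<in> U \<longleftrightarrow> 0 < h x)" if x: "x \<in> M" for x
  proof (cases "U = M")
    case False
    then have ne: "M - U \<noteq> {}" using UM by auto
    have "0 \<le> h x" using False ne by (auto simp: h_def intro: cINF_greatest)
    moreover have "0 < h x" if xU: "x \<in> U"
    proof -
      obtain r where r: "r > 0" "mball x r \<subseteq> U"
        using assms(2) xU unfolding T openin_mtopology by blast
      have "r \<le> Inf (d x ` (M - U))"
      proof (rule cINF_greatest[OF ne])
        fix z assume "z \<in> M - U" then show "r \<le> d x z" using r(2) x by (auto simp: not_less[symmetric])
      qed
      then show ?thesis using r False by (simp add: h_def)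
    qed
    moreover have "h x \<le> 0" if xU: "x \<notin> U"
      using cINF_lower[OF bdd, of x "M - U" x] x xU False by (simp add: h_def)
    ultimately show ?thesis by force
  qed (use x in \<open>simp add: h_def\<close>)
  ultimately show ?thesis by (intro that[of h]) (auto simp: T)
qed

text \<open>
  Prokhorov's theorem. The map \<open>\<Phi>\<close> sends a measure to its integrals of all bounded continuous functions, and
  the weak topology is the pullback of the product topology under \<open>\<Phi>\<close>. So it suffices that \<open>\<Phi>\<close> maps the weak
  closure of \<open>S\<close> onto the closure \<open>C\<close> of the image of \<open>S\<close>, which is compact by Tychonoff's theorem. Each
  property of a \<open>tight_functional\<close> holds on \<open>C\<close> because it is a closed condition on finitely many coordinates.
\<close>

theorem tight_imp_weakly_rel_compact:
  assumes metr: "metrizable_space T" and S: "S \<subseteq> prob_measures T"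
    and tight: "\<And>e. e > 0 \<Longrightarrow> \<exists>K. compactin T K \<and> (\<forall>\<mu>\<in>S. measure \<mu> (topspace T - K) \<le> e)"
  shows "weakly_rel_compact T S"
proof -
  define P where "P = product_topology (\<lambda>_. euclideanreal) (Cb T)"
  define \<Phi> where "\<Phi> \<mu> = restrict (integral\<^sup>L \<mu>) (Cb T)" for \<mu> :: "'a measure"
  define C where "C = P closure_of (\<Phi> ` S)"
  define W where "W = weak_topology T"
  let ?G = "{{\<mu> \<in> prob_measures T. integral\<^sup>L \<mu> f \<in> V} | f V.
        continuous_map T euclideanreal f \<and> bounded (f ` topspace T) \<and> open V}"
  have \<Phi>P: "\<Phi> \<mu> \<in> topspace P" for \<mu> by (auto simp: P_def \<Phi>_def)
  have ev: "continuous_map P euclideanreal (\<lambda>\<Lambda>. \<Lambda> f)" if "f \<in> Cb T" for f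
    using continuous_map_product_projection[OF that, of "\<lambda>_. euclideanreal"] by (simp add: P_def)
  have closed_cond: "H \<Lambda> \<le> 0"
    if H: "continuous_map P euclideanreal H" "\<And>\<mu>. \<mu> \<in> S \<Longrightarrow> H (\<Phi> \<mu>) \<le> 0" and "\<Lambda> \<in> C" for H \<Lambda>
  proof -
    have "closedin P {x \<in> topspace P. H x \<in> {..0}}"
      by (rule closedin_continuous_map_preimage[OF H(1)]) auto
    then have "C \<subseteq> {x \<in> topspace P. H x \<in> {..0}}"
      unfolding C_def using H(2) \<Phi>P by (intro closure_of_minimal) auto
    then show ?thesis using that by auto
  qed
  have closed_eq: "H \<Lambda> = 0"
    if H: "continuous_map P euclideanreal H" "\<And>\<mu>. \<mu> \<in> S \<Longrightarrow> H (\<Phi> \<mu>) = 0" and "\<Lambda> \<in> C" for H \<Lambda>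
    using closed_cond[of H \<Lambda>] closed_cond[of "\<lambda>x. - H x" \<Lambda>] that by (force intro: continuous_intros)
  have int: "integrable \<mu> f" if "\<mu> \<in> S" "f \<in> Cb T" for \<mu> f using Cb_integrable that S by blast
  have repr: "\<exists>\<mu>\<in>prob_measures T. \<Phi> \<mu> = \<Lambda>" if \<Lambda>: "\<Lambda> \<in> C" for \<Lambda>
  proof -
    interpret tight_functional T \<Lambda>
    proof
      fix f g assume f: "f \<in> Cb T" and g: "g \<in> Cb T"
      have "\<Lambda> (\<lambda>x. f x + g x) - (\<Lambda> f + \<Lambda> g) = 0"
        by (rule closed_eq[OF _ _ \<Lambda>])
           (auto simp: \<Phi>_def Cb_add f g int intro!: continuous_intros ev)
      then show "\<Lambda> (\<lambda>x. f x + g x) = \<Lambda> f + \<Lambda> g" by simp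
    next
      fix f c assume f: "f \<in> Cb T"
      have "\<Lambda> (\<lambda>x. c * f x) - c * \<Lambda> f = 0"
        by (rule closed_eq[OF _ _ \<Lambda>])
           (auto simp: \<Phi>_def Cb_cmult f int intro!: continuous_map_diff continuous_map_real_mult_left ev)
      then show "\<Lambda> (\<lambda>x. c * f x) = c * \<Lambda> f" by simp
    next
      fix f assume f: "f \<in> Cb T" "\<And>x. x \<in> topspace T \<Longrightarrow> 0 \<le> f x"
      have "- \<Lambda> f \<le> 0"
      proof (rule closed_cond[OF _ _ \<Lambda>])
        fix \<mu> assume "\<mu> \<in> S"
        then have "space \<mu> = topspace T" using S prob_measuresD by blast
        then show "- \<Phi> \<mu> f \<le> 0" using f by (auto simp: \<Phi>_def intro!: Bochner_Integration.integral_nonneg)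
      qed (auto intro!: continuous_intros ev f)
      then show "0 \<le> \<Lambda> f" by simp
    next
      have "\<Lambda> (\<lambda>_. 1) - 1 = 0"
      proof (rule closed_eq[OF _ _ \<Lambda>])
        fix \<mu> assume "\<mu> \<in> S"
        then interpret prob_space \<mu> using S prob_measuresD by blast
        show "\<Phi> \<mu> (\<lambda>_. 1) - 1 = 0" by (simp add: \<Phi>_def Cb_const prob_space)
      qed (auto intro!: continuous_intros ev Cb_const)
      then show "\<Lambda> (\<lambda>_. 1) = 1" by simp
    next
      fix e :: real assume "e > 0"
      then obtain K where K: "compactin T K" "\<And>\<mu>. \<mu> \<in> S \<Longrightarrow> measure \<mu> (topspace T - K) \<le> e"
        using tight by blast
      have "\<Lambda> f \<le> \<delta> + c * e" if f: "f \<in> Cb T" and fc: "\<forall>x\<in>topspace T. 0 \<le> f x \<and> f x \<le> c"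
        and f\<delta>: "\<forall>x\<in>K. f x \<le> \<delta>" and "0 \<le> \<delta>" for f c \<delta>
      proof -
        have "\<Lambda> f - (\<delta> + c * e) \<le> 0"
        proof (rule closed_cond[OF _ _ \<Lambda>])
          fix \<mu> assume \<mu>: "\<mu> \<in> S"
          then interpret prob_space \<mu> using S prob_measuresD by blast
          have sp: "space \<mu> = topspace T" "sets \<mu> = sets (borel_of T)" using \<mu> S prob_measuresD by blast+
          obtain x where "x \<in> topspace T" using not_empty unfolding sp by blast
          then have c0: "0 \<le> c" using fc by force
          have Ks: "topspace T - K \<in> sets \<mu>"
            unfolding sp
            using compactin_imp_closedin[OF metrizable_imp_Hausdorff_space[OF metr] K(1)]
            by (auto intro!: openin_sets_borel_of simp: closedin_def)
          have "\<Phi> \<mu> f = integral\<^sup>L \<mu> f" using f by (simp add: \<Phi>_def)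
          also have "\<dots> \<le> integral\<^sup>L \<mu> (\<lambda>x. \<delta> + c * indicator (topspace T - K) x)"
          proof (rule integral_mono)
            show "integrable \<mu> f" by (rule int[OF \<mu> f])
            show "integrable \<mu> (\<lambda>x. \<delta> + c * indicator (topspace T - K) x)"
              using Ks by (auto simp: emeasure_eq_measure intro!: integrable_real_indicator)
            fix x assume "x \<in> space \<mu>"
            then show "f x \<le> \<delta> + c * indicator (topspace T - K) x"
              using fc f\<delta> \<open>0 \<le> \<delta>\<close> by (force simp: sp indicator_def)
          qed
          also have "\<dots> = \<delta> + c * measure \<mu> (topspace T - K)"
            using Ks by (simp add: prob_space emeasure_eq_measure integrable_real_indicator)
          also have "\<dots> \<le> \<delta> + c * e" using K(2)[OF \<mu>] c0 by (simp add: mult_left_mono)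
          finally show "\<Phi> \<mu> f - (\<delta> + c * e) \<le> 0" by simp
        qed (auto intro!: continuous_intros ev f)
        then show ?thesis by simp
      qed
      then show "\<exists>K. compactin T K \<and> (\<forall>f\<in>Cb T. \<forall>c \<delta>. (\<forall>x\<in>topspace T. 0 \<le> f x \<and> f x \<le> c) \<longrightarrow>
          (\<forall>x\<in>K. f x \<le> \<delta>) \<longrightarrow> 0 \<le> \<delta> \<longrightarrow> \<Lambda> f \<le> \<delta> + c * e)"
        using K(1) by blast
    next
      fix U assume "openin T U"
      then show "\<exists>h. continuous_map T euclideanreal h \<and>
        (\<forall>x\<in>topspace T. 0 \<le> h x \<and> (x \<in> U \<longleftrightarrow> 0 < h x))"
        using metrizable_cozero[OF metr] by metis
    qed
    have "\<Lambda> \<in> extensional (Cb T)"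
      using \<Lambda> closure_of_subset_topspace[of P "\<Phi> ` S"] by (auto simp: C_def P_def PiE_def)
    then have "\<Phi> repr = \<Lambda>"
      by (intro extensionalityI[of _ "Cb T"]) (auto simp: \<Phi>_def L_eq_integral)
    then show ?thesis using repr_prob_measures by blast
  qed
  have compC: "compactin P C"
  proof -
    have "\<exists>c. \<forall>x\<in>topspace T. \<bar>f x\<bar> \<le> c" if "f \<in> Cb T" for f using that by (elim CbE) blast
    then obtain c where c: "\<And>f x. f \<in> Cb T \<Longrightarrow> x \<in> topspace T \<Longrightarrow> \<bar>f x\<bar> \<le> c f" by metis
    let ?B = "PiE (Cb T) (\<lambda>f. {- c f..c f})"
    have B: "compactin P ?B" unfolding P_def by (simp add: compactin_PiE)
    have "C \<subseteq> ?B"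
      unfolding C_def
    proof (rule closure_of_minimal)
      show "closedin P ?B"
        unfolding P_def by (simp add: closedin_product_topology)
      show "\<Phi> ` S \<subseteq> ?B"
      proof clarify
        fix \<mu> assume \<mu>: "\<mu> \<in> S"
        then interpret prob_space \<mu> using S prob_measuresD by blast
        have sp: "space \<mu> = topspace T" using \<mu> S prob_measuresD by blast
        have "\<bar>integral\<^sup>L \<mu> f\<bar> \<le> c f" if f: "f \<in> Cb T" for f
        proof -
          have "\<bar>integral\<^sup>L \<mu> f\<bar> \<le> integral\<^sup>L \<mu> (\<lambda>x. \<bar>f x\<bar>)" by (rule integral_abs_bound)
          also have "\<dots> \<le> integral\<^sup>L \<mu> (\<lambda>x. c f)"
            using c[OF f] int[OF \<mu> f] by (intro integral_mono) (auto simp: sp)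
          finally show ?thesis by (simp add: prob_space)
        qed
        then show "\<Phi> \<mu> \<in> ?B" by (auto simp: \<Phi>_def abs_le_iff minus_le_iff)
      qed
    qed
    then show ?thesis unfolding C_def by (rule closed_compactin[OF B]) simp
  qed
  have open_pull: "\<exists>V. openin P V \<and> U = {\<mu> \<in> prob_measures T. \<Phi> \<mu> \<in> V}" if "openin W U" for U
  proof -
    have gen: "generate_topology_on ?G U"
      using that unfolding W_def weak_topology_def by (rule openin_topology_generated_by)
    have "openin (pullback_topology (prob_measures T) \<Phi> P) U"
    proof (rule generate_topology_on_coarsest[OF istopology_openin _ gen])
      fix s assume "s \<in> ?G"
      then obtain f V where f: "f \<in> Cb T" and V: "open V" and s: "s = {\<mu> \<in> prob_measures T. integral\<^sup>L \<mu> f \<in> V}"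
        by (auto simp: Cb_def)
      have "openin P {x \<in> topspace P. x f \<in> V}"
        using openin_continuous_map_preimage[OF ev[OF f], of V] V by simp
      moreover have "s = \<Phi> -` {x \<in> topspace P. x f \<in> V} \<inter> prob_measures T"
        using \<Phi>P f by (auto simp: s \<Phi>_def)
      ultimately show "openin (pullback_topology (prob_measures T) \<Phi> P) s"
        unfolding openin_pullback_topology by blast
    qed
    then show ?thesis unfolding openin_pullback_topology by blast
  qed
  have cont: "continuous_map W P \<Phi>"
    unfolding P_def continuous_map_componentwise
  proof (intro conjI ballI)
    show "\<Phi> ` topspace W \<subseteq> extensional (Cb T)" by (auto simp: \<Phi>_def)
    fix f assume f: "f \<in> Cb T"
    show "continuous_map W euclideanreal (\<lambda>\<mu>. \<Phi> \<mu> f)"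
      unfolding continuous_map_def
    proof (intro conjI allI impI)
      fix V :: "real set" assume "openin euclideanreal V"
      then have "{\<mu> \<in> prob_measures T. integral\<^sup>L \<mu> f \<in> V} \<in> ?G"
        using f by (auto simp: Cb_def)
      from topology_generated_by_Basis[OF this]
      have "openin W {\<mu> \<in> prob_measures T. integral\<^sup>L \<mu> f \<in> V}"
        unfolding W_def weak_topology_def .
      then show "openin W {\<mu> \<in> topspace W. \<Phi> \<mu> f \<in> V}"
        using f by (simp add: W_def \<Phi>_def)
    qed auto
  qed
  let ?K = "W closure_of S"
  have KC: "\<Phi> \<mu> \<in> C" if "\<mu> \<in> ?K" for \<mu>
    using continuous_map_image_closure_subset[OF cont, of S] that by (auto simp: C_def)
  have CK: "\<exists>\<mu>\<in>?K. \<Phi> \<mu> = \<Lambda>" if "\<Lambda> \<in> C" for \<Lambda>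
  proof -
    obtain \<mu> where \<mu>: "\<mu> \<in> prob_measures T" "\<Phi> \<mu> = \<Lambda>" using repr[OF \<open>\<Lambda> \<in> C\<close>] by blast
    have "\<exists>\<nu>\<in>S. \<nu> \<in> U" if U: "openin W U" "\<mu> \<in> U" for U
    proof -
      obtain V where V: "openin P V" "U = {\<mu> \<in> prob_measures T. \<Phi> \<mu> \<in> V}" using open_pull[OF U(1)] by blast
      then have "\<Lambda> \<in> V" using U(2) \<mu>(2) by simp
      then obtain \<nu> where "\<nu> \<in> S" "\<Phi> \<nu> \<in> V"
        using \<open>\<Lambda> \<in> C\<close> V(1) unfolding C_def in_closure_of by blast
      then show ?thesis using V(2) S by auto
    qed
    then have "\<mu> \<in> ?K" unfolding in_closure_of using \<mu>(1) by (auto simp: W_def)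
    then show ?thesis using \<mu>(2) by blast
  qed
  have "compactin W ?K"
    unfolding compactin_def
  proof (intro conjI allI impI)
    show "?K \<subseteq> topspace W" by (rule closure_of_subset_topspace)
    fix \<U> assume \<U>: "Ball \<U> (openin W) \<and> ?K \<subseteq> \<Union>\<U>"
    then obtain V where V: "\<And>U. U \<in> \<U> \<Longrightarrow> openin P (V U)" "\<And>U. U \<in> \<U> \<Longrightarrow> U = {\<mu> \<in> prob_measures T. \<Phi> \<mu> \<in> V U}"
      using open_pull by metis
    have "C \<subseteq> \<Union>(V ` \<U>)"
    proof
      fix \<Lambda> assume "\<Lambda> \<in> C"
      then obtain \<mu> where \<mu>: "\<mu> \<in> ?K" "\<Phi> \<mu> = \<Lambda>" using CK by blast
      then obtain U where U: "U \<in> \<U>" "\<mu> \<in> U" using \<U> by blast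
      then have "\<Lambda> \<in> V U" using V(2)[OF U(1)] \<mu>(2) by blast
      then show "\<Lambda> \<in> \<Union>(V ` \<U>)" using U(1) by blast
    qed
    then obtain \<F> where F: "finite \<F>" "\<F> \<subseteq> V ` \<U>" "C \<subseteq> \<Union>\<F>"
      using compC V(1) unfolding compactin_def by (metis (no_types, lifting) imageE)
    then obtain \<G> where G: "\<G> \<subseteq> \<U>" "finite \<G>" "\<F> = V ` \<G>" by (meson finite_subset_image)
    have "?K \<subseteq> \<Union>\<G>"
    proof
      fix \<mu> assume \<mu>: "\<mu> \<in> ?K"
      then obtain U where U: "U \<in> \<G>" "\<Phi> \<mu> \<in> V U" using KC F(3) G(3) by blast
      have "\<mu> \<in> prob_measures T" using \<mu> closure_of_subset_topspace[of W S] by (auto simp: W_def)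
      then have "\<mu> \<in> U" using V(2)[of U] U G(1) by blast
      then show "\<mu> \<in> \<Union>\<G>" using U by blast
    qed
    then show "\<exists>\<F>. finite \<F> \<and> \<F> \<subseteq> \<U> \<and> ?K \<subseteq> \<Union>\<F>" using G by blast
  qed
  then show ?thesis using S by (simp add: weakly_rel_compact_def W_def)
qed

section \<open>Continuous functions on a compact semi-metric space\<close>

lemma openin_semidist_ball:
  assumes tri: "\<And>x y z. x \<in> X \<Longrightarrow> y \<in> X \<Longrightarrow> z \<in> X \<Longrightarrow> d x z \<le> d x y + d y z" and a: "a \<in> X"
  shows "openin (semidist_topology X d) {y \<in> X. d a y < ennreal r}"
  unfolding openin_semidist_topology
proof (intro conjI ballI)
  fix x assume x: "x \<in> {y \<in> X. d a y < ennreal r}"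
  obtain s where s: "d a x = ennreal s" "0 \<le> s" using x by (cases "d a x") auto
  then have sr: "s < r" using x by (simp add: ennreal_less_iff)
  have "d a y < ennreal r" if that: "y \<in> X" "d x y < ennreal (r - s)" for y
  proof -
    have "d x y < top" using that(2) by (rule less_trans) simp
    then obtain t where t: "d x y = ennreal t" "0 \<le> t" by (cases "d x y") auto
    have "d a y \<le> ennreal s + ennreal t" using tri[of a x y] a x that s t by auto
    also have "\<dots> < ennreal r" using that t s sr by (simp add: ennreal_less_iff flip: ennreal_plus)
    finally show ?thesis .
  qed
  then show "\<exists>r'>0. \<forall>y\<in>X. d x y < ennreal r' \<longrightarrow> y \<in> {y \<in> X. d a y < ennreal r}"
    using sr by (intro exI[of _ "r - s"]) auto
qed auto

lemma continuous_map_semidist: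
  "continuous_map (semidist_topology X d) euclideanreal f \<longleftrightarrow>
     (\<forall>x\<in>X. \<forall>e>0. \<exists>r>0. \<forall>y\<in>X. d x y < ennreal r \<longrightarrow> \<bar>f x - f y\<bar> < e)" (is "_ \<longleftrightarrow> ?R")
proof
  assume L: "continuous_map (semidist_topology X d) euclideanreal f"
  show ?R
  proof (intro ballI allI impI)
    fix x e assume x: "x \<in> X" and e: "0 < (e::real)"
    have "openin (semidist_topology X d) {y \<in> topspace (semidist_topology X d). f y \<in> ball (f x) e}"
      by (rule openin_continuous_map_preimage[OF L]) auto
    then have "\<exists>r>0. \<forall>y\<in>X. d x y < ennreal r \<longrightarrow> y \<in> {y \<in> X. f y \<in> ball (f x) e}"
      using x e unfolding openin_semidist_topology topspace_semidist_topology by auto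
    then show "\<exists>r>0. \<forall>y\<in>X. d x y < ennreal r \<longrightarrow> \<bar>f x - f y\<bar> < e"
      by (auto simp: dist_real_def)
  qed
next
  assume R: ?R
  show "continuous_map (semidist_topology X d) euclideanreal f"
    unfolding continuous_map_def
  proof (intro conjI allI impI)
    fix U :: "real set" assume "openin euclideanreal U"
    then have U: "open U" by simp
    show "openin (semidist_topology X d) {x \<in> topspace (semidist_topology X d). f x \<in> U}"
      unfolding openin_semidist_topology topspace_semidist_topology
    proof (intro conjI ballI)
      fix x assume x: "x \<in> {x \<in> X. f x \<in> U}"
      then obtain e where e: "e > 0" "ball (f x) e \<subseteq> U" using U openE by blast
      then obtain r where "r > 0" "\<forall>y\<in>X. d x y < ennreal r \<longrightarrow> \<bar>f x - f y\<bar> < e" using R x by blast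
      then show "\<exists>r>0. \<forall>y\<in>X. d x y < ennreal r \<longrightarrow> y \<in> {x \<in> X. f x \<in> U}"
        using e(2) by (intro exI[of _ r]) (auto simp: dist_real_def subset_eq)
    qed auto
  qed auto
qed

text \<open>
  Classifying the members of \<open>S\<close> by the values of an invariant \<open>V\<close> gives a net whose centers lie in \<open>S\<close>
  itself, as total boundedness requires.
\<close>

lemma finite_class_representatives:
  assumes "finite (V ` S)" and "\<And>g h. g \<in> S \<Longrightarrow> h \<in> S \<Longrightarrow> V g = V h \<Longrightarrow> P g h"
  shows "\<exists>F. finite F \<and> F \<subseteq> S \<and> (\<forall>g\<in>S. \<exists>h\<in>F. P g h)"
proof (intro exI conjI ballI)
  show "finite (inv_into S V ` V ` S)" using assms(1) by (rule finite_imageI)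
  show "inv_into S V ` V ` S \<subseteq> S" by (auto simp: inv_into_into)
  fix g assume "g \<in> S"
  then show "\<exists>h\<in>inv_into S V ` V ` S. P g h"
    by (intro bexI[of _ "inv_into S V (V g)"] assms(2)) (auto simp: inv_into_into f_inv_into_f)
qed

lemma countable_class_representatives:
  assumes "countable (V ` S)" and "\<And>g h. g \<in> S \<Longrightarrow> h \<in> S \<Longrightarrow> V g = V h \<Longrightarrow> P g h"
  shows "\<exists>F. countable F \<and> F \<subseteq> S \<and> (\<forall>g\<in>S. \<exists>h\<in>F. P g h)"
proof (intro exI conjI ballI)
  show "countable (inv_into S V ` V ` S)" using assms(1) by (rule countable_image)
  show "inv_into S V ` V ` S \<subseteq> S" by (auto simp: inv_into_into)
  fix g assume "g \<in> S"
  then show "\<exists>h\<in>inv_into S V ` V ` S. P g h"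
    by (intro bexI[of _ "inv_into S V (V g)"] assms(2)) (auto simp: inv_into_into f_inv_into_f)
qed

locale compact_semidist =
  fixes X :: "'x set" and d :: "'x \<Rightarrow> 'x \<Rightarrow> ennreal"
  assumes d_refl: "x \<in> X \<Longrightarrow> d x x = 0"
    and d_sym: "x \<in> X \<Longrightarrow> y \<in> X \<Longrightarrow> d x y = d y x"
    and d_tri: "x \<in> X \<Longrightarrow> y \<in> X \<Longrightarrow> z \<in> X \<Longrightarrow> d x z \<le> d x y + d y z"
    and compact: "compact_space (semidist_topology X d)"
    and nonempty: "X \<noteq> {}"
begin

lemma d_tri_le:
  assumes "x \<in> X" "y \<in> X" "z \<in> X" "d x y \<le> ennreal r" "d y z \<le> ennreal s" "0 \<le> r" "0 \<le> s"
  shows "d x z \<le> ennreal (r + s)"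
  using order_trans[OF d_tri[OF assms(1-3)] add_mono[OF assms(4,5)]] assms(6,7) by (simp add: ennreal_plus)

lemma compact_cover:
  assumes "\<And>x. x \<in> X \<Longrightarrow> r x > 0"
  shows "\<exists>A. finite A \<and> A \<subseteq> X \<and> (\<forall>x\<in>X. \<exists>a\<in>A. d a x < ennreal (r a))"
proof -
  let ?U = "(\<lambda>a. {y \<in> X. d a y < ennreal (r a)}) ` X"
  have op: "openin (semidist_topology X d) U" if "U \<in> ?U" for U
    using that openin_semidist_ball[OF d_tri] by auto
  have cov: "X \<subseteq> \<Union>?U" using assms d_refl by fastforce
  have "compactin (semidist_topology X d) X" using compact by (simp add: compact_space_def)
  then obtain F where F: "finite F" "F \<subseteq> ?U" "X \<subseteq> \<Union>F"
    using op cov unfolding compactin_def by meson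
  then obtain A where A: "A \<subseteq> X" "finite A" "F = (\<lambda>a. {y \<in> X. d a y < ennreal (r a)}) ` A"
    by (meson finite_subset_image)
  show ?thesis using A F(3) by (intro exI[of _ A]) blast
qed

lemma finite_net:
  assumes "e > 0"
  shows "\<exists>A. finite A \<and> A \<subseteq> X \<and> (\<forall>x\<in>X. \<exists>a\<in>A. d a x \<le> ennreal e)"
  using compact_cover[of "\<lambda>_. e"] assms by (meson less_imp_le)

text \<open>
  The Lebesgue number argument: \<open>x\<close> lies in a ball of half the radius on which \<open>g\<close> varies little, and \<open>y\<close> is
  too close to \<open>x\<close> to leave the ball of full radius with the same center.
\<close>

lemma uniformly_continuous:
  assumes g: "continuous_map (semidist_topology X d) euclideanreal g" and e: "e > 0"
  shows "\<exists>r>0. \<forall>x\<in>X. \<forall>y\<in>X. d x y \<le> ennreal r \<longrightarrow> \<bar>g x - g y\<bar> \<le> e"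
proof -
  have "\<forall>x\<in>X. \<exists>r>0. \<forall>y\<in>X. d x y < ennreal r \<longrightarrow> \<bar>g x - g y\<bar> < e/2"
    using g half_gt_zero[OF e] unfolding continuous_map_semidist by blast
  then obtain r where r: "\<And>x. x \<in> X \<Longrightarrow> r x > 0"
    and rg: "\<And>x y. x \<in> X \<Longrightarrow> y \<in> X \<Longrightarrow> d x y < ennreal (r x) \<Longrightarrow> \<bar>g x - g y\<bar> < e/2"
    by metis
  obtain A where A: "finite A" "A \<subseteq> X" "\<forall>x\<in>X. \<exists>a\<in>A. d a x < ennreal (r a / 2)"
    using compact_cover[of "\<lambda>x. r x / 2"] r by auto
  have Ane: "A \<noteq> {}" using A(3) nonempty by auto
  define s where "s = Min ((\<lambda>a. r a / 4) ` A)"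
  have s: "s > 0" using A Ane r by (auto simp: s_def)
  have "\<bar>g x - g y\<bar> \<le> e" if xy: "x \<in> X" "y \<in> X" "d x y \<le> ennreal s" for x y
  proof -
    obtain a where a: "a \<in> A" "d a x < ennreal (r a / 2)" using A xy by blast
    then have aX: "a \<in> X" using A by auto
    have "s \<le> r a / 4" unfolding s_def using A a by (intro Min_le) auto
    then have "s < r a / 2" using r[OF aX] by linarith
    then have "ennreal s < ennreal (r a / 2)" using s by (intro ennreal_lessI) auto
    with xy(3) have "d x y < ennreal (r a / 2)" by (rule le_less_trans)
    have "d a y \<le> d a x + d x y" by (rule d_tri[OF aX xy(1,2)])
    also have "\<dots> < ennreal (r a / 2) + ennreal (r a / 2)"
      using a(2) \<open>d x y < _\<close> by (rule add_strict_mono)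
    also have "\<dots> = ennreal (r a)" using r[OF aX] by (simp flip: ennreal_plus)
    finally have 1: "\<bar>g a - g y\<bar> < e/2" using rg aX xy by blast
    have "ennreal (r a / 2) \<le> ennreal (r a)" using r[OF aX] by (intro ennreal_leI) auto
    then have "\<bar>g a - g x\<bar> < e/2" using rg[OF aX xy(1)] a(2) by (auto intro: less_le_trans)
    with 1 show ?thesis by linarith
  qed
  then show ?thesis using s by blast
qed

abbreviation cdist :: "('x \<Rightarrow> real) \<Rightarrow> ('x \<Rightarrow> real) \<Rightarrow> real" where
  "cdist \<equiv> mdist (cfunspace (semidist_topology X d) euclidean_metric)"

abbreviation CX :: "('x \<Rightarrow> real) topology" where
  "CX \<equiv> C_space X d"

lemma topspace_C: "topspace CX = {f \<in> extensional X. continuous_map (semidist_topology X d) euclideanreal f}"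
proof -
  have "compactin (semidist_topology X d) (topspace (semidist_topology X d))"
    using compact by (simp add: compact_space_def)
  from compactin_mspace_cfunspace[OF this, of euclidean_metric]
  show ?thesis by (auto simp: C_space_def mtopology_of_euclidean)
qed

lemma C_metric: "Metric_space (topspace CX) cdist"
  by (simp add: C_space_def del: mspace_cfunspace)

lemma C_mtopology: "CX = Metric_space.mtopology (topspace CX) cdist"
proof -
  let ?m = "cfunspace (semidist_topology X d) (euclidean_metric :: real metric)"
  have 1: "CX = Metric_space.mtopology (mspace ?m) (mdist ?m)" by (simp add: C_space_def mtopology_of_def)
  have 2: "topspace CX = mspace ?m" unfolding C_space_def by (rule topspace_mtopology_of)
  show ?thesis unfolding 2 by (rule 1)
qed

lemma C_complete: "Metric_space.mcomplete (topspace CX) cdist"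
proof -
  have "mcomplete_of (cfunspace (semidist_topology X d) (Met_TC.Self :: real metric))"
    by (rule Met_TC.mcomplete_cfunspace) (simp add: complete_UNIV)
  moreover have "Met_TC.Self = (euclidean_metric :: real metric)"
    by (simp add: Met_TC.Self_def euclidean_metric_def)
  moreover have "topspace CX = mspace (cfunspace (semidist_topology X d) (euclidean_metric :: real metric))"
    unfolding C_space_def by (rule topspace_mtopology_of)
  ultimately show ?thesis by (simp add: mcomplete_of_def del: mspace_cfunspace)
qed

lemma C_metrizable: "metrizable_space CX"
  using Metric_space.metrizable_space_mtopology[OF C_metric] C_mtopology by simp

lemma cdist_le:
  assumes "f \<in> topspace CX" "g \<in> topspace CX"
  shows "cdist f g \<le> c \<longleftrightarrow> (\<forall>x\<in>X. \<bar>f x - g x\<bar> \<le> c)"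
  using cfunspace_mdist_le[of f "semidist_topology X d" euclidean_metric g c] assms nonempty
  by (simp add: C_space_def dist_real_def del: mspace_cfunspace)

text \<open>
  Two functions with the same modulus of continuity at scale \<open>r\<close> are uniformly close if their values on an
  \<open>r\<close>-net agree up to rounding. As rounded values on a finite net are countably many, and finitely many for
  uniformly bounded functions, this gives both separability and total boundedness.
\<close>

lemma close_of_same_class:
  assumes A: "A \<subseteq> X" "\<forall>x\<in>X. \<exists>a\<in>A. d a x \<le> ennreal r" and e: "e > 0"
    and g: "\<And>x y. x \<in> X \<Longrightarrow> y \<in> X \<Longrightarrow> d x y \<le> ennreal r \<Longrightarrow> \<bar>g x - g y\<bar> \<le> e"
    and h: "\<And>x y. x \<in> X \<Longrightarrow> y \<in> X \<Longrightarrow> d x y \<le> ennreal r \<Longrightarrow> \<bar>h x - h y\<bar> \<le> e"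
    and eq: "restrict (\<lambda>a. \<lfloor>g a / e\<rfloor>) A = restrict (\<lambda>a. \<lfloor>h a / e\<rfloor>) A" and x: "x \<in> X"
  shows "\<bar>g x - h x\<bar> \<le> 3 * e"
proof -
  obtain a where a: "a \<in> A" "d a x \<le> ennreal r" using A x by blast
  have "\<lfloor>g a / e\<rfloor> = \<lfloor>h a / e\<rfloor>" using fun_cong[OF eq, of a] a by simp
  then obtain k where "\<lfloor>g a / e\<rfloor> = k" "\<lfloor>h a / e\<rfloor> = k" by blast
  then have "\<bar>g a / e - h a / e\<bar> < 1" unfolding floor_eq_iff by linarith
  then have "\<bar>g a - h a\<bar> < e" using e by (simp add: abs_if field_simps split: if_splits)
  moreover have "\<bar>g a - g x\<bar> \<le> e" "\<bar>h a - h x\<bar> \<le> e" using g[of a x] h[of a x] a x A by auto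
  ultimately show ?thesis by linarith
qed

text \<open>
  Uniform continuity puts every function into some class \<open>S m J\<close>, and each class has a countable net.
\<close>

lemma separable_C:
  "\<exists>Q. countable Q \<and> Q \<subseteq> topspace CX \<and> (\<forall>g\<in>topspace CX. \<forall>e>0. \<exists>h\<in>Q. cdist g h \<le> e)"
proof -
  \<comment> \<open>Functions whose modulus of continuity at scale \<open>1 / (J + 1)\<close> is at most \<open>1 / (m + 1)\<close>.\<close>
  define S where "S m J = {g \<in> topspace CX. \<forall>x\<in>X. \<forall>y\<in>X. d x y \<le> ennreal (1 / real (Suc J)) \<longrightarrow>
      \<bar>g x - g y\<bar> \<le> 1 / real (Suc m)}" for m J
  have "\<exists>F. countable F \<and> F \<subseteq> S m J \<and> (\<forall>g\<in>S m J. \<exists>h\<in>F. cdist g h \<le> 3 * (1 / real (Suc m)))" for m J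
  proof -
    obtain A where A: "finite A" "A \<subseteq> X" "\<forall>x\<in>X. \<exists>a\<in>A. d a x \<le> ennreal (1 / real (Suc J))"
      using finite_net[of "1 / real (Suc J)"] by auto
    let ?V = "\<lambda>g :: 'x \<Rightarrow> real. restrict (\<lambda>a. \<lfloor>g a / (1 / real (Suc m))\<rfloor>) A"
    show ?thesis
    proof (rule countable_class_representatives[where V="?V"])
      have "?V ` S m J \<subseteq> PiE A (\<lambda>_. UNIV)" by auto
      then show "countable (?V ` S m J)"
        by (rule countable_subset) (auto intro: countable_PiE A(1))
      fix g h assume g: "g \<in> S m J" and h: "h \<in> S m J" and V: "?V g = ?V h"
      have "\<forall>x\<in>X. \<bar>g x - h x\<bar> \<le> 3 * (1 / real (Suc m))"
        using g h by (intro ballI close_of_same_class[OF A(2,3) _ _ _ V]) (auto simp: S_def)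
      then show "cdist g h \<le> 3 * (1 / real (Suc m))"
        using g h by (subst cdist_le) (auto simp: S_def)
    qed
  qed
  then obtain F where F: "\<And>m J. countable (F m J)" "\<And>m J. F m J \<subseteq> S m J"
    "\<And>m J g. g \<in> S m J \<Longrightarrow> \<exists>h\<in>F m J. cdist g h \<le> 3 * (1 / real (Suc m))"
    by metis
  show ?thesis
  proof (intro exI[of _ "\<Union>m J. F m J"] conjI ballI allI impI)
    show "countable (\<Union>m J. F m J)" using F(1) by auto
    show "(\<Union>m J. F m J) \<subseteq> topspace CX" using F(2) by (auto simp: S_def)
    fix g and e :: real assume g: "g \<in> topspace CX" and e: "0 < e"
    obtain m where m: "1 / real (Suc m) < e / 3" using nat_approx_posE[of "e/3"] e by auto
    obtain r where r: "r > 0" "\<forall>x\<in>X. \<forall>y\<in>X. d x y \<le> ennreal r \<longrightarrow> \<bar>g x - g y\<bar> \<le> 1 / real (Suc m)"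
      using uniformly_continuous[of g "1 / real (Suc m)"] g by (auto simp: topspace_C)
    obtain J where J: "1 / real (Suc J) < r" using nat_approx_posE[OF r(1)] by auto
    have "ennreal (1 / real (Suc J)) \<le> ennreal r" using J by (intro ennreal_leI) simp
    then have "d x y \<le> ennreal (1 / real (Suc J)) \<Longrightarrow> d x y \<le> ennreal r" for x y
      by (rule order_trans[rotated])
    then have "g \<in> S m J" using g r(2) unfolding S_def by blast
    from F(3)[OF this] obtain h where "h \<in> F m J" "cdist g h \<le> 3 * (1 / real (Suc m))" by blast
    moreover have "3 * (1 / real (Suc m)) \<le> e" using m by linarith
    ultimately show "\<exists>h\<in>\<Union>m J. F m J. cdist g h \<le> e" by (meson UN_I UNIV_I order_trans)
  qed
qed

lemma countable_dense:
  "\<exists>D. countable D \<and> D \<subseteq> X \<and> (\<forall>x\<in>X. \<forall>r>0. \<exists>a\<in>D. d a x \<le> ennreal r)"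
proof -
  have "\<forall>n. \<exists>A. finite A \<and> A \<subseteq> X \<and> (\<forall>x\<in>X. \<exists>a\<in>A. d a x \<le> ennreal (1 / real (Suc n)))"
    by (intro allI finite_net) auto
  then obtain A where A: "\<And>n. finite (A n)" "\<And>n. A n \<subseteq> X"
    "\<And>n x. x \<in> X \<Longrightarrow> \<exists>a\<in>A n. d a x \<le> ennreal (1 / real (Suc n))" by metis
  show ?thesis
  proof (intro exI[of _ "\<Union>n. A n"] conjI ballI allI impI)
    show "countable (\<Union>n. A n)" using A(1) by (auto intro: countable_finite)
    show "(\<Union>n. A n) \<subseteq> X" using A(2) by auto
    fix x and r :: real assume x: "x \<in> X" and r: "0 < r"
    obtain n where n: "1 / real (Suc n) < r" using nat_approx_posE[OF r] by auto
    then have "ennreal (1 / real (Suc n)) \<le> ennreal r" by (intro ennreal_leI) simp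
    then show "\<exists>a\<in>\<Union>n. A n. d a x \<le> ennreal r" using A(3)[OF x, of n] by (force intro: order_trans)
  qed
qed

lemma continuous_le_dense:
  assumes f: "continuous_map (semidist_topology X d) euclideanreal f"
    and D: "D \<subseteq> X" "\<forall>x\<in>X. \<forall>r>0. \<exists>a\<in>D. d a x \<le> ennreal r" and le: "\<And>a. a \<in> D \<Longrightarrow> f a \<le> c" and x: "x \<in> X"
  shows "f x \<le> c"
proof (rule field_le_epsilon)
  fix e :: real assume "e > 0"
  then obtain r where r: "r > 0" "\<forall>x\<in>X. \<forall>y\<in>X. d x y \<le> ennreal r \<longrightarrow> \<bar>f x - f y\<bar> \<le> e"
    using uniformly_continuous[OF f] by blast
  then obtain a where a: "a \<in> D" "d a x \<le> ennreal r" using D x by blast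
  then have "\<bar>f a - f x\<bar> \<le> e" using r D x by blast
  then show "f x \<le> c + e" using le[OF a(1)] by linarith
qed

text \<open>
  By separability an open set is a countable union of closed balls, and by continuity a closed ball is determined
  by the values on a countable dense set.
\<close>

lemma measurable_into_C:
  assumes Z: "\<And>\<omega>. \<omega> \<in> space M \<Longrightarrow> Z \<omega> \<in> topspace CX"
    and ev: "\<And>x. x \<in> X \<Longrightarrow> (\<lambda>\<omega>. Z \<omega> x) \<in> borel_measurable M"
  shows "Z \<in> M \<rightarrow>\<^sub>M borel_of CX"
  unfolding borel_of_def
proof (rule measurable_measure_of)
  show "{U. openin CX U} \<subseteq> Pow (topspace CX)" by (auto dest: openin_subset)
  show "Z \<in> space M \<rightarrow> topspace CX" using Z by auto
  fix U assume "U \<in> {U. openin CX U}"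
  then have U: "openin CX U" by simp
  obtain Q where Q: "countable Q" "Q \<subseteq> topspace CX" "\<And>g e. g \<in> topspace CX \<Longrightarrow> e > 0 \<Longrightarrow> \<exists>h\<in>Q. cdist g h \<le> e"
    using separable_C by metis
  obtain D where D: "countable D" "D \<subseteq> X" "\<forall>x\<in>X. \<forall>r>0. \<exists>a\<in>D. d a x \<le> ennreal r"
    using countable_dense by blast
  have cball: "{\<omega> \<in> space M. cdist (Z \<omega>) h \<le> r} \<in> sets M" if h: "h \<in> Q" for h r
  proof -
    have hC: "h \<in> topspace CX" using h Q by auto
    have "cdist (Z \<omega>) h \<le> r \<longleftrightarrow> (\<forall>a\<in>D. \<bar>Z \<omega> a - h a\<bar> \<le> r)" if w: "\<omega> \<in> space M" for \<omega>
    proof -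
      have "continuous_map (semidist_topology X d) euclideanreal (\<lambda>x. \<bar>Z \<omega> x - h x\<bar>)"
        using Z[OF w] hC by (auto simp: topspace_C intro!: continuous_intros)
      then show ?thesis
        unfolding cdist_le[OF Z[OF w] hC] using continuous_le_dense[OF _ D(2,3)] D(2) by blast
    qed
    then have "{\<omega> \<in> space M. cdist (Z \<omega>) h \<le> r} = {\<omega> \<in> space M. \<forall>a\<in>D. \<bar>Z \<omega> a - h a\<bar> \<le> r}" by auto
    also have "\<dots> = (\<Inter>a\<in>D. {\<omega> \<in> space M. \<bar>Z \<omega> a - h a\<bar> \<le> r})"
      using D(3) nonempty zero_less_one by blast
    also have "\<dots> \<in> sets M"
    proof (rule sets.countable_INT'[OF D(1)])
      show "D \<noteq> {}" using D(3) nonempty zero_less_one by blast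
      have "{\<omega> \<in> space M. \<bar>Z \<omega> a - h a\<bar> \<le> r} \<in> sets M" if "a \<in> D" for a
      proof -
      have [measurable]: "(\<lambda>\<omega>. Z \<omega> a) \<in> borel_measurable M" using that D(2) ev by auto
        show ?thesis by measurable
      qed
      then show "(\<lambda>a. {\<omega> \<in> space M. \<bar>Z \<omega> a - h a\<bar> \<le> r}) ` D \<subseteq> sets M" by auto
    qed
    finally show ?thesis .
  qed
  define I where "I = {(h, n). h \<in> Q \<and> {g \<in> topspace CX. cdist g h \<le> 1 / real (Suc n)} \<subseteq> U}"
  have "Z -` U \<inter> space M = (\<Union>(h, n)\<in>I. {\<omega> \<in> space M. cdist (Z \<omega>) h \<le> 1 / real (Suc n)})"
  proof (intro equalityI subsetI)
    fix \<omega> assume w: "\<omega> \<in> Z -` U \<inter> space M"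
    interpret Metric_space "topspace CX" cdist by (rule C_metric)
    have "openin mtopology U" using U C_mtopology by simp
    then obtain r where r: "r > 0" "mball (Z \<omega>) r \<subseteq> U" using w unfolding openin_mtopology by blast
    obtain n where n: "1 / real (Suc n) < r / 2" using nat_approx_posE[of "r/2"] r by auto
    obtain h where h: "h \<in> Q" "cdist (Z \<omega>) h \<le> 1 / real (Suc n)"
      using Q(3)[OF Z, of \<omega> "1 / real (Suc n)"] w by auto
    have "{g \<in> topspace CX. cdist g h \<le> 1 / real (Suc n)} \<subseteq> U"
    proof clarify
      fix g assume g: "g \<in> topspace CX" "cdist g h \<le> 1 / real (Suc n)"
      have "cdist (Z \<omega>) g \<le> cdist (Z \<omega>) h + cdist h g"
        using w Z g h Q(2) by (intro triangle) auto
      also have "\<dots> < r" using g(2) h(2) n by (simp only: commute[of h g])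
      finally show "g \<in> U" using r(2) g w Z by auto
    qed
    then show "\<omega> \<in> (\<Union>(h, n)\<in>I. {\<omega> \<in> space M. cdist (Z \<omega>) h \<le> 1 / real (Suc n)})"
      using h w by (auto simp: I_def)
  qed (use Z in \<open>auto simp: I_def\<close>)
  also have "\<dots> \<in> sets M"
  proof (rule sets.countable_UN')
    show "countable I"
      by (rule countable_subset[of _ "Q \<times> UNIV"]) (auto simp: I_def Q(1))
  qed (auto simp: I_def intro!: cball)
  finally show "Z -` U \<inter> space M \<in> sets M" .
qed

text \<open>
  The half of the theorem of Arzela and Ascoli that tightness uses. The bound \<open>R\<close> is imposed at all points, since
  in a disconnected \<open>X\<close> a bound at one point and the moduli of continuity do not bound the function.
\<close>

lemma compactin_equicontinuous_closure:
  assumes r: "\<And>m. r m > 0"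
  shows "compactin CX (CX closure_of {g \<in> topspace CX. (\<forall>x\<in>X. \<bar>g x\<bar> \<le> R) \<and>
     (\<forall>m. \<forall>x\<in>X. \<forall>y\<in>X. d x y \<le> ennreal (r m) \<longrightarrow> \<bar>g x - g y\<bar> \<le> 1 / real (Suc m))})"
    (is "compactin CX (CX closure_of ?S)")
proof -
  define S where "S = ?S"
  have SI: "g \<in> S \<Longrightarrow> g \<in> topspace CX" "g \<in> S \<Longrightarrow> x \<in> X \<Longrightarrow> \<bar>g x\<bar> \<le> R"
    "g \<in> S \<Longrightarrow> x \<in> X \<Longrightarrow> y \<in> X \<Longrightarrow> d x y \<le> ennreal (r m) \<Longrightarrow> \<bar>g x - g y\<bar> \<le> 1 / real (Suc m)" for g x y m
    by (auto simp: S_def)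
  interpret Metric_space "topspace CX" cdist by (rule C_metric)
  have "mtotally_bounded S"
    unfolding mtotally_bounded_def
  proof (intro allI impI)
    fix e :: real assume e: "0 < e"
    obtain m where m: "1 / real (Suc m) < e / 3" using nat_approx_posE[of "e/3"] e by auto
    define t where "t = 1 / real (Suc m)"
    have t: "t > 0" by (simp add: t_def)
    obtain A where A: "finite A" "A \<subseteq> X" "\<forall>x\<in>X. \<exists>a\<in>A. d a x \<le> ennreal (r m)"
      using finite_net[OF r[of m]] by auto
    let ?V = "\<lambda>g :: 'x \<Rightarrow> real. restrict (\<lambda>a. \<lfloor>g a / t\<rfloor>) A"
    have "\<exists>F. finite F \<and> F \<subseteq> S \<and> (\<forall>g\<in>S. \<exists>h\<in>F. cdist g h \<le> 3 * t)"
    proof (rule finite_class_representatives[where V="?V"])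
      have "?V ` S \<subseteq> PiE A (\<lambda>_. {\<lfloor>- R / t\<rfloor>..\<lfloor>R / t\<rfloor>})"
      proof clarify
        fix g assume g: "g \<in> S"
        have "\<lfloor>g a / t\<rfloor> \<in> {\<lfloor>- R / t\<rfloor>..\<lfloor>R / t\<rfloor>}" if "a \<in> A" for a
        proof -
          have "\<bar>g a\<bar> \<le> R" using SI(2)[OF g] A(2) that by blast
          then have "- R \<le> g a" "g a \<le> R" by linarith+
          then have "- R / t \<le> g a / t" "g a / t \<le> R / t"
            using t divide_right_mono less_imp_le by blast+
          then show ?thesis by (simp add: floor_mono)
        qed
        then show "?V g \<in> PiE A (\<lambda>_. {\<lfloor>- R / t\<rfloor>..\<lfloor>R / t\<rfloor>})"
          unfolding restrict_PiE_iff by blast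
      qed
      then show "finite (?V ` S)" by (rule finite_subset) (auto intro!: finite_PiE A(1))
      fix g h assume g: "g \<in> S" and h: "h \<in> S" and V: "?V g = ?V h"
      have "\<forall>x\<in>X. \<bar>g x - h x\<bar> \<le> 3 * t"
        using SI(3)[OF g, of _ _ m] SI(3)[OF h, of _ _ m]
        by (intro ballI close_of_same_class[OF A(2,3) t _ _ V]) (auto simp: t_def)
      then show "cdist g h \<le> 3 * t" by (simp add: cdist_le SI(1) g h)
    qed
    then obtain F where F: "finite F" "F \<subseteq> S" "\<And>g. g \<in> S \<Longrightarrow> \<exists>h\<in>F. cdist g h \<le> 3 * t" by blast
    have "S \<subseteq> (\<Union>h\<in>F. mball h e)"
    proof
      fix g assume g: "g \<in> S"
      obtain h where h: "h \<in> F" "cdist g h \<le> 3 * t" using F(3)[OF g] by blast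
      then have "cdist h g < e" using m by (simp add: commute t_def)
      then show "g \<in> (\<Union>h\<in>F. mball h e)" using h F(2) SI(1) g by (auto intro!: bexI[of _ h])
    qed
    then show "\<exists>K. finite K \<and> K \<subseteq> S \<and> S \<subseteq> (\<Union>x\<in>K. mball x e)" using F by blast
  qed
  then show ?thesis
    using mtotally_bounded_eq_compact_closure_of[OF C_complete] C_mtopology by (simp add: S_def)
qed

end

section \<open>Chaining along nets\<close>

text \<open>
  The increments have \<open>L\<^sub>2\<^sub>m\<close>-norm at most \<open>C (2m) powr \<gamma>\<close> times the distance. Even integer moments suffice
  for maximal inequalities, and they can be expanded by the binomial theorem.
\<close>

definition increments_bounded ::
  "'w measure \<Rightarrow> 'x set \<Rightarrow> ('x \<Rightarrow> 'x \<Rightarrow> ennreal) \<Rightarrow> real \<Rightarrow> real \<Rightarrow> ('x \<Rightarrow> 'w \<Rightarrow> real) \<Rightarrow> bool" where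
  "increments_bounded M X d \<gamma> C \<zeta> \<longleftrightarrow>
     (\<forall>x\<in>X. \<zeta> x \<in> borel_measurable M) \<and>
     (\<forall>x\<in>X. \<forall>y\<in>X. \<forall>r>0. \<forall>m\<ge>1. d x y \<le> ennreal r \<longrightarrow>
        (\<integral>\<^sup>+\<omega>. ennreal ((\<zeta> x \<omega> - \<zeta> y \<omega>) ^ (2 * m)) \<partial>M) \<le>
          ennreal ((C * (2 * real m) powr \<gamma> * r) ^ (2 * m)))"

lemma powr_sum3_le:
  fixes a b c g :: real
  assumes "0 \<le> a" "0 \<le> b" "0 \<le> c" "0 \<le> g"
  shows "(a + b + c) powr g \<le> 3 powr g * (a powr g + b powr g + c powr g)"
proof -
  let ?m = "max a (max b c)"
  have "(a + b + c) powr g \<le> (3 * ?m) powr g" using assms by (intro powr_mono2) auto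
  also have "\<dots> = 3 powr g * ?m powr g" using assms by (simp add: powr_mult)
  also have "?m powr g \<le> a powr g + b powr g + c powr g" by (simp add: max_def)
  finally show ?thesis by simp
qed

text \<open>
  Nets at the scales \<open>\<delta> / 2^j\<close> with \<open>\<delta>\<close> at least the diameter; \<open>entropy\<close> is the discrete form of
  the entropy integral.
\<close>

locale net_chain = compact_semidist +
  fixes \<delta> :: real and A :: "nat \<Rightarrow> 'a set" and \<gamma> :: real
  assumes \<delta>: "0 < \<delta>" and diam: "x \<in> X \<Longrightarrow> y \<in> X \<Longrightarrow> d x y \<le> ennreal \<delta>"
    and \<gamma>: "0 < \<gamma>"
    and A_fin: "finite (A j)" and A_sub: "A j \<subseteq> X"
    and A_net: "x \<in> X \<Longrightarrow> \<exists>a\<in>A j. d a x \<le> ennreal (\<delta> / 2 ^ j)"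
    and entropy: "summable (\<lambda>j. \<delta> / 2 ^ j * ln (real (card (A j))) powr \<gamma>)"
begin

definition eps :: "nat \<Rightarrow> real" where "eps j = \<delta> / 2 ^ j"

lemma eps_pos: "0 < eps j" using \<delta> by (simp add: eps_def)

lemma eps_Suc: "eps j = 2 * eps (Suc j)" by (simp add: eps_def)

lemma eps_le: "eps (Suc j) \<le> eps j" using eps_pos[of j] by (simp add: eps_Suc[of j])

lemma eps_0: "eps 0 = \<delta>" by (simp add: eps_def)

lemma summable_eps: "summable eps"
proof -
  have "summable (\<lambda>j. \<delta> * (1/2) ^ j)" by (intro summable_mult summable_geometric) auto
  moreover have "\<delta> * (1/2) ^ j = eps j" for j by (simp add: eps_def power_divide)
  ultimately show ?thesis by simp
qed

lemma A_ne: "A j \<noteq> {}"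
  using A_net nonempty by blast

definition proj :: "nat \<Rightarrow> 'a \<Rightarrow> 'a" where "proj j x = (SOME a. a \<in> A j \<and> d a x \<le> ennreal (eps j))"

lemma proj: assumes "x \<in> X" shows "proj j x \<in> A j" "d (proj j x) x \<le> ennreal (eps j)" "proj j x \<in> X"
proof -
  have "\<exists>a. a \<in> A j \<and> d a x \<le> ennreal (eps j)" using A_net[OF assms, of j] by (auto simp: eps_def)
  then have "proj j x \<in> A j \<and> d (proj j x) x \<le> ennreal (eps j)" unfolding proj_def by (rule someI_ex)
  then show "proj j x \<in> A j" "d (proj j x) x \<le> ennreal (eps j)" "proj j x \<in> X" using A_sub by auto
qed

text \<open>
  These pairs serve two purposes. They contain the steps from \<open>proj (j + 1) x\<close> to \<open>proj j x\<close>, at distance at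
  most \<open>eps (j + 1) + eps j\<close>, and the pairs \<open>proj j x\<close>, \<open>proj j y\<close> for points with \<open>d x y \<le> eps j\<close>, at
  distance at most \<open>3 * eps j\<close>. A single oscillation per scale thus bounds the chains and the modulus of continuity.
\<close>

definition links :: "nat \<Rightarrow> ('a \<times> 'a) set" where
  "links j = {(a, b). a \<in> A j \<union> A (Suc j) \<and> b \<in> A j \<union> A (Suc j) \<and> d a b \<le> ennreal (3 * eps j)}"

lemma links_X: "(a, b) \<in> links j \<Longrightarrow> a \<in> X \<and> b \<in> X \<and> d a b \<le> ennreal (3 * eps j)"
  using A_sub by (auto simp: links_def)

definition width :: "nat \<Rightarrow> nat" where "width j = card (A j) + card (A (Suc j))"

lemma width_ge: "2 \<le> width j"
proof -
  have "0 < card (A j)" "0 < card (A (Suc j))" using A_ne A_fin by (simp_all add: card_gt_0_iff)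
  then show ?thesis by (simp add: width_def)
qed

lemma links_fin: "finite (links j)" and links_card: "card (links j) \<le> width j ^ 2"
proof -
  let ?P = "A j \<union> A (Suc j)"
  have fin: "finite (?P \<times> ?P)" using A_fin by auto
  have sub: "links j \<subseteq> ?P \<times> ?P" by (auto simp: links_def)
  show "finite (links j)" by (rule finite_subset[OF sub fin])
  have "card (links j) \<le> card (?P \<times> ?P)" by (rule card_mono[OF fin sub])
  also have "\<dots> = card ?P ^ 2" by (simp add: card_cartesian_product power2_eq_square)
  also have "\<dots> \<le> width j ^ 2" unfolding width_def by (intro power_mono card_Un_le) auto
  finally show "card (links j) \<le> width j ^ 2" .
qed

lemma links_ne: "links j \<noteq> {}"
proof -
  obtain a where a: "a \<in> A j" using A_ne by blast
  then have "d a a = 0" using A_sub d_refl by blast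
  then have "(a, a) \<in> links j" using a by (simp add: links_def)
  then show ?thesis by blast
qed

definition osc :: "nat \<Rightarrow> ('a \<Rightarrow> real) \<Rightarrow> real" where
  "osc j z = Max ((\<lambda>(a, b). \<bar>z a - z b\<bar>) ` links j)"

lemma osc_ge: "(a, b) \<in> links j \<Longrightarrow> \<bar>z a - z b\<bar> \<le> osc j z"
  unfolding osc_def using links_fin by (intro Max_ge) (auto intro: image_eqI[of _ _ "(a, b)"])

lemma osc_nonneg: "0 \<le> osc j z"
proof -
  obtain a b where "(a, b) \<in> links j" using links_ne[of j] by auto
  from osc_ge[OF this, of z] show ?thesis by linarith
qed

lemma proj_step:
  assumes "x \<in> X" shows "\<bar>z (proj (Suc j) x) - z (proj j x)\<bar> \<le> osc j z"
proof (rule osc_ge)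
  have "d (proj (Suc j) x) (proj j x) \<le> ennreal (eps (Suc j) + eps j)"
    using proj[OF assms, of j] proj[OF assms, of "Suc j"] assms eps_pos[of j] eps_pos[of "Suc j"]
    by (intro d_tri_le[where y=x]) (auto simp: d_sym[OF assms proj(3)[OF assms]])
  also have "\<dots> \<le> ennreal (3 * eps j)" using eps_le[of j] eps_pos[of j] by (intro ennreal_leI) linarith
  finally show "(proj (Suc j) x, proj j x) \<in> links j" using proj[OF assms] by (auto simp: links_def)
qed

lemma proj_near:
  assumes "x \<in> X" "y \<in> X" "d x y \<le> ennreal (eps j)"
  shows "\<bar>z (proj j x) - z (proj j y)\<bar> \<le> osc j z"
proof (rule osc_ge)
  have "d (proj j x) y \<le> ennreal (eps j + eps j)"
    using proj[OF assms(1), of j] assms eps_pos[of j] by (intro d_tri_le[where y=x]) auto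
  moreover have "d y (proj j y) \<le> ennreal (eps j)"
    using proj(2)[OF assms(2), of j] d_sym[OF assms(2) proj(3)[OF assms(2)], of j] by simp
  ultimately have "d (proj j x) (proj j y) \<le> ennreal ((eps j + eps j) + eps j)"
    by (rule d_tri_le[OF proj(3)[OF assms(1)] assms(2) proj(3)[OF assms(2)]]) (use eps_pos[of j] in auto)
  then show "(proj j x, proj j y) \<in> links j" using proj(1)[OF assms(1)] proj(1)[OF assms(2)] by (auto simp: links_def)
qed

lemma summable_proj_converges:
  assumes "summable (\<lambda>j. osc j z)" "x \<in> X"
  shows "convergent (\<lambda>j. z (proj j x))"
proof -
  have "summable (\<lambda>j. z (proj (Suc j) x) - z (proj j x))"
    using assms proj_step[OF assms(2)] by (intro summable_comparison_test'[OF assms(1)]) auto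
  then have "convergent (\<lambda>n. \<Sum>j<n. z (proj (Suc j) x) - z (proj j x))"
    by (simp add: summable_iff_convergent)
  then have "convergent (\<lambda>n. z (proj n x) - z (proj 0 x))" by (subst (asm) sum_lessThan_telescope)
  then show ?thesis by (simp add: convergent_diff_const_right_iff)
qed

lemma chain_bound:
  assumes sm: "summable (\<lambda>j. osc j z)" and x: "x \<in> X" and lim: "(\<lambda>j. z (proj j x)) \<longlonglongrightarrow> w"
  shows "\<bar>w - z (proj J x)\<bar> \<le> (\<Sum>j. osc (j + J) z)"
proof -
  have sJ: "summable (\<lambda>j. osc (j + J) z)" using sm by (rule summable_ignore_initial_segment)
  have "\<bar>z (proj (n + J) x) - z (proj J x)\<bar> \<le> (\<Sum>j. osc (j + J) z)" for n
  proof -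
    have "z (proj (n + J) x) - z (proj J x) = (\<Sum>j<n. z (proj (Suc (j + J)) x) - z (proj (j + J) x))"
      using sum_lessThan_telescope[of "\<lambda>j. z (proj (j + J) x)" n] by simp
    also have "\<bar>\<dots>\<bar> \<le> (\<Sum>j<n. osc (j + J) z)"
      by (rule order_trans[OF sum_abs sum_mono]) (rule proj_step[OF x])
    also have "\<dots> \<le> (\<Sum>j. osc (j + J) z)" by (intro sum_le_suminf sJ) (auto simp: osc_nonneg)
    finally show ?thesis .
  qed
  moreover have "(\<lambda>n. \<bar>z (proj (n + J) x) - z (proj J x)\<bar>) \<longlonglongrightarrow> \<bar>w - z (proj J x)\<bar>"
    by (intro tendsto_intros LIMSEQ_ignore_initial_segment lim)
  ultimately show ?thesis by (intro LIMSEQ_le_const2) auto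
qed

text \<open>
  Go from \<open>x\<close> along its chain to scale \<open>J\<close>, across to the chain of \<open>y\<close> by one link, and back. Here \<open>z\<close>
  is used only on the nets, and \<open>w\<close> is its extension along the chains.
\<close>

lemma modulus_bound:
  assumes sm: "summable (\<lambda>j. osc j z)" and lim: "\<And>x. x \<in> X \<Longrightarrow> (\<lambda>j. z (proj j x)) \<longlonglongrightarrow> w x"
    and xy: "x \<in> X" "y \<in> X" "d x y \<le> ennreal (eps J)"
  shows "\<bar>w x - w y\<bar> \<le> 3 * (\<Sum>j. osc (j + J) z)"
proof -
  have sJ: "summable (\<lambda>j. osc (j + J) z)" using sm by (rule summable_ignore_initial_segment)
  have "osc (0 + J) z \<le> (\<Sum>j. osc (j + J) z)"
    using sum_le_suminf[OF sJ, of "{0}"] by (simp add: osc_nonneg)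
  then show ?thesis
    using chain_bound[OF sm xy(1) lim[OF xy(1)], of J] chain_bound[OF sm xy(2) lim[OF xy(2)], of J]
      proj_near[OF xy, of z] by simp
qed

lemma modulus_continuous:
  assumes sm: "summable (\<lambda>j. osc j z)" and lim: "\<And>x. x \<in> X \<Longrightarrow> (\<lambda>j. z (proj j x)) \<longlonglongrightarrow> w x"
  shows "continuous_map (semidist_topology X d) euclideanreal w"
  unfolding continuous_map_semidist
proof (intro ballI allI impI)
  fix x e assume x: "x \<in> X" and e: "0 < (e::real)"
  obtain J where J: "norm (\<Sum>j. osc (j + J) z) < e / 3"
    using suminf_exist_split[OF _ sm, of "e/3"] e by auto
  have "\<bar>w x - w y\<bar> < e" if "y \<in> X" "d x y < ennreal (eps J)" for y
    using modulus_bound[OF sm lim x that(1) less_imp_le[OF that(2)]] J by simp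
  then show "\<exists>r>0. \<forall>y\<in>X. d x y < ennreal r \<longrightarrow> \<bar>w x - w y\<bar> < e" using eps_pos[of J] by blast
qed

text \<open>
  The moment used at scale \<open>j\<close> is \<open>2 * half_exponent j\<close>. It is chosen so that its exponential exceeds the
  number of links, and it remains of the order of the entropy.
\<close>

definition half_exponent :: "nat \<Rightarrow> nat" where "half_exponent j = nat \<lceil>ln (real (width j))\<rceil> + 1"

lemma half_exponent_ge: "ln (real (width j)) \<le> real (half_exponent j)" and half_exponent_le: "real (half_exponent j) \<le> ln (real (width j)) + 2"
proof -
  have "0 \<le> ln (real (width j))" using width_ge[of j] by simp
  then show "ln (real (width j)) \<le> real (half_exponent j)" "real (half_exponent j) \<le> ln (real (width j)) + 2"
    unfolding half_exponent_def by linarith+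
qed

text \<open>
  The bound of \<open>increments_bounded\<close> for the norm of an increment along a link, in the moment of that scale.
\<close>

definition link_scale :: "real \<Rightarrow> nat \<Rightarrow> real" where
  "link_scale C j = C * (2 * real (half_exponent j)) powr \<gamma> * (3 * eps j)"

lemma link_scale_pos: "0 < C \<Longrightarrow> 0 < link_scale C j"
  using eps_pos[of j] by (simp add: link_scale_def half_exponent_def)

lemma summable_link_scale:
  assumes C: "0 < C" shows "summable (link_scale C)"
proof -
  \<comment> \<open>The links at scale \<open>j\<close> see two nets, so their number involves the entropy at \<open>j\<close> and at \<open>j + 1\<close>.\<close>
  define l where "l j = ln (real (card (A j)))" for j
  have card1: "1 \<le> real (card (A j))" for j using A_ne[of j] A_fin[of j] by (simp add: Suc_le_eq card_gt_0_iff)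
  have l0: "0 \<le> l j" for j using card1[of j] by (simp add: l_def)
  have w: "ln (real (width j)) \<le> 1 + l j + l (Suc j)" for j
  proof -
    let ?a = "real (card (A j))" and ?b = "real (card (A (Suc j)))"
    have "?a + ?b \<le> 2 * (?a * ?b)"
      using mult_mono[of 1 ?a 1 ?b] mult_right_mono[of 1 ?a ?b] mult_left_mono[of 1 ?b ?a] card1[of j] card1[of "Suc j"] by linarith
    then have "ln (real (width j)) \<le> ln (2 * (?a * ?b))"
      using card1[of j] card1[of "Suc j"] by (subst ln_le_cancel_iff) (auto simp: width_def)
    also have "\<dots> = ln 2 + l j + l (Suc j)"
      using card1[of j] card1[of "Suc j"] by (simp add: l_def ln_mult)
    also have "ln (2::real) \<le> 1" using ln_2_less_1 by simp
    finally show ?thesis by simp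
  qed
  define T where "T j = 3 * C * 3 powr \<gamma> * (6 powr \<gamma> * eps j + 2 powr \<gamma> * (eps j * l j powr \<gamma>)
     + 2 * 2 powr \<gamma> * (eps (Suc j) * l (Suc j) powr \<gamma>))" for j
  have ent: "summable (\<lambda>j. eps j * l j powr \<gamma>)" using entropy by (simp add: eps_def l_def)
  have "summable T" unfolding T_def[abs_def]
    by (intro summable_mult summable_add summable_eps ent summable_Suc_iff[THEN iffD2, OF ent])
  then show ?thesis
  proof (rule summable_comparison_test')
    fix j
    have "(2 * real (half_exponent j)) powr \<gamma> \<le> (6 + 2 * l j + 2 * l (Suc j)) powr \<gamma>"
      using half_exponent_le[of j] w[of j] \<gamma> by (intro powr_mono2) auto
    also have "\<dots> \<le> 3 powr \<gamma> * (6 powr \<gamma> + (2 * l j) powr \<gamma> + (2 * l (Suc j)) powr \<gamma>)"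
      using l0 \<gamma> by (intro powr_sum3_le) auto
    also have "\<dots> = 3 powr \<gamma> * (6 powr \<gamma> + 2 powr \<gamma> * l j powr \<gamma> + 2 powr \<gamma> * l (Suc j) powr \<gamma>)"
      using l0 by (simp add: powr_mult)
    finally have "C * (2 * real (half_exponent j)) powr \<gamma> * (3 * eps j) \<le>
       C * (3 powr \<gamma> * (6 powr \<gamma> + 2 powr \<gamma> * l j powr \<gamma> + 2 powr \<gamma> * l (Suc j) powr \<gamma>)) * (3 * eps j)"
      using C eps_pos[of j] by (intro mult_right_mono mult_left_mono) auto
    also have "\<dots> = T j" by (simp add: T_def eps_Suc[of j] algebra_simps)
    finally show "norm (link_scale C j) \<le> T j" using link_scale_pos[OF C, of j] by (simp add: link_scale_def)
  qed
qed

definition osc_bound :: "real \<Rightarrow> nat \<Rightarrow> real" where "osc_bound C j = 2 * exp 1 * link_scale C j"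

lemma osc_bound_pos: "0 < C \<Longrightarrow> 0 < osc_bound C j" by (simp add: osc_bound_def link_scale_pos)

lemma summable_osc_bound: "0 < C \<Longrightarrow> summable (osc_bound C)"
  unfolding osc_bound_def[abs_def] by (intro summable_mult summable_link_scale)

end

text \<open>
  This replaces the union bound together with an integration of tails: summed over all links, the power on
  the right is linear in the moments.
\<close>

lemma le_add_power:
  fixes u t :: real
  assumes "0 \<le> u" "0 < t" "1 \<le> m"
  shows "u \<le> t + u ^ (2 * m) / t ^ (2 * m - 1)"
proof (cases "u \<le> t")
  case False
  have eq: "2 * m = Suc (2 * m - 1)" using assms(3) by simp
  have "1 \<le> (u / t) ^ (2 * m - 1)" using False assms by (intro one_le_power) auto
  then have "u * 1 \<le> u * (u / t) ^ (2 * m - 1)" using assms by (intro mult_left_mono) auto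
  also have "\<dots> = u ^ (2 * m) / t ^ (2 * m - 1)" by (subst eq) (simp add: power_divide)
  finally show ?thesis using assms by simp
next
  case True
  moreover have "0 \<le> u ^ (2 * m) / t ^ (2 * m - 1)" using assms by simp
  ultimately show ?thesis by linarith
qed

locale chained_field = net_chain X d \<delta> A \<gamma> + prob_space M
  for X :: "'x set" and d :: "'x \<Rightarrow> 'x \<Rightarrow> ennreal" and \<delta> A \<gamma> and M :: "'w measure" +
  fixes \<zeta> :: "'x \<Rightarrow> 'w \<Rightarrow> real" and C :: real
  assumes C: "0 < C" and inc: "increments_bounded M X d \<gamma> C \<zeta>"
begin

lemma \<zeta>_measurable: "x \<in> X \<Longrightarrow> \<zeta> x \<in> borel_measurable M"
  using inc by (simp add: increments_bounded_def)

lemma increment: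
  assumes "x \<in> X" "y \<in> X" "0 < r" "1 \<le> m" "d x y \<le> ennreal r"
  shows "(\<integral>\<^sup>+\<omega>. ennreal ((\<zeta> x \<omega> - \<zeta> y \<omega>) ^ (2 * m)) \<partial>M) \<le> ennreal ((C * (2 * real m) powr \<gamma> * r) ^ (2 * m))"
  using inc assms unfolding increments_bounded_def by blast

abbreviation Osc where "Osc j \<omega> \<equiv> osc j (\<lambda>x. \<zeta> x \<omega>)"

lemma Osc_measurable [measurable]: "Osc j \<in> borel_measurable M"
proof -
  have "(\<lambda>\<omega>. Max ((\<lambda>p. \<bar>\<zeta> (fst p) \<omega> - \<zeta> (snd p) \<omega>\<bar>) ` links j)) \<in> borel_measurable M"
  proof (rule borel_measurable_Max)
    show "finite (links j)" by (rule links_fin)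
    fix p assume "p \<in> links j"
    then have [measurable]: "\<zeta> (fst p) \<in> borel_measurable M" "\<zeta> (snd p) \<in> borel_measurable M"
      using links_X[of "fst p" "snd p" j] by (auto intro: \<zeta>_measurable)
    show "(\<lambda>\<omega>. \<bar>\<zeta> (fst p) \<omega> - \<zeta> (snd p) \<omega>\<bar>) \<in> borel_measurable M" by measurable
  qed
  then show ?thesis by (simp add: osc_def case_prod_beta)
qed

text \<open>
  In \<open>le_add_power\<close> take \<open>t = e * s\<close>, where \<open>s\<close> bounds the \<open>L\<^sub>2\<^sub>m\<close>-norms of the increments along links.
  The number of links is at most \<open>exp (2m)\<close>, which the factor \<open>e\<close> in \<open>t\<close> exactly compensates, so both
  summands are at most \<open>t\<close>.
\<close>

lemma expectation_Osc: "(\<integral>\<^sup>+\<omega>. ennreal (Osc j \<omega>) \<partial>M) \<le> ennreal (osc_bound C j)"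
proof -
  define m where "m = half_exponent j"
  define s where "s = link_scale C j"
  define t where "t = exp 1 * s"
  have m: "1 \<le> m" by (simp add: m_def half_exponent_def)
  have s: "0 < s" using link_scale_pos[OF C] by (simp add: s_def)
  have t: "0 < t" using s by (simp add: t_def)
  define c where "c = 1 / t ^ (2 * m - 1)"
  have c: "0 \<le> c" using t by (simp add: c_def)
  let ?D = "\<lambda>p \<omega>. \<zeta> (fst p) \<omega> - \<zeta> (snd p) \<omega>"
  have meas: "(\<lambda>\<omega>. ennreal (?D p \<omega> ^ (2 * m))) \<in> borel_measurable M" if "p \<in> links j" for p
  proof -
    have [measurable]: "\<zeta> (fst p) \<in> borel_measurable M" "\<zeta> (snd p) \<in> borel_measurable M"
      using that links_X[of "fst p" "snd p" j] by (auto intro: \<zeta>_measurable)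
    show ?thesis by measurable
  qed
  have "ennreal (Osc j \<omega>) \<le> ennreal t + (\<Sum>p\<in>links j. ennreal (?D p \<omega> ^ (2 * m))) * ennreal (1 / t ^ (2 * m - 1))" for \<omega>
  proof -
    have "Osc j \<omega> \<in> (\<lambda>(a, b). \<bar>\<zeta> a \<omega> - \<zeta> b \<omega>\<bar>) ` links j"
      unfolding osc_def by (rule Max_in) (auto simp: links_fin links_ne)
    then obtain p where p: "p \<in> links j" "Osc j \<omega> = \<bar>?D p \<omega>\<bar>" by auto
    have "Osc j \<omega> \<le> t + ?D p \<omega> ^ (2 * m) / t ^ (2 * m - 1)"
      using le_add_power[of "\<bar>?D p \<omega>\<bar>" t m] t m p(2) by (simp add: power_even_abs)
    also have "\<dots> \<le> t + (\<Sum>p\<in>links j. ?D p \<omega> ^ (2 * m)) / t ^ (2 * m - 1)"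
      using t by (intro add_left_mono divide_right_mono member_le_sum p(1) links_fin) auto
    finally have "ennreal (Osc j \<omega>) \<le> ennreal (t + (\<Sum>p\<in>links j. ?D p \<omega> ^ (2 * m)) * c)"
      by (intro ennreal_leI) (simp add: c_def)
    also have "\<dots> = ennreal t + (\<Sum>p\<in>links j. ennreal (?D p \<omega> ^ (2 * m))) * ennreal c"
      using t c by (subst ennreal_plus) (auto simp: ennreal_mult sum_nonneg sum_ennreal)
    finally show ?thesis by (simp add: c_def)
  qed
  then have "(\<integral>\<^sup>+\<omega>. ennreal (Osc j \<omega>) \<partial>M) \<le>
      (\<integral>\<^sup>+\<omega>. ennreal t + (\<Sum>p\<in>links j. ennreal (?D p \<omega> ^ (2 * m))) * ennreal (1 / t ^ (2 * m - 1)) \<partial>M)"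
    by (intro nn_integral_mono) auto
  also have "\<dots> = ennreal t + (\<Sum>p\<in>links j. \<integral>\<^sup>+\<omega>. ennreal (?D p \<omega> ^ (2 * m)) \<partial>M) * ennreal (1 / t ^ (2 * m - 1))"
  proof -
    define S where "S \<omega> = (\<Sum>p\<in>links j. ennreal (?D p \<omega> ^ (2 * m)))" for \<omega>
    have [measurable]: "S \<in> borel_measurable M" unfolding S_def[abs_def] by (intro borel_measurable_sum meas)
    have "(\<integral>\<^sup>+\<omega>. ennreal t + S \<omega> * ennreal (1 / t ^ (2 * m - 1)) \<partial>M) =
        ennreal t + (\<integral>\<^sup>+\<omega>. S \<omega> \<partial>M) * ennreal (1 / t ^ (2 * m - 1))"
      by (simp add: nn_integral_add nn_integral_multc emeasure_space_1)
    also have "(\<integral>\<^sup>+\<omega>. S \<omega> \<partial>M) = (\<Sum>p\<in>links j. \<integral>\<^sup>+\<omega>. ennreal (?D p \<omega> ^ (2 * m)) \<partial>M)"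
      unfolding S_def by (intro nn_integral_sum meas)
    finally show ?thesis unfolding S_def .
  qed
  also have "\<dots> \<le> ennreal t + (\<Sum>p\<in>links j. ennreal (s ^ (2 * m))) * ennreal (1 / t ^ (2 * m - 1))"
  proof (intro add_left_mono mult_right_mono sum_mono)
    fix p assume "p \<in> links j"
    then show "(\<integral>\<^sup>+\<omega>. ennreal (?D p \<omega> ^ (2 * m)) \<partial>M) \<le> ennreal (s ^ (2 * m))"
      using increment[of "fst p" "snd p" "3 * eps j" m] links_X[of "fst p" "snd p" j] eps_pos[of j] m
      by (simp add: s_def link_scale_def m_def)
  qed auto
  also have "\<dots> = ennreal (t + real (card (links j)) * s ^ (2 * m) * (1 / t ^ (2 * m - 1)))"
    unfolding c_def[symmetric] using s t c
    by (subst ennreal_plus) (auto simp: ennreal_mult ennreal_of_nat_eq_real_of_nat)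
  also have "\<dots> \<le> ennreal (osc_bound C j)"
  proof (rule ennreal_leI)
    have "real (card (links j)) \<le> real (width j) ^ 2"
      using links_card[of j] by (metis of_nat_le_iff of_nat_power)
    also have "\<dots> = exp (ln (real (width j))) ^ 2" using width_ge[of j] by (subst exp_ln) auto
    also have "\<dots> \<le> exp (real m) ^ 2" using half_exponent_ge[of j] by (intro power_mono) (auto simp: m_def)
    also have "\<dots> = exp 1 ^ (2 * m)" by (simp add: exp_of_nat_mult[symmetric] power_mult[symmetric] mult.commute)
    finally have K: "real (card (links j)) \<le> exp 1 ^ (2 * m)" .
    have "real (card (links j)) * s ^ (2 * m) * (1 / t ^ (2 * m - 1)) \<le> exp 1 ^ (2 * m) * s ^ (2 * m) * (1 / t ^ (2 * m - 1))"
      using K s t by (intro mult_right_mono) auto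
    also have "\<dots> = t ^ (2 * m) / t ^ (2 * m - 1)" by (simp add: t_def power_mult_distrib)
    also have "\<dots> = t" using t m by (subst power_diff[symmetric]) auto
    finally show "t + real (card (links j)) * s ^ (2 * m) * (1 / t ^ (2 * m - 1)) \<le> osc_bound C j"
      by (simp add: osc_bound_def t_def s_def)
  qed
  finally show ?thesis .
qed

definition total :: "nat \<Rightarrow> 'w \<Rightarrow> ennreal" where "total J \<omega> = (\<Sum>j. ennreal (Osc (j + J) \<omega>))"

lemma total_measurable [measurable]: "total J \<in> borel_measurable M"
  unfolding total_def[abs_def] by measurable

lemma expectation_total: "(\<integral>\<^sup>+\<omega>. total J \<omega> \<partial>M) \<le> ennreal (\<Sum>j. osc_bound C (j + J))"
proof -
  have "(\<integral>\<^sup>+\<omega>. total J \<omega> \<partial>M) = (\<Sum>j. \<integral>\<^sup>+\<omega>. ennreal (Osc (j + J) \<omega>) \<partial>M)"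
    unfolding total_def by (rule nn_integral_suminf) measurable
  also have "\<dots> \<le> (\<Sum>j. ennreal (osc_bound C (j + J)))" by (intro suminf_le expectation_Osc) auto
  also have "\<dots> = ennreal (\<Sum>j. osc_bound C (j + J))"
    using osc_bound_pos[OF C] by (intro suminf_ennreal2 summable_ignore_initial_segment summable_osc_bound C) (auto intro: less_imp_le)
  finally show ?thesis .
qed

lemma total_finite:
  assumes "total J \<omega> < \<infinity>"
  shows "summable (\<lambda>j. Osc j \<omega>)" "total J \<omega> = ennreal (\<Sum>j. Osc (j + J) \<omega>)"
proof -
  have s: "summable (\<lambda>j. Osc (j + J) \<omega>)"
    using assms by (intro summable_suminf_not_top) (auto simp: total_def osc_nonneg)
  then show "summable (\<lambda>j. Osc j \<omega>)" using summable_iff_shift[of "\<lambda>j. Osc j \<omega>" J] by blast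
  show "total J \<omega> = ennreal (\<Sum>j. Osc (j + J) \<omega>)"
    unfolding total_def using s by (intro suminf_ennreal2) (auto simp: osc_nonneg)
qed

lemma AE_total_finite: "AE \<omega> in M. total 0 \<omega> < \<infinity>"
proof -
  have "(\<integral>\<^sup>+\<omega>. total 0 \<omega> \<partial>M) \<noteq> \<infinity>" using expectation_total[of 0] by (auto simp: top_unique)
  from nn_integral_PInf_AE[OF _ this] show ?thesis by (auto simp: less_top)
qed

text \<open>
  The second moments of \<open>\<zeta> (proj j x) - \<zeta> x\<close> are summable over \<open>j\<close>.
\<close>

lemma AE_proj_tendsto:
  assumes x: "x \<in> X" shows "AE \<omega> in M. (\<lambda>j. \<zeta> (proj j x) \<omega>) \<longlonglongrightarrow> \<zeta> x \<omega>"
proof -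
  have [measurable]: "\<zeta> x \<in> borel_measurable M" "\<And>j. \<zeta> (proj j x) \<in> borel_measurable M"
    using x proj(3)[OF x] by (auto intro: \<zeta>_measurable)
  let ?f = "\<lambda>\<omega>. \<Sum>j. ennreal ((\<zeta> (proj j x) \<omega> - \<zeta> x \<omega>) ^ 2)"
  have "(\<integral>\<^sup>+\<omega>. ?f \<omega> \<partial>M) = (\<Sum>j. \<integral>\<^sup>+\<omega>. ennreal ((\<zeta> (proj j x) \<omega> - \<zeta> x \<omega>) ^ 2) \<partial>M)"
    by (rule nn_integral_suminf) measurable
  also have "\<dots> \<le> (\<Sum>j. ennreal ((C * 2 powr \<gamma> * eps j) ^ 2))"
    using increment[of "proj _ x" x _ 1] proj[OF x] x eps_pos by (intro suminf_le) auto
  also have "\<dots> < \<infinity>"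
  proof -
    have "eps j ^ 2 \<le> \<delta> * eps j" for j
      using eps_pos[of j] \<delta> by (simp add: power2_eq_square eps_def divide_le_eq_1_pos mult_le_cancel_left_pos field_simps)
    then have "summable (\<lambda>j. eps j ^ 2)"
      by (intro summable_comparison_test'[OF summable_mult[OF summable_eps, of \<delta>]]) auto
    then have "summable (\<lambda>j. (C * 2 powr \<gamma>) ^ 2 * eps j ^ 2)" by (rule summable_mult)
    then have "summable (\<lambda>j. (C * 2 powr \<gamma> * eps j) ^ 2)" by (simp add: power_mult_distrib)
    then show ?thesis using ennreal_suminf_neq_top by (auto simp: less_top)
  qed
  finally have "(\<integral>\<^sup>+\<omega>. ?f \<omega> \<partial>M) \<noteq> \<infinity>" by simp
  then have "AE \<omega> in M. ?f \<omega> \<noteq> \<infinity>" by (intro nn_integral_PInf_AE) measurable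
  then show ?thesis
  proof (rule AE_mp, intro AE_I2 impI)
    fix \<omega> assume "?f \<omega> \<noteq> \<infinity>"
    then have "summable (\<lambda>j. (\<zeta> (proj j x) \<omega> - \<zeta> x \<omega>) ^ 2)" by (intro summable_suminf_not_top) auto
    then have "(\<lambda>j. (\<zeta> (proj j x) \<omega> - \<zeta> x \<omega>) ^ 2) \<longlonglongrightarrow> 0" by (rule summable_LIMSEQ_zero)
    then have "(\<lambda>j. sqrt ((\<zeta> (proj j x) \<omega> - \<zeta> x \<omega>) ^ 2)) \<longlonglongrightarrow> sqrt 0" by (rule tendsto_real_sqrt)
    then have "(\<lambda>j. \<zeta> (proj j x) \<omega> - \<zeta> x \<omega>) \<longlonglongrightarrow> 0" by (simp add: tendsto_rabs_zero_iff)
    then show "(\<lambda>j. \<zeta> (proj j x) \<omega>) \<longlonglongrightarrow> \<zeta> x \<omega>" by (simp add: LIM_zero_iff)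
  qed
qed

text \<open>
  The modification is the limit along the chains where the oscillations are summable, and zero elsewhere.
\<close>

theorem continuous_modification_exists: "\<exists>Z. continuous_modification M X d \<zeta> Z"
proof -
  define Z where "Z \<omega> = (if total 0 \<omega> < \<infinity> then restrict (\<lambda>x. lim (\<lambda>j. \<zeta> (proj j x) \<omega>)) X else restrict (\<lambda>x. 0) X)" for \<omega>
  have "Z \<in> M \<rightarrow>\<^sub>M borel_of CX"
  proof (rule measurable_into_C)
    fix \<omega> assume "\<omega> \<in> space M"
    show "Z \<omega> \<in> topspace CX"
    proof (cases "total 0 \<omega> < \<infinity>")
      case True
      note sm = total_finite(1)[OF True]
      have "continuous_map (semidist_topology X d) euclideanreal (Z \<omega>)"
        by (rule modulus_continuous[OF sm])
           (use summable_proj_converges[OF sm] True in \<open>auto simp: Z_def convergent_LIMSEQ_iff\<close>)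
      then show ?thesis using True by (simp add: topspace_C Z_def)
    next
      case False
      then show ?thesis by (auto simp: topspace_C Z_def continuous_map_semidist intro: exI[of _ 1])
    qed
  next
    fix x assume x: "x \<in> X"
    have [measurable]: "\<zeta> (proj j x) \<in> borel_measurable M" for j using proj(3)[OF x] by (rule \<zeta>_measurable)
    have "(\<lambda>\<omega>. if total 0 \<omega> < \<infinity> then lim (\<lambda>j. \<zeta> (proj j x) \<omega>) else 0) \<in> borel_measurable M"
      by measurable
    also have "(\<lambda>\<omega>. if total 0 \<omega> < \<infinity> then lim (\<lambda>j. \<zeta> (proj j x) \<omega>) else 0) = (\<lambda>\<omega>. Z \<omega> x)"
      using x by (auto simp: Z_def)
    finally show "(\<lambda>\<omega>. Z \<omega> x) \<in> borel_measurable M" .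
  qed
  moreover have "AE \<omega> in M. Z \<omega> x = \<zeta> x \<omega>" if x: "x \<in> X" for x
    using AE_total_finite AE_proj_tendsto[OF x] by eventually_elim (use x in \<open>auto simp: Z_def limI\<close>)
  ultimately show ?thesis unfolding continuous_modification_def by blast
qed

text \<open>
  Almost surely a continuous modification agrees with the field on all nets at once, since these are countable, and
  it is the limit of its own values along the chains. So it obeys \<open>modulus_bound\<close> whichever modification
  is chosen.
\<close>

lemma AE_modification_modulus:
  assumes Z: "continuous_modification M X d \<zeta> Z"
  shows "AE \<omega> in M. Z \<omega> \<in> topspace CX \<and>
    (\<forall>J. \<forall>x\<in>X. \<forall>y\<in>X. total J \<omega> < \<infinity> \<longrightarrow> d x y \<le> ennreal (eps J) \<longrightarrow> ennreal \<bar>Z \<omega> x - Z \<omega> y\<bar> \<le> 3 * total J \<omega>)"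
proof -
  have "countable (\<Union>j. A j)" using A_fin by (auto intro: countable_finite)
  then have "AE \<omega> in M. \<forall>a\<in>\<Union>j. A j. Z \<omega> a = \<zeta> a \<omega>"
    using Z A_sub by (subst AE_ball_countable) (auto simp: continuous_modification_def)
  moreover have "AE \<omega> in M. Z \<omega> \<in> topspace CX"
    using Z measurable_space[of Z M "borel_of CX"] by (auto simp: continuous_modification_def)
  ultimately show ?thesis
  proof eventually_elim
    case (elim \<omega>)
    then have cont: "continuous_map (semidist_topology X d) euclideanreal (Z \<omega>)" by (simp add: topspace_C)
    have lim: "(\<lambda>j. \<zeta> (proj j x) \<omega>) \<longlonglongrightarrow> Z \<omega> x" if x: "x \<in> X" for x
    proof (rule LIMSEQ_I)
      fix e :: real assume "0 < e"
      then obtain r where r: "r > 0" "\<forall>y\<in>X. d x y < ennreal r \<longrightarrow> \<bar>Z \<omega> x - Z \<omega> y\<bar> < e"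
        using cont x unfolding continuous_map_semidist by blast
      have "eventually (\<lambda>j. eps j < r) sequentially"
        using summable_LIMSEQ_zero[OF summable_eps] r(1) by (rule order_tendstoD)
      then obtain J where J: "\<And>j. j \<ge> J \<Longrightarrow> eps j < r" by (auto simp: eventually_sequentially)
      have "norm (\<zeta> (proj j x) \<omega> - Z \<omega> x) < e" if "j \<ge> J" for j
      proof -
        have "d x (proj j x) \<le> ennreal (eps j)" using proj[OF x, of j] x by (simp add: d_sym[OF x proj(3)[OF x]])
        also have "\<dots> < ennreal r" using J[OF that] eps_pos[of j] by (intro ennreal_lessI) auto
        finally have "\<bar>Z \<omega> x - Z \<omega> (proj j x)\<bar> < e" using r proj(3)[OF x] by blast
        moreover have "Z \<omega> (proj j x) = \<zeta> (proj j x) \<omega>" using elim proj(1)[OF x] by blast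
        ultimately show ?thesis by simp
      qed
      then show "\<exists>no. \<forall>n\<ge>no. norm (\<zeta> (proj n x) \<omega> - Z \<omega> x) < e" by blast
    qed
    have "ennreal \<bar>Z \<omega> x - Z \<omega> y\<bar> \<le> 3 * total J \<omega>"
      if "x \<in> X" "y \<in> X" "total J \<omega> < \<infinity>" "d x y \<le> ennreal (eps J)" for J x y
    proof -
      note t = total_finite[OF that(3)]
      have "ennreal \<bar>Z \<omega> x - Z \<omega> y\<bar> \<le> ennreal (3 * (\<Sum>j. Osc (j + J) \<omega>))"
        by (intro ennreal_leI modulus_bound[OF t(1) lim] that)
      also have "\<dots> = 3 * total J \<omega>"
        using summable_ignore_initial_segment[OF t(1), of J] unfolding t(2)
        by (subst ennreal_mult) (auto intro!: suminf_nonneg simp: osc_nonneg)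
      finally show ?thesis .
    qed
    with elim show ?case by blast
  qed
qed

end

section \<open>Tightness of fields with bounded increments\<close>

lemma (in prob_space) Markov_emeasure:
  assumes [measurable]: "u \<in> borel_measurable M" and a: "0 < a" and q: "0 \<le> q" "(\<integral>\<^sup>+\<omega>. u \<omega> \<partial>M) \<le> ennreal q"
  shows "emeasure M {\<omega> \<in> space M. ennreal a < u \<omega>} \<le> ennreal (q / a)"
proof -
  have "emeasure M {\<omega> \<in> space M. ennreal a < u \<omega>} \<le> emeasure M {\<omega> \<in> space M. 1 \<le> ennreal (1 / a) * u \<omega>}"
  proof (intro emeasure_mono subsetI)
    fix \<omega> assume "\<omega> \<in> {\<omega> \<in> space M. ennreal a < u \<omega>}"
    then have "ennreal (1 / a) * ennreal a \<le> ennreal (1 / a) * u \<omega>" "\<omega> \<in> space M"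
      by (auto intro!: mult_left_mono)
    then show "\<omega> \<in> {\<omega> \<in> space M. 1 \<le> ennreal (1 / a) * u \<omega>}"
      using a by (simp flip: ennreal_mult')
  qed measurable
  also have "\<dots> \<le> ennreal (1 / a) * (\<integral>\<^sup>+\<omega>. u \<omega> * indicator (space M) \<omega> \<partial>M)"
    by (rule nn_integral_Markov_inequality) measurable
  also have "(\<integral>\<^sup>+\<omega>. u \<omega> * indicator (space M) \<omega> \<partial>M) = (\<integral>\<^sup>+\<omega>. u \<omega> \<partial>M)"
    by (intro nn_integral_cong) auto
  also have "ennreal (1 / a) * (\<integral>\<^sup>+\<omega>. u \<omega> \<partial>M) \<le> ennreal (1 / a) * ennreal q"
    by (intro mult_left_mono q) auto
  also have "\<dots> = ennreal (q / a)" using a q(1) by (simp flip: ennreal_mult')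
  finally show ?thesis .
qed

text \<open>
  Fix the probability \<open>e\<close> that may be lost. Half of it pays for a uniform bound \<open>R\<close>: as \<open>eps 0\<close> is at
  least the diameter, the values at all points differ from the value at \<open>x0\<close> by at most \<open>3 * total 0\<close>. The other
  half is distributed geometrically over the conditions that the modulus of continuity at scale \<open>J m\<close> is at
  most \<open>1 / (m + 1)\<close>. Markov's inequality bounds each probability by the tails of \<open>osc_bound\<close>, which are the
  same for all fields of the family.
\<close>

theorem chaining_weakly_rel_compact:
  assumes chain: "net_chain X d \<delta> A \<gamma>" and M: "prob_space M" and C: "0 < C"
    and inc: "\<And>n. n \<in> I \<Longrightarrow> increments_bounded M X d \<gamma> C (\<zeta> n)"
    and x0: "x0 \<in> X" and V: "0 \<le> V" "\<And>n. n \<in> I \<Longrightarrow> (\<integral>\<^sup>+\<omega>. ennreal ((\<zeta> n x0 \<omega>)\<^sup>2) \<partial>M) \<le> ennreal V"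
    and Z: "\<And>n. n \<in> I \<Longrightarrow> continuous_modification M X d (\<zeta> n) (Z n)"
  shows "weakly_rel_compact (C_space X d) ((\<lambda>n. distr M (borel_of (C_space X d)) (Z n)) ` I)"
proof -
  interpret net_chain X d \<delta> A \<gamma> by (rule chain)
  interpret M: prob_space M by (rule M)
  have Zm: "Z n \<in> M \<rightarrow>\<^sub>M borel_of (C_space X d)" if "n \<in> I" for n
    using Z[OF that] by (simp add: continuous_modification_def)
  define tb where "tb J = (\<Sum>j. osc_bound C (j + J))" for J
  have si: "summable (\<lambda>j. osc_bound C (j + J))" for J
    using summable_osc_bound[OF C] by (rule summable_ignore_initial_segment)
  have tb0: "0 \<le> tb J" for J
    unfolding tb_def by (intro suminf_nonneg si) (auto intro: less_imp_le osc_bound_pos C)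
  have tb_small: "\<exists>J. tb J \<le> e" if e0: "0 < e" for e
  proof -
    obtain J where "norm (tb J) < e" using suminf_exist_split[OF e0 summable_osc_bound[OF C]] unfolding tb_def by blast
    then show ?thesis by (intro exI[of _ J]) auto
  qed
  show ?thesis
  proof (rule tight_imp_weakly_rel_compact[OF C_metrizable])
    show "(\<lambda>n. distr M (borel_of (C_space X d)) (Z n)) ` I \<subseteq> prob_measures (C_space X d)"
      using Zm by (auto simp: prob_measures_def intro: M.prob_space_distr)
  next
    fix e :: real assume e: "0 < e"
    have "\<forall>m. \<exists>J. tb J \<le> e / 2 * (1/2) ^ Suc m / (3 * real (Suc m))" using e by (intro allI tb_small) auto
    then obtain J where J: "\<And>m. tb (J m) \<le> e / 2 * (1/2) ^ Suc m / (3 * real (Suc m))" by metis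
    define Q where "Q = 1 + V + 3 * tb 0"
    define R where "R = 2 * Q / e"
    have Q: "0 < Q" using V(1) tb0[of 0] by (simp add: Q_def)
    have R: "0 < R" using Q e by (simp add: R_def)
    define S where "S = {g \<in> topspace (C_space X d). (\<forall>x\<in>X. \<bar>g x\<bar> \<le> R) \<and>
     (\<forall>m. \<forall>x\<in>X. \<forall>y\<in>X. d x y \<le> ennreal (eps (J m)) \<longrightarrow> \<bar>g x - g y\<bar> \<le> 1 / real (Suc m))}"
    let ?K = "C_space X d closure_of S"
    have K: "compactin (C_space X d) ?K"
      unfolding S_def by (rule compactin_equicontinuous_closure) (rule eps_pos)
    have "measure (distr M (borel_of (C_space X d)) (Z n)) (topspace (C_space X d) - ?K) \<le> e" if n: "n \<in> I" for n
    proof -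
      interpret F: chained_field X d \<delta> A \<gamma> M "\<zeta> n" C
        by unfold_locales (use C inc[OF n] in auto)
      have [measurable]: "\<zeta> n x0 \<in> borel_measurable M" by (rule F.\<zeta>_measurable[OF x0])
      define B0 where "B0 = {\<omega> \<in> space M. ennreal R < ennreal \<bar>\<zeta> n x0 \<omega>\<bar> + 3 * F.total 0 \<omega>}"
      define B where "B m = {\<omega> \<in> space M. ennreal (1 / (3 * real (Suc m))) < F.total (J m) \<omega>}" for m
      have Bs: "B0 \<in> sets M" "B m \<in> sets M" for m unfolding B0_def B_def by measurable
      have eB0: "emeasure M B0 \<le> ennreal (e / 2)"
      proof -
        have "(\<integral>\<^sup>+\<omega>. ennreal \<bar>\<zeta> n x0 \<omega>\<bar> \<partial>M) \<le> (\<integral>\<^sup>+\<omega>. 1 + ennreal ((\<zeta> n x0 \<omega>)\<^sup>2) \<partial>M)"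
        proof (rule nn_integral_mono)
          fix \<omega>
          have "\<bar>u\<bar> \<le> 1 + u\<^sup>2" for u :: real
            using zero_le_power2[of "\<bar>u\<bar> - 1"] by (simp add: power2_eq_square algebra_simps)
          from ennreal_leI[OF this] show "ennreal \<bar>\<zeta> n x0 \<omega>\<bar> \<le> 1 + ennreal ((\<zeta> n x0 \<omega>)\<^sup>2)"
            by (simp add: ennreal_plus)
        qed
        also have "\<dots> = 1 + (\<integral>\<^sup>+\<omega>. ennreal ((\<zeta> n x0 \<omega>)\<^sup>2) \<partial>M)"
          by (subst nn_integral_add) (auto simp: M.emeasure_space_1)
        also have "\<dots> \<le> 1 + ennreal V" by (intro add_left_mono V(2) n)
        finally have 1: "(\<integral>\<^sup>+\<omega>. ennreal \<bar>\<zeta> n x0 \<omega>\<bar> \<partial>M) \<le> 1 + ennreal V" .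
        have "(\<integral>\<^sup>+\<omega>. ennreal \<bar>\<zeta> n x0 \<omega>\<bar> + 3 * F.total 0 \<omega> \<partial>M) =
            (\<integral>\<^sup>+\<omega>. ennreal \<bar>\<zeta> n x0 \<omega>\<bar> \<partial>M) + 3 * (\<integral>\<^sup>+\<omega>. F.total 0 \<omega> \<partial>M)"
          by (simp add: nn_integral_add nn_integral_cmult)
        also have "\<dots> \<le> (1 + ennreal V) + 3 * ennreal (tb 0)"
          using F.expectation_total[of 0] by (intro add_mono 1 mult_left_mono) (auto simp: tb_def)
        also have "\<dots> = ennreal Q"
          using V(1) tb0[of 0] by (simp add: Q_def ennreal_plus ennreal_mult)
        finally have "emeasure M B0 \<le> ennreal (Q / R)"
          unfolding B0_def using Q R by (intro M.Markov_emeasure) auto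
        also have "Q / R = e / 2" using Q e by (simp add: R_def)
        finally show ?thesis .
      qed
      have eB: "emeasure M (B m) \<le> ennreal (e / 2 * (1/2) ^ Suc m)" for m
      proof -
        have "emeasure M (B m) \<le> ennreal (tb (J m) / (1 / (3 * real (Suc m))))"
          unfolding B_def using F.expectation_total[of "J m"] tb0
          by (intro M.Markov_emeasure) (auto simp: tb_def)
        also have "\<dots> \<le> ennreal (e / 2 * (1/2) ^ Suc m)"
        proof (rule ennreal_leI)
          have "tb (J m) * (3 * real (Suc m)) \<le> e / 2 * (1/2) ^ Suc m / (3 * real (Suc m)) * (3 * real (Suc m))"
            by (intro mult_right_mono J) auto
          also have "\<dots> = e / 2 * (1/2) ^ Suc m" by (subst times_divide_eq_left, rule nonzero_mult_div_cancel_right) auto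
          finally show "tb (J m) / (1 / (3 * real (Suc m))) \<le> e / 2 * (1/2) ^ Suc m" by simp
        qed
        finally show ?thesis .
      qed
      let ?B = "B0 \<union> (\<Union>m. B m)"
      have "emeasure M ?B \<le> emeasure M B0 + emeasure M (\<Union>m. B m)"
        using Bs by (intro emeasure_subadditive) auto
      also have "\<dots> \<le> ennreal (e / 2) + (\<Sum>m. emeasure M (B m))"
        using Bs by (intro add_mono eB0 emeasure_subadditive_countably) auto
      also have "\<dots> \<le> ennreal (e / 2) + (\<Sum>m. ennreal (e / 2 * (1/2) ^ Suc m))"
        by (intro add_left_mono suminf_le eB) auto
      also have "(\<Sum>m. ennreal (e / 2 * (1/2) ^ Suc m)) = ennreal (e / 2)"
        using e sums_mult[OF power_half_series, of "e/2"] by (intro suminf_ennreal_eq) auto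
      also have "ennreal (e / 2) + ennreal (e / 2) = ennreal e" using e by (simp flip: ennreal_plus)
      finally have eU: "emeasure M ?B \<le> ennreal e" .
      have "AE \<omega> in M. \<omega> \<in> Z n -` (topspace (C_space X d) - ?K) \<inter> space M \<longrightarrow> \<omega> \<in> ?B"
      proof -
        have "AE \<omega> in M. Z n \<omega> x0 = \<zeta> n x0 \<omega>"
          using Z[OF n] x0 by (auto simp: continuous_modification_def)
        with F.AE_modification_modulus[OF Z[OF n]] show ?thesis
        proof eventually_elim
          case (elim \<omega>)
          show ?case
          proof (rule impI, rule ccontr)
            assume w: "\<omega> \<in> Z n -` (topspace (C_space X d) - ?K) \<inter> space M" and "\<omega> \<notin> ?B"
            then have R0: "ennreal \<bar>\<zeta> n x0 \<omega>\<bar> + 3 * F.total 0 \<omega> \<le> ennreal R"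
              and Tm: "F.total (J m) \<omega> \<le> ennreal (1 / (3 * real (Suc m)))" for m
              by (auto simp: B0_def B_def not_less)
            have ZC: "Z n \<omega> \<in> topspace (C_space X d)"
              and mod: "\<And>J x y. x \<in> X \<Longrightarrow> y \<in> X \<Longrightarrow> F.total J \<omega> < \<infinity> \<Longrightarrow> d x y \<le> ennreal (eps J) \<Longrightarrow>
                 ennreal \<bar>Z n \<omega> x - Z n \<omega> y\<bar> \<le> 3 * F.total J \<omega>"
              using elim by blast+
            have fin0: "F.total 0 \<omega> < \<infinity>"
            proof (rule ccontr)
              assume "\<not> F.total 0 \<omega> < \<infinity>"
              then have "F.total 0 \<omega> = top" unfolding infinity_ennreal_def using top.not_eq_extremum by blast
              with R0 show False by (simp add: ennreal_mult_top top_unique)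
            qed
            have "\<bar>Z n \<omega> x\<bar> \<le> R" if x: "x \<in> X" for x
            proof -
              have "ennreal \<bar>Z n \<omega> x\<bar> \<le> ennreal (\<bar>Z n \<omega> x0\<bar> + \<bar>Z n \<omega> x - Z n \<omega> x0\<bar>)"
                by (intro ennreal_leI) linarith
              also have "\<dots> = ennreal \<bar>\<zeta> n x0 \<omega>\<bar> + ennreal \<bar>Z n \<omega> x - Z n \<omega> x0\<bar>"
                using elim by (simp add: ennreal_plus)
              also have "\<dots> \<le> ennreal \<bar>\<zeta> n x0 \<omega>\<bar> + 3 * F.total 0 \<omega>"
                using diam[OF x x0] by (intro add_left_mono mod x x0 fin0) (simp add: eps_0)
              finally have "ennreal \<bar>Z n \<omega> x\<bar> \<le> ennreal R" using R0 by (rule order_trans)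
              then show ?thesis using R by (simp add: ennreal_le_iff)
            qed
            moreover have "\<bar>Z n \<omega> x - Z n \<omega> y\<bar> \<le> 1 / real (Suc m)"
              if "x \<in> X" "y \<in> X" "d x y \<le> ennreal (eps (J m))" for m x y
            proof -
              have "F.total (J m) \<omega> < \<infinity>" using Tm[of m] by (auto intro: le_less_trans)
              then have "ennreal \<bar>Z n \<omega> x - Z n \<omega> y\<bar> \<le> 3 * F.total (J m) \<omega>" by (intro mod that)
              also have "\<dots> \<le> 3 * ennreal (1 / (3 * real (Suc m)))" by (intro mult_left_mono Tm) auto
              also have "\<dots> = ennreal (3 * (1 / (3 * real (Suc m))))" by (subst ennreal_mult) auto
              also have "3 * (1 / (3 * real (Suc m))) = 1 / real (Suc m)" by (simp add: divide_simps)
              finally show ?thesis by (simp add: ennreal_le_iff)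
            qed
            ultimately have "Z n \<omega> \<in> S" using ZC unfolding S_def by blast
            then have "Z n \<omega> \<in> ?K" by (rule subsetD[OF closure_of_subset, rotated]) (auto simp: S_def)
            then show False using w by blast
          qed
        qed
      qed
      then have "emeasure M (Z n -` (topspace (C_space X d) - ?K) \<inter> space M) \<le> emeasure M ?B"
        by (rule emeasure_mono_AE) (use Bs in auto)
      moreover have "topspace (C_space X d) - ?K \<in> sets (borel_of (C_space X d))"
        by (intro openin_sets_borel_of openin_diff) auto
      ultimately have "emeasure (distr M (borel_of (C_space X d)) (Z n)) (topspace (C_space X d) - ?K) \<le> ennreal e"
        using eU by (subst emeasure_distr[OF Zm[OF n]]) auto
      then show ?thesis using e unfolding measure_def by (intro enn2real_leI) auto
    qed
    then show "\<exists>K. compactin (C_space X d) K \<and>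
       (\<forall>\<mu>\<in>(\<lambda>n. distr M (borel_of (C_space X d)) (Z n)) ` I. measure \<mu> (topspace (C_space X d) - K) \<le> e)"
      using K by (intro exI[of _ ?K]) auto
  qed
qed

section \<open>The moment semi-distance\<close>

text \<open>
  Convexity of \<open>powr p\<close> on the closed half-line. At zero it amounts to \<open>a powr p \<le> a\<close> for \<open>a < 1\<close>.
\<close>

lemma powr_convex_combination:
  fixes u v t p :: real
  assumes u: "0 \<le> u" and v: "0 \<le> v" and t: "0 < t" "t < 1" and p: "1 \<le> p"
  shows "(t * u + (1 - t) * v) powr p \<le> t * u powr p + (1 - t) * v powr p"
proof -
  have scale: "(a * w) powr p \<le> a * w powr p" if "0 < a" "a < 1" "0 \<le> w" for a w :: real
  proof -
    have "a powr p \<le> a powr 1" using that p by (intro powr_mono') auto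
    then show ?thesis using that by (simp add: powr_mult mult_right_mono)
  qed
  consider "u = 0" | "v = 0" | "0 < u" "0 < v" using u v by linarith
  then show ?thesis
  proof cases
    case 1 then show ?thesis using scale[of "1 - t" v] t v by simp
  next
    case 2 then show ?thesis using scale[of t u] t u by simp
  next
    case 3
    show ?thesis
      using convex_onD[OF powr_convex[OF p], of "1 - t" u v] 3 t by simp
  qed
qed

lemma ennreal_rpow_mono: "x \<le> y \<Longrightarrow> 0 \<le> a \<Longrightarrow> ennreal_rpow x a \<le> ennreal_rpow y a"
  unfolding ennreal_rpow_def
  by (cases x; cases y) (auto simp: top_unique ennreal_le_iff intro!: ennreal_leI powr_mono2)

lemma ennreal_rpow_ennreal: "0 \<le> x \<Longrightarrow> ennreal_rpow (ennreal x) a = ennreal (x powr a)"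
  by (simp add: ennreal_rpow_def)

lemma Lp_norm_le_iff:
  assumes p: "0 < p" and a: "0 \<le> a"
  shows "Lp_norm M p f \<le> ennreal a \<longleftrightarrow> (\<integral>\<^sup>+ \<omega>. ennreal (\<bar>f \<omega>\<bar> powr p) \<partial>M) \<le> ennreal (a powr p)"
proof (cases "\<integral>\<^sup>+ \<omega>. ennreal (\<bar>f \<omega>\<bar> powr p) \<partial>M" rule: ennreal_cases)
  case (real u)
  have "u powr (1 / p) \<le> a \<longleftrightarrow> u \<le> a powr p"
  proof
    assume "u powr (1 / p) \<le> a"
    then have "(u powr (1 / p)) powr p \<le> a powr p" using p by (intro powr_mono2) auto
    then show "u \<le> a powr p" using real p by (simp add: powr_powr)
  next
    assume "u \<le> a powr p"
    then have "u powr (1 / p) \<le> (a powr p) powr (1 / p)" using real p by (intro powr_mono2) auto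
    then show "u powr (1 / p) \<le> a" using a p by (simp add: powr_powr)
  qed
  then show ?thesis
    using real a by (simp add: Lp_norm_def ennreal_rpow_ennreal ennreal_le_iff)
next
  case top
  then show ?thesis by (simp add: Lp_norm_def ennreal_rpow_def top_unique)
qed

text \<open>
  Minkowski's inequality. For \<open>\<bar>f\<bar> + \<bar>g\<bar>\<close> written as \<open>a + b\<close> times a convex combination of the normalized
  functions \<open>\<bar>f\<bar> / a\<close> and \<open>\<bar>g\<bar> / b\<close> it is convexity of the power. Norms that vanish are
  reached by letting the bounds \<open>a\<close> and \<open>b\<close> decrease to them.
\<close>

lemma Lp_norm_triangle:
  assumes [measurable]: "f \<in> borel_measurable M" "g \<in> borel_measurable M" and p: "1 \<le> p"
  shows "Lp_norm M p (\<lambda>\<omega>. f \<omega> + g \<omega>) \<le> Lp_norm M p f + Lp_norm M p g"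
proof -
  have main: "Lp_norm M p (\<lambda>\<omega>. f \<omega> + g \<omega>) \<le> ennreal (a + b)"
    if a: "0 < a" "Lp_norm M p f \<le> ennreal a" and b: "0 < b" "Lp_norm M p g \<le> ennreal b" for a b
  proof -
    let ?t = "a / (a + b)"
    have t: "0 < ?t" "?t < 1" and t1: "1 - ?t = b / (a + b)" using a b by (auto simp: field_simps)
    have If: "(\<integral>\<^sup>+ \<omega>. ennreal (\<bar>f \<omega>\<bar> powr p) \<partial>M) \<le> ennreal (a powr p)"
      and Ig: "(\<integral>\<^sup>+ \<omega>. ennreal (\<bar>g \<omega>\<bar> powr p) \<partial>M) \<le> ennreal (b powr p)"
      using a b p by (simp_all add: Lp_norm_le_iff)
    define cf where "cf = (a + b) powr p * ?t / a powr p"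
    define cg where "cg = (a + b) powr p * (1 - ?t) / b powr p"
    have c0: "0 \<le> cf" "0 \<le> cg"
      unfolding cf_def cg_def t1 using a b by auto
    have pt: "\<bar>f \<omega> + g \<omega>\<bar> powr p \<le> cf * \<bar>f \<omega>\<bar> powr p + cg * \<bar>g \<omega>\<bar> powr p" for \<omega>
    proof -
      have "\<bar>f \<omega> + g \<omega>\<bar> powr p \<le> (\<bar>f \<omega>\<bar> + \<bar>g \<omega>\<bar>) powr p" using p by (intro powr_mono2) auto
      also have "\<bar>f \<omega>\<bar> + \<bar>g \<omega>\<bar> = (a + b) * (?t * (\<bar>f \<omega>\<bar> / a) + (1 - ?t) * (\<bar>g \<omega>\<bar> / b))"
        unfolding t1 using a b by (simp add: distrib_left)
      also have "\<dots> powr p = (a + b) powr p * (?t * (\<bar>f \<omega>\<bar> / a) + (1 - ?t) * (\<bar>g \<omega>\<bar> / b)) powr p"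
        by (rule powr_mult)
      also have "\<dots> \<le> (a + b) powr p * (?t * (\<bar>f \<omega>\<bar> / a) powr p + (1 - ?t) * (\<bar>g \<omega>\<bar> / b) powr p)"
        using a b t p by (intro mult_left_mono powr_convex_combination) auto
      also have "\<dots> = cf * \<bar>f \<omega>\<bar> powr p + cg * \<bar>g \<omega>\<bar> powr p"
        using a b by (simp add: cf_def cg_def powr_divide distrib_left)
      finally show ?thesis .
    qed
    have "(\<integral>\<^sup>+ \<omega>. ennreal (\<bar>f \<omega> + g \<omega>\<bar> powr p) \<partial>M) \<le>
       (\<integral>\<^sup>+ \<omega>. ennreal cf * ennreal (\<bar>f \<omega>\<bar> powr p) + ennreal cg * ennreal (\<bar>g \<omega>\<bar> powr p) \<partial>M)"
      using c0 by (intro nn_integral_mono) (auto simp: ennreal_mult[symmetric] ennreal_plus[symmetric] simp del: ennreal_plus intro!: ennreal_leI pt)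
    also have "\<dots> = ennreal cf * (\<integral>\<^sup>+ \<omega>. ennreal (\<bar>f \<omega>\<bar> powr p) \<partial>M) + ennreal cg * (\<integral>\<^sup>+ \<omega>. ennreal (\<bar>g \<omega>\<bar> powr p) \<partial>M)"
      by (simp add: nn_integral_add nn_integral_cmult)
    also have "\<dots> \<le> ennreal cf * ennreal (a powr p) + ennreal cg * ennreal (b powr p)"
      by (intro add_mono mult_left_mono If Ig) auto
    also have "\<dots> = ennreal (cf * a powr p + cg * b powr p)"
      using c0 by (simp add: ennreal_mult ennreal_plus)
    also have "cf * a powr p + cg * b powr p = (a + b) powr p"
    proof -
      have "cf * a powr p = (a + b) powr p * ?t" "cg * b powr p = (a + b) powr p * (1 - ?t)"
        unfolding cf_def cg_def using a b by simp_all
      then have "cf * a powr p + cg * b powr p = (a + b) powr p * (?t + (1 - ?t))"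
        by (simp only: distrib_left)
      then show ?thesis by simp
    qed
    finally show ?thesis using a b p by (subst Lp_norm_le_iff) auto
  qed
  show ?thesis
  proof (cases "Lp_norm M p f = top \<or> Lp_norm M p g = top")
    case False
    then obtain a b where a: "0 \<le> a" "Lp_norm M p f = ennreal a" and b: "0 \<le> b" "Lp_norm M p g = ennreal b"
      by (metis ennreal_cases)
    show ?thesis
    proof (rule ennreal_le_epsilon)
      fix e :: real assume e: "0 < e"
      have "Lp_norm M p (\<lambda>\<omega>. f \<omega> + g \<omega>) \<le> ennreal ((a + e/2) + (b + e/2))"
        using a b e by (intro main) (auto intro!: ennreal_leI)
      also have "\<dots> = Lp_norm M p f + Lp_norm M p g + ennreal e"
        using a b e by (simp flip: ennreal_plus add: add_ac)
      finally show "Lp_norm M p (\<lambda>\<omega>. f \<omega> + g \<omega>) \<le> Lp_norm M p f + Lp_norm M p g + ennreal e" .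
    qed
  qed auto
qed

lemma q_norm_triangle:
  assumes [measurable]: "f \<in> borel_measurable M" "g \<in> borel_measurable M"
  shows "q_norm M q (\<lambda>\<omega>. f \<omega> + g \<omega>) \<le> q_norm M q f + q_norm M q g"
  unfolding q_norm_def[of M q "\<lambda>\<omega>. f \<omega> + g \<omega>"]
proof (rule SUP_least)
  fix p :: real assume p: "p \<in> {2..}"
  have "Lp_norm M p (\<lambda>\<omega>. f \<omega> + g \<omega>) / ennreal (p powr (1 / q)) \<le>
      (Lp_norm M p f + Lp_norm M p g) / ennreal (p powr (1 / q))"
    using p by (intro divide_right_mono_ennreal Lp_norm_triangle) auto
  also have "\<dots> = Lp_norm M p f / ennreal (p powr (1 / q)) + Lp_norm M p g / ennreal (p powr (1 / q))"
    by (rule add_divide_distrib_ennreal)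
  also have "\<dots> \<le> q_norm M q f + q_norm M q g"
    unfolding q_norm_def using p by (intro add_mono SUP_upper)
  finally show "Lp_norm M p (\<lambda>\<omega>. f \<omega> + g \<omega>) / ennreal (p powr (1 / q)) \<le> q_norm M q f + q_norm M q g" .
qed

lemma rho_dist_refl: "rho_dist M \<xi> q x x = 0"
  by (simp add: rho_dist_def q_norm_def Lp_norm_def ennreal_rpow_def)

lemma rho_dist_sym: "rho_dist M \<xi> q x y = rho_dist M \<xi> q y x"
  unfolding rho_dist_def q_norm_def Lp_norm_def by (simp add: abs_minus_commute)

lemma rho_dist_triangle:
  assumes "\<And>i x. 1 \<le> i \<Longrightarrow> x \<in> X \<Longrightarrow> \<xi> i x \<in> borel_measurable M" and xyz: "x \<in> X" "y \<in> X" "z \<in> X"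
  shows "rho_dist M \<xi> q x z \<le> rho_dist M \<xi> q x y + rho_dist M \<xi> q y z"
  unfolding rho_dist_def[of M \<xi> q x z]
proof (rule SUP_least)
  fix k :: nat assume k: "k \<in> {1..}"
  then have [measurable]: "\<xi> k x \<in> borel_measurable M" "\<xi> k y \<in> borel_measurable M" "\<xi> k z \<in> borel_measurable M"
    using assms by auto
  have "q_norm M q (\<lambda>\<omega>. \<xi> k x \<omega> - \<xi> k z \<omega>) = q_norm M q (\<lambda>\<omega>. (\<xi> k x \<omega> - \<xi> k y \<omega>) + (\<xi> k y \<omega> - \<xi> k z \<omega>))"
    by simp
  also have "\<dots> \<le> q_norm M q (\<lambda>\<omega>. \<xi> k x \<omega> - \<xi> k y \<omega>) + q_norm M q (\<lambda>\<omega>. \<xi> k y \<omega> - \<xi> k z \<omega>)"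
    by (rule q_norm_triangle) measurable
  also have "\<dots> \<le> rho_dist M \<xi> q x y + rho_dist M \<xi> q y z"
    unfolding rho_dist_def using k by (intro add_mono SUP_upper)
  finally show "q_norm M q (\<lambda>\<omega>. \<xi> k x \<omega> - \<xi> k z \<omega>) \<le> rho_dist M \<xi> q x y + rho_dist M \<xi> q y z" .
qed

lemma powr_even: "1 \<le> m \<Longrightarrow> \<bar>u :: real\<bar> powr real (2 * m) = u ^ (2 * m)"
  by (cases "u = 0") (auto simp: powr_realpow power_even_abs simp del: of_nat_mult)

lemma rho_dist_even_moment:
  assumes le: "rho_dist M \<xi> q x y \<le> ennreal r" and r: "0 \<le> r" and k: "1 \<le> k" and m: "1 \<le> m"
  shows "(\<integral>\<^sup>+ \<omega>. ennreal ((\<xi> k x \<omega> - \<xi> k y \<omega>) ^ (2 * m)) \<partial>M) \<le>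
     ennreal (((2 * real m) powr (1 / q) * r) ^ (2 * m))"
proof -
  let ?p = "real (2 * m)" and ?f = "\<lambda>\<omega>. \<xi> k x \<omega> - \<xi> k y \<omega>"
  let ?c = "?p powr (1 / q)"
  have c: "0 < ?c" using m by simp
  have "Lp_norm M ?p ?f / ennreal ?c \<le> q_norm M q ?f"
    unfolding q_norm_def using m by (intro SUP_upper) auto
  also have "\<dots> \<le> rho_dist M \<xi> q x y"
    unfolding rho_dist_def using k by (intro SUP_upper) auto
  also note le
  finally have "Lp_norm M ?p ?f / ennreal ?c * ennreal ?c \<le> ennreal r * ennreal ?c"
    by (rule mult_right_mono) simp
  also have "Lp_norm M ?p ?f / ennreal ?c * ennreal ?c = Lp_norm M ?p ?f"
    using c by (subst ennreal_divide_times, subst ennreal_divide_self) auto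
  also have "ennreal r * ennreal ?c = ennreal (?c * r)" using r by (simp add: ennreal_mult mult.commute)
  finally have "(\<integral>\<^sup>+ \<omega>. ennreal (\<bar>?f \<omega>\<bar> powr ?p) \<partial>M) \<le> ennreal ((?c * r) powr ?p)"
    using m r by (subst (asm) Lp_norm_le_iff) auto
  also have "(?c * r) powr ?p = (?c * r) ^ (2 * m)"
    using powr_even[OF m, of "?c * r"] r by simp
  finally show ?thesis using powr_even[OF m] by simp
qed

section \<open>Nets from the entropy integral\<close>

lemma covering_number_attained:
  assumes "\<exists>A. finite A \<and> A \<subseteq> X \<and> (\<forall>x\<in>X. \<exists>a\<in>A. d a x \<le> ennreal e)"
  shows "\<exists>A. finite A \<and> A \<subseteq> X \<and> (\<forall>x\<in>X. \<exists>a\<in>A. d a x \<le> ennreal e) \<and> covering_number X d e = enat (card A)"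
proof -
  let ?S = "{A. A \<subseteq> X \<and> finite A \<and> X \<subseteq> (\<Union>a\<in>A. {x\<in>X. d a x \<le> ennreal e})}"
  obtain A where "finite A" "A \<subseteq> X" "\<forall>x\<in>X. \<exists>a\<in>A. d a x \<le> ennreal e" using assms by blast
  then have "A \<in> ?S" by blast
  then have "enat (card A) \<in> (\<lambda>A. enat (card A)) ` ?S" by (rule imageI)
  then have "covering_number X d e \<in> (\<lambda>A. enat (card A)) ` ?S"
    unfolding covering_number_def by (rule wellorder_InfI)
  then obtain B where B: "B \<in> ?S" "covering_number X d e = enat (card B)" by auto
  then have "\<forall>x\<in>X. \<exists>a\<in>B. d a x \<le> ennreal e" by blast
  with B show ?thesis by (intro exI[of _ B]) auto
qed

lemma covering_number_le:
  assumes "finite A" "A \<subseteq> X" "\<forall>x\<in>X. \<exists>a\<in>A. d a x \<le> ennreal e"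
  shows "covering_number X d e \<le> enat (card A)"
  unfolding covering_number_def using assms by (intro INF_lower) blast

lemma covering_number_antimono: "e \<le> e' \<Longrightarrow> covering_number X d e' \<le> covering_number X d e"
  unfolding covering_number_def
proof (rule INF_superset_mono)
  assume "e \<le> e'"
  then have "d a x \<le> ennreal e \<Longrightarrow> d a x \<le> ennreal e'" for a x
    using order_trans ennreal_leI by blast
  then show "{A. A \<subseteq> X \<and> finite A \<and> X \<subseteq> (\<Union>a\<in>A. {x \<in> X. d a x \<le> ennreal e})} \<subseteq>
    {A. A \<subseteq> X \<and> finite A \<and> X \<subseteq> (\<Union>a\<in>A. {x \<in> X. d a x \<le> ennreal e'})}" by blast
qed simp

lemma entropy_fun_ge:
  assumes "e \<le> e'" "covering_number X d e' = enat n" "1 \<le> n"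
  shows "ennreal (ln (real n)) \<le> entropy_fun X d e"
proof (cases "covering_number X d e")
  case (enat k)
  then have "n \<le> k" using covering_number_antimono[OF assms(1), of X d] assms(2) by simp
  then show ?thesis using assms(3) enat by (auto simp: entropy_fun_def intro!: ennreal_leI)
qed (simp add: entropy_fun_def)

text \<open>
  Minimal nets are chosen at the scales \<open>\<epsilon> j\<close>. The entropy decreases with the radius, so the integral over
  \<open>{\<epsilon> (j+1)<..\<epsilon> j}\<close> is at least half of the \<open>j\<close>-th term of the series. If the diameter is zero the integral carries
  no information, but then one point is a net at every scale and all terms vanish.
\<close>

theorem (in compact_semidist) net_chain_exists:
  assumes diam: "semidist_diameter X d < \<infinity>" and \<gamma>: "0 < \<gamma>"
    and ent: "(\<integral>\<^sup>+ \<epsilon>\<in>{0..enn2real (semidist_diameter X d)}. ennreal_rpow (entropy_fun X d \<epsilon>) \<gamma> \<partial>lborel) < \<infinity>"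
  shows "\<exists>\<delta> A. net_chain X d \<delta> A \<gamma>"
proof -
  define D where "D = enn2real (semidist_diameter X d)"
  have D0: "0 \<le> D" by (simp add: D_def)
  have dD: "d x y \<le> ennreal D" if "x \<in> X" "y \<in> X" for x y
  proof -
    have "d x y \<le> semidist_diameter X d"
      unfolding semidist_diameter_def using that by (meson SUP_upper2 SUP_upper order_trans)
    then show ?thesis using diam by (simp add: D_def)
  qed
  \<comment> \<open>A positive largest scale even for zero diameter.\<close>
  define \<delta> where "\<delta> = (if D = 0 then 1 else D)"
  have \<delta>: "0 < \<delta>" "D \<le> \<delta>" using D0 by (auto simp: \<delta>_def)
  define \<epsilon> where "\<epsilon> j = \<delta> / 2 ^ j" for j :: nat
  have \<epsilon>: "0 < \<epsilon> j" "\<epsilon> (Suc j) = \<epsilon> j / 2" for j using \<delta> by (auto simp: \<epsilon>_def)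
  have "\<forall>j. \<exists>A. finite A \<and> A \<subseteq> X \<and> (\<forall>x\<in>X. \<exists>a\<in>A. d a x \<le> ennreal (\<epsilon> j)) \<and> covering_number X d (\<epsilon> j) = enat (card A)"
    by (intro allI covering_number_attained finite_net \<epsilon>)
  then obtain A where A: "\<And>j. finite (A j)" "\<And>j. A j \<subseteq> X" "\<And>j. \<forall>x\<in>X. \<exists>a\<in>A j. d a x \<le> ennreal (\<epsilon> j)"
    "\<And>j. covering_number X d (\<epsilon> j) = enat (card (A j))" by metis
  have Ane: "A j \<noteq> {}" for j using A(3)[of j] nonempty by blast
  have card: "1 \<le> card (A j)" for j using A(1)[of j] Ane[of j] by (simp add: Suc_le_eq card_gt_0_iff)
  define l where "l j = ln (real (card (A j))) powr \<gamma>" for j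
  have "summable (\<lambda>j. \<epsilon> j * l j)"
  proof (cases "D = 0")
    case True
    obtain x0 where x0: "x0 \<in> X" using nonempty by blast
    have "card (A j) = 1" for j
    proof -
      have "\<forall>x\<in>X. \<exists>a\<in>{x0}. d a x \<le> ennreal (\<epsilon> j)"
        using dD[OF x0] True by auto
      then have "covering_number X d (\<epsilon> j) \<le> enat (card {x0})"
        using x0 by (intro covering_number_le) auto
      then show ?thesis using A(4)[of j] card[of j] by simp
    qed
    then show ?thesis by (simp add: l_def)
  next
    case False
    then have \<delta>D: "\<delta> = D" by (simp add: \<delta>_def)
    have l0: "0 \<le> l j" for j by (simp add: l_def)
    have dec: "\<epsilon> i \<le> \<epsilon> j" if "j \<le> i" for i j
      using that \<delta> by (auto simp: \<epsilon>_def intro!: divide_left_mono power_increasing)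
    let ?f = "\<lambda>e. ennreal_rpow (entropy_fun X d e) \<gamma> * indicator {0..D} e"
    let ?s = "\<lambda>j e. ennreal (l j) * indicator {\<epsilon> (Suc j)<..\<epsilon> j} e"
    have "(\<Sum>j. ?s j e) \<le> ?f e" for e
    proof (cases "\<exists>j. e \<in> {\<epsilon> (Suc j)<..\<epsilon> j}")
      case True
      then obtain j where j: "e \<in> {\<epsilon> (Suc j)<..\<epsilon> j}" by blast
      have "e \<notin> {\<epsilon> (Suc i)<..\<epsilon> i}" if "i \<noteq> j" for i
        using j dec[of "Suc i" j] dec[of "Suc j" i] that by (cases "i < j") (auto simp: Suc_le_eq not_less)
      then have "(\<Sum>i. ?s i e) = (\<Sum>i\<in>{j}. ?s i e)" by (intro suminf_finite) auto
      also have "\<dots> = ennreal (l j)" using j by simp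
      also have "\<dots> = ennreal_rpow (ennreal (ln (real (card (A j))))) \<gamma>"
        using card[of j] by (simp add: l_def ennreal_rpow_ennreal)
      also have "\<dots> \<le> ennreal_rpow (entropy_fun X d e) \<gamma>"
        using j \<gamma> by (intro ennreal_rpow_mono entropy_fun_ge[OF _ A(4) card]) auto
      also have "\<dots> = ?f e"
      proof -
        have "\<epsilon> j \<le> \<epsilon> 0" by (rule dec) simp
        then have "e \<in> {0..D}" using j \<epsilon>(1)[of "Suc j"] by (auto simp: \<epsilon>_def[of 0] \<delta>D)
        then show ?thesis by simp
      qed
      finally show ?thesis .
    next
      case False
      then have "?s j e = 0" for j by auto
      then have "(\<Sum>j. ?s j e) = 0" by (simp only: suminf_zero)
      then show ?thesis by simp
    qed
    then have "(\<integral>\<^sup>+ e. (\<Sum>j. ?s j e) \<partial>lborel) \<le> (\<integral>\<^sup>+ e. ?f e \<partial>lborel)" by (intro nn_integral_mono)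
    also have "\<dots> < \<infinity>" using ent by (simp add: D_def)
    finally have fin: "(\<integral>\<^sup>+ e. (\<Sum>j. ?s j e) \<partial>lborel) < \<infinity>" .
    have "(\<integral>\<^sup>+ e. (\<Sum>j. ?s j e) \<partial>lborel) = (\<Sum>j. \<integral>\<^sup>+ e. ?s j e \<partial>lborel)"
      by (rule nn_integral_suminf) measurable
    also have "\<dots> = (\<Sum>j. ennreal (l j * (\<epsilon> j / 2)))"
    proof (rule suminf_cong)
      fix j
      have "(\<integral>\<^sup>+ e. ?s j e \<partial>lborel) = ennreal (l j) * ennreal (\<epsilon> j - \<epsilon> (Suc j))"
        using \<epsilon>[of j] by (simp add: nn_integral_cmult)
      also have "\<epsilon> j - \<epsilon> (Suc j) = \<epsilon> j / 2" using \<epsilon>(2)[of j] by simp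
      also have "ennreal (l j) * ennreal (\<epsilon> j / 2) = ennreal (l j * (\<epsilon> j / 2))"
        by (rule ennreal_mult'[OF l0, symmetric])
      finally show "(\<integral>\<^sup>+ e. ?s j e \<partial>lborel) = ennreal (l j * (\<epsilon> j / 2))" .
    qed
    finally have "summable (\<lambda>j. l j * (\<epsilon> j / 2))"
      using fin l0 \<epsilon> by (intro summable_suminf_not_top) (auto intro: mult_nonneg_nonneg less_imp_le)
    then have "summable (\<lambda>j. 2 * (l j * (\<epsilon> j / 2)))" by (rule summable_mult)
    then show ?thesis by (simp add: mult.commute)
  qed
  then have "net_chain X d \<delta> A \<gamma>"
    using \<delta> \<gamma> A dD order_trans[OF dD ennreal_leI[OF \<delta>(2)]]
    by unfold_locales (auto simp: \<epsilon>_def l_def)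
  then show ?thesis by blast
qed

section \<open>Moments of martingales\<close>

text \<open>
  A crude form of Young's inequality. Its factor of two affects only the terms of order at least two in
  \<open>moment_step\<close>, hence only the final constant.
\<close>

lemma power_mult_power_le:
  fixes s x :: real
  shows "\<bar>s\<bar> ^ i * \<bar>x\<bar> ^ k \<le> \<bar>s\<bar> ^ (i + k) + \<bar>x\<bar> ^ (i + k)"
proof (cases "\<bar>s\<bar> \<le> \<bar>x\<bar>")
  case True
  then have "\<bar>s\<bar> ^ i * \<bar>x\<bar> ^ k \<le> \<bar>x\<bar> ^ i * \<bar>x\<bar> ^ k" by (intro mult_right_mono power_mono) auto
  then show ?thesis by (simp add: power_add add_increasing)
next
  case False
  then have "\<bar>s\<bar> ^ i * \<bar>x\<bar> ^ k \<le> \<bar>s\<bar> ^ i * \<bar>s\<bar> ^ k" by (intro mult_left_mono power_mono) auto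
  then show ?thesis by (simp add: power_add add_increasing2)
qed

lemma binomial_quadratic_bound:
  fixes a c :: real
  assumes a: "0 < a" and c: "0 \<le> c" and pc: "real p * c \<le> a"
  shows "(a + c) ^ p \<le> a ^ p * (1 + real p * c / a + (real p * c / a)\<^sup>2)"
proof -
  have "(a + c) ^ p = a ^ p * (1 + c / a) ^ p"
    using a by (simp add: power_mult_distrib[symmetric] distrib_left)
  also have "(1 + c / a) ^ p \<le> exp (c / a) ^ p"
    using a c by (intro power_mono exp_ge_add_one_self) auto
  also have "exp (c / a) ^ p = exp (real p * c / a)" by (simp add: exp_of_nat_mult[symmetric])
  also have "\<dots> \<le> 1 + real p * c / a + (real p * c / a)\<^sup>2"
    using a c pc by (intro exp_bound) auto
  finally show ?thesis using a by simp
qed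

context prob_space
begin

lemma integrable_power_mult:
  assumes [measurable]: "s \<in> borel_measurable M" "x \<in> borel_measurable M"
    and "integrable M (\<lambda>\<omega>. \<bar>s \<omega>\<bar> ^ (i + k))" "integrable M (\<lambda>\<omega>. \<bar>x \<omega>\<bar> ^ (i + k) :: real)"
  shows "integrable M (\<lambda>\<omega>. s \<omega> ^ i * x \<omega> ^ k :: real)"
proof (rule Bochner_Integration.integrable_bound[OF Bochner_Integration.integrable_add[OF assms(3,4)]])
  show "AE \<omega> in M. norm (s \<omega> ^ i * x \<omega> ^ k) \<le> norm (\<bar>s \<omega>\<bar> ^ (i + k) + \<bar>x \<omega>\<bar> ^ (i + k))"
    using power_mult_power_le[of "s _" i "x _" k] by (intro AE_I2) (simp add: abs_mult power_abs)
qed measurable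

lemma moment_power_mult:
  assumes [measurable]: "s \<in> borel_measurable M" "x \<in> borel_measurable M"
    and int: "integrable M (\<lambda>\<omega>. \<bar>s \<omega>\<bar> ^ (i + k))" "integrable M (\<lambda>\<omega>. \<bar>x \<omega>\<bar> ^ (i + k) :: real)"
    and a: "0 < a" "expectation (\<lambda>\<omega>. \<bar>s \<omega>\<bar> ^ (i + k)) \<le> a ^ (i + k)"
    and c: "0 < c" "expectation (\<lambda>\<omega>. \<bar>x \<omega>\<bar> ^ (i + k)) \<le> c ^ (i + k)"
  shows "expectation (\<lambda>\<omega>. s \<omega> ^ i * x \<omega> ^ k) \<le> 2 * (a ^ i * c ^ k)"
proof -
  have "expectation (\<lambda>\<omega>. s \<omega> ^ i * x \<omega> ^ k) \<le>
      expectation (\<lambda>\<omega>. a ^ i * c ^ k * (\<bar>s \<omega>\<bar> ^ (i + k) / a ^ (i + k) + \<bar>x \<omega>\<bar> ^ (i + k) / c ^ (i + k)))"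
  proof (rule integral_mono)
    show "integrable M (\<lambda>\<omega>. s \<omega> ^ i * x \<omega> ^ k)" by (rule integrable_power_mult) (use int in auto)
    show "integrable M (\<lambda>\<omega>. a ^ i * c ^ k * (\<bar>s \<omega>\<bar> ^ (i + k) / a ^ (i + k) + \<bar>x \<omega>\<bar> ^ (i + k) / c ^ (i + k)))"
      using int by (intro integrable_mult_right Bochner_Integration.integrable_add integrable_divide_zero) auto
    fix \<omega>
    have "s \<omega> ^ i * x \<omega> ^ k \<le> \<bar>s \<omega>\<bar> ^ i * \<bar>x \<omega>\<bar> ^ k"
      by (metis abs_ge_self abs_mult power_abs)
    also have "\<dots> = a ^ i * c ^ k * (\<bar>s \<omega> / a\<bar> ^ i * \<bar>x \<omega> / c\<bar> ^ k)"
      using a c by (simp add: power_divide)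
    also have "\<dots> \<le> a ^ i * c ^ k * (\<bar>s \<omega> / a\<bar> ^ (i + k) + \<bar>x \<omega> / c\<bar> ^ (i + k))"
      using a c by (intro mult_left_mono power_mult_power_le) auto
    finally show "s \<omega> ^ i * x \<omega> ^ k \<le> a ^ i * c ^ k * (\<bar>s \<omega>\<bar> ^ (i + k) / a ^ (i + k) + \<bar>x \<omega>\<bar> ^ (i + k) / c ^ (i + k))"
      using a c by (simp add: power_divide)
  qed
  also have "\<dots> = a ^ i * c ^ k * (expectation (\<lambda>\<omega>. \<bar>s \<omega>\<bar> ^ (i + k)) / a ^ (i + k) + expectation (\<lambda>\<omega>. \<bar>x \<omega>\<bar> ^ (i + k)) / c ^ (i + k))"
    using int by simp
  also have "\<dots> \<le> a ^ i * c ^ k * (1 + 1)"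
    using a c by (intro mult_left_mono add_mono) (auto simp: divide_le_eq)
  finally show ?thesis by simp
qed

text \<open>
  In the binomial expansion of \<open>(s + x) ^ (2m)\<close> the linear term has expectation zero. The constant term is kept
  exactly and the others are at most twice the corresponding terms of \<open>(a + c) ^ (2m)\<close>, so the excess over
  \<open>a ^ (2m)\<close> is quadratic in \<open>2mc / a\<close>.
\<close>

lemma moment_step:
  assumes [measurable]: "s \<in> borel_measurable M" "x \<in> borel_measurable M" and m: "1 \<le> m"
    and int: "integrable M (\<lambda>\<omega>. s \<omega> ^ (2 * m))" "integrable M (\<lambda>\<omega>. x \<omega> ^ (2 * m) :: real)"
    and a: "0 < a" "expectation (\<lambda>\<omega>. s \<omega> ^ (2 * m)) \<le> a ^ (2 * m)"
    and c: "0 < c" "expectation (\<lambda>\<omega>. x \<omega> ^ (2 * m)) \<le> c ^ (2 * m)"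
    and orth: "expectation (\<lambda>\<omega>. s \<omega> ^ (2 * m - 1) * x \<omega>) = 0"
    and pc: "real (2 * m) * c \<le> a"
  shows "integrable M (\<lambda>\<omega>. (s \<omega> + x \<omega>) ^ (2 * m))"
    and "expectation (\<lambda>\<omega>. (s \<omega> + x \<omega>) ^ (2 * m)) \<le> a ^ (2 * m) * (1 + 2 * (real (2 * m) * c / a)\<^sup>2)"
proof -
  let ?p = "2 * m"
  define t where "t k \<omega> = real (?p choose k) * (s \<omega> ^ (?p - k) * x \<omega> ^ k)" for k \<omega>
  define g where "g k = real (?p choose k) * (a ^ (?p - k) * c ^ k)" for k
  have eq: "(\<lambda>\<omega>. (s \<omega> + x \<omega>) ^ ?p) = (\<lambda>\<omega>. \<Sum>k\<le>?p. t k \<omega>)"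
  proof
    fix \<omega> show "(s \<omega> + x \<omega>) ^ ?p = (\<Sum>k\<le>?p. t k \<omega>)"
      using binomial_ring[of "x \<omega>" "s \<omega>" ?p] by (simp add: t_def add.commute[of "s \<omega>"] mult_ac)
  qed
  have gsum: "(\<Sum>k\<le>?p. g k) = (a + c) ^ ?p"
    using binomial_ring[of c a ?p] by (simp add: g_def add.commute[of a] mult_ac)
  have ik: "(?p - k) + k = ?p" if "k \<le> ?p" for k using that by simp
  have absint: "integrable M (\<lambda>\<omega>. \<bar>s \<omega>\<bar> ^ ?p)" "integrable M (\<lambda>\<omega>. \<bar>x \<omega>\<bar> ^ ?p)"
    using int by (simp_all add: power_even_abs)
  have absE: "expectation (\<lambda>\<omega>. \<bar>s \<omega>\<bar> ^ ?p) \<le> a ^ ?p" "expectation (\<lambda>\<omega>. \<bar>x \<omega>\<bar> ^ ?p) \<le> c ^ ?p"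
    using a c by (simp_all add: power_even_abs)
  have ti: "integrable M (t k)" if "k \<le> ?p" for k
    unfolding t_def[abs_def]
    by (intro integrable_mult_right integrable_power_mult) (simp_all only: ik[OF that] absint assms(1,2))
  show "integrable M (\<lambda>\<omega>. (s \<omega> + x \<omega>) ^ ?p)"
    unfolding eq by (intro Bochner_Integration.integrable_sum ti) auto
  have "expectation (\<lambda>\<omega>. (s \<omega> + x \<omega>) ^ ?p) = (\<Sum>k\<le>?p. expectation (t k))"
    unfolding eq by (intro Bochner_Integration.integral_sum ti) auto
  also have "\<dots> \<le> (\<Sum>k\<le>?p. 2 * g k - (if k = 0 then g 0 else 0) - (if k = 1 then 2 * g 1 else 0))"
  proof (rule sum_mono)
    fix k assume k: "k \<in> {..?p}"
    have T2: "expectation (t k) \<le> 2 * g k"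
    proof -
      have "expectation (\<lambda>\<omega>. s \<omega> ^ (?p - k) * x \<omega> ^ k) \<le> 2 * (a ^ (?p - k) * c ^ k)"
        by (rule moment_power_mult) (use k in \<open>simp_all only: ik atMost_iff absint absE a c assms(1,2)\<close>)
      then have "real (?p choose k) * expectation (\<lambda>\<omega>. s \<omega> ^ (?p - k) * x \<omega> ^ k) \<le>
          real (?p choose k) * (2 * (a ^ (?p - k) * c ^ k))" by (intro mult_left_mono) auto
      then show ?thesis by (simp add: t_def[abs_def] g_def)
    qed
    have T0: "expectation (t 0) \<le> g 0" using a by (simp add: t_def[abs_def] g_def)
    have T1: "expectation (t 1) = 0" using orth by (simp add: t_def[abs_def])
    show "expectation (t k) \<le> 2 * g k - (if k = 0 then g 0 else 0) - (if k = 1 then 2 * g 1 else 0)"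
      using T0 T1 T2 by (cases "k = 0"; cases "k = 1") auto
  qed
  also have "\<dots> = 2 * (a + c) ^ ?p - g 0 - 2 * g 1"
    using m by (simp add: sum_subtractf sum_distrib_left[symmetric] gsum sum.delta)
  also have "\<dots> \<le> 2 * (a ^ ?p * (1 + real ?p * c / a + (real ?p * c / a)\<^sup>2)) - g 0 - 2 * g 1"
    using binomial_quadratic_bound[OF a(1) less_imp_le[OF c(1)] pc] by simp
  also have "g 0 = a ^ ?p" by (simp add: g_def)
  also have "g 1 = a ^ ?p * (real ?p * c / a)"
  proof -
    have "a ^ ?p = a ^ (?p - 1) * a" using m by (subst power_Suc2[symmetric]) simp
    then show ?thesis using a(1) by (simp add: g_def)
  qed
  also have "2 * (a ^ ?p * (1 + real ?p * c / a + (real ?p * c / a)\<^sup>2)) - a ^ ?p - 2 * (a ^ ?p * (real ?p * c / a)) =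
      a ^ ?p * (1 + 2 * (real ?p * c / a)\<^sup>2)" by (simp add: algebra_simps)
  finally show "expectation (\<lambda>\<omega>. (s \<omega> + x \<omega>) ^ ?p) \<le> a ^ ?p * (1 + 2 * (real ?p * c / a)\<^sup>2)" .
qed

end

lemma sum_power_le:
  fixes y :: "nat \<Rightarrow> real"
  assumes "1 \<le> m"
  shows "(\<Sum>i=1..n. y i) ^ (2 * m) \<le> real n ^ (2 * m) * (\<Sum>i=1..n. y i ^ (2 * m))"
proof (cases "n = 0")
  case False
  define b where "b = Max ((\<lambda>i. \<bar>y i\<bar>) ` {1..n})"
  have "b \<in> (\<lambda>i. \<bar>y i\<bar>) ` {1..n}" unfolding b_def using False by (intro Max_in) auto
  then obtain j where j: "j \<in> {1..n}" "b = \<bar>y j\<bar>" by auto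
  have "\<bar>\<Sum>i=1..n. y i\<bar> \<le> (\<Sum>i=1..n. \<bar>y i\<bar>)" by (rule sum_abs)
  also have "\<dots> \<le> real (card {1..n}) * b"
    by (rule sum_bounded_above) (auto simp: b_def)
  finally have "\<bar>\<Sum>i=1..n. y i\<bar> ^ (2 * m) \<le> (real n * b) ^ (2 * m)" by (intro power_mono) auto
  also have "\<dots> = real n ^ (2 * m) * y j ^ (2 * m)" using j by (simp add: power_mult_distrib power_even_abs)
  also have "\<dots> \<le> real n ^ (2 * m) * (\<Sum>i=1..n. y i ^ (2 * m))"
    by (intro mult_left_mono member_le_sum j) auto
  finally show ?thesis by (simp add: power_even_abs)
qed (use assms in \<open>simp add: power_0_left\<close>)

locale martingale_differences = prob_space M for M :: "'w measure" +
  fixes F :: "nat \<Rightarrow> 'w measure" and Y :: "nat \<Rightarrow> 'w \<Rightarrow> real"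
  assumes F_sub: "\<And>k. subalgebra M (F k)"
    and filt: "\<And>k l. k \<le> l \<Longrightarrow> sets (F k) \<subseteq> sets (F l)"
    and Y_measurable: "\<And>i. 1 \<le> i \<Longrightarrow> Y i \<in> borel_measurable M"
    and Y_diff: "\<And>i k. k < i \<Longrightarrow> AE \<omega> in M. real_cond_exp M (F k) (Y i) \<omega> = 0"
    and Y_adapted: "\<And>i. 1 \<le> i \<Longrightarrow> AE \<omega> in M. real_cond_exp M (F i) (Y i) \<omega> = Y i \<omega>"
begin

definition S :: "nat \<Rightarrow> 'w \<Rightarrow> real" where "S n \<omega> = (\<Sum>i=1..n. Y i \<omega>)"

lemma S_measurable [measurable]: "S n \<in> borel_measurable M"
  unfolding S_def[abs_def] by (intro borel_measurable_sum Y_measurable) auto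

lemma S_Suc: "S (Suc n) \<omega> = S n \<omega> + Y (Suc n) \<omega>"
  by (simp add: S_def)

text \<open>
  The partial sum is replaced by an almost surely equal function that is measurable for \<open>F n\<close>, because the
  \<open>Y i\<close> are adapted only up to null sets.
\<close>

lemma orthogonal:
  assumes int: "integrable M (\<lambda>\<omega>. S n \<omega> ^ k * Y (Suc n) \<omega>)"
  shows "expectation (\<lambda>\<omega>. S n \<omega> ^ k * Y (Suc n) \<omega>) = 0"
proof -
  interpret finite_measure_subalgebra M "F n" by unfold_locales (rule F_sub)
  have [measurable]: "Y (Suc n) \<in> borel_measurable M" by (rule Y_measurable) simp
  define T where "T \<omega> = (\<Sum>i=1..n. real_cond_exp M (F i) (Y i) \<omega>)" for \<omega>
  have TF: "T \<in> borel_measurable (F n)"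
    unfolding T_def[abs_def]
  proof (rule borel_measurable_sum)
    fix i assume "i \<in> {1..n}"
    then have "subalgebra (F n) (F i)"
      using F_sub[of i] F_sub[of n] filt[of i n] by (simp add: subalgebra_def)
    then show "real_cond_exp M (F i) (Y i) \<in> borel_measurable (F n)"
      by (rule measurable_from_subalg) (rule borel_measurable_cond_exp)
  qed
  have TM [measurable]: "T \<in> borel_measurable M" by (rule measurable_from_subalg[OF F_sub TF])
  have TS: "AE \<omega> in M. T \<omega> = S n \<omega>"
  proof -
    have "AE \<omega> in M. \<forall>i\<in>{1..n}. real_cond_exp M (F i) (Y i) \<omega> = Y i \<omega>"
      by (intro AE_finite_allI Y_adapted) auto
    then show ?thesis by eventually_elim (simp add: T_def S_def)
  qed
  have eq: "AE \<omega> in M. S n \<omega> ^ k * Y (Suc n) \<omega> = T \<omega> ^ k * Y (Suc n) \<omega>"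
    using TS by eventually_elim simp
  have intT: "integrable M (\<lambda>\<omega>. T \<omega> ^ k * Y (Suc n) \<omega>)"
    using eq by (rule integrable_cong_AE_imp[OF int, rotated]) measurable
  have "expectation (\<lambda>\<omega>. S n \<omega> ^ k * Y (Suc n) \<omega>) = expectation (\<lambda>\<omega>. T \<omega> ^ k * Y (Suc n) \<omega>)"
    using eq by (intro integral_cong_AE) measurable
  also have "\<dots> = expectation (\<lambda>\<omega>. T \<omega> ^ k * real_cond_exp M (F n) (Y (Suc n)) \<omega>)"
    by (rule real_cond_exp_intg(2)[symmetric, OF intT]) (use TF in measurable)
  also have "\<dots> = expectation (\<lambda>\<omega>. 0)"
  proof (rule integral_cong_AE)
    show "AE \<omega> in M. T \<omega> ^ k * real_cond_exp M (F n) (Y (Suc n)) \<omega> = 0"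
      using Y_diff[of n "Suc n", OF lessI] by eventually_elim simp
  qed measurable
  finally show ?thesis by simp
qed

text \<open>
  Starting the induction from \<open>n + 2m\<close> instead of \<open>n\<close> keeps the bound \<open>a\<close> for the sum above \<open>2mc\<close>, where
  \<open>moment_step\<close> applies. Its quadratic excess \<open>2 (2mc / a)\<^sup>2\<close> is the linear term of
  \<open>(1 + 8mc\<^sup>2 / a\<^sup>2) ^ m\<close>.
\<close>

lemma martingale_moment_aux:
  assumes m: "1 \<le> m" and c: "0 < c"
    and Yi: "\<And>i. 1 \<le> i \<Longrightarrow> integrable M (\<lambda>\<omega>. Y i \<omega> ^ (2 * m))"
    and YE: "\<And>i. 1 \<le> i \<Longrightarrow> expectation (\<lambda>\<omega>. Y i \<omega> ^ (2 * m)) \<le> c ^ (2 * m)"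
  shows "integrable M (\<lambda>\<omega>. S n \<omega> ^ (2 * m)) \<and>
    expectation (\<lambda>\<omega>. S n \<omega> ^ (2 * m)) \<le> (8 * real m * c\<^sup>2 * real (n + 2 * m)) ^ m"
proof (induction n)
  case 0
  then show ?case using m by (simp add: S_def power_0_left)
next
  case (Suc n)
  have [measurable]: "Y (Suc n) \<in> borel_measurable M" by (rule Y_measurable) simp
  \<comment> \<open>The induction hypothesis bounds the norm of the sum by \<open>a\<close>, and \<open>a\<^sup>2\<close> grows by \<open>8 m c\<^sup>2\<close> in each step.\<close>
  define a where "a = sqrt (8 * real m * c\<^sup>2 * real (n + 2 * m))"
  have a2: "a\<^sup>2 = 8 * real m * c\<^sup>2 * real (n + 2 * m)" by (simp add: a_def)
  have a: "0 < a" using m c by (simp add: a_def)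
  have ap: "a ^ (2 * m) = (8 * real m * c\<^sup>2 * real (n + 2 * m)) ^ m" by (simp add: power_mult a2)
  have IH: "integrable M (\<lambda>\<omega>. S n \<omega> ^ (2 * m))" "expectation (\<lambda>\<omega>. S n \<omega> ^ (2 * m)) \<le> a ^ (2 * m)"
    using Suc unfolding ap by auto
  have pc: "real (2 * m) * c \<le> a"
  proof (rule power2_le_imp_le)
    have "(real (2 * m) * c)\<^sup>2 \<le> 8 * real m * c\<^sup>2 * real (2 * m)"
      using mult_nonneg_nonneg[OF zero_le_power2[of c] zero_le_power2[of "real m"]]
      by (simp add: power2_eq_square mult_ac)
    also have "\<dots> \<le> 8 * real m * c\<^sup>2 * real (n + 2 * m)" by (intro mult_left_mono) auto
    finally show "(real (2 * m) * c)\<^sup>2 \<le> a\<^sup>2" by (simp add: a2)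
  qed (use a in simp)
  have m1: "(2 * m - 1) + 1 = 2 * m" using m by simp
  have "integrable M (\<lambda>\<omega>. S n \<omega> ^ (2 * m - 1) * Y (Suc n) \<omega> ^ 1)"
  proof (rule integrable_power_mult)
    show "integrable M (\<lambda>\<omega>. \<bar>S n \<omega>\<bar> ^ (2 * m - 1 + 1))" "integrable M (\<lambda>\<omega>. \<bar>Y (Suc n) \<omega>\<bar> ^ (2 * m - 1 + 1))"
      unfolding m1 using IH(1) Yi[of "Suc n"] by (simp_all add: power_even_abs)
  qed measurable
  then have orth: "expectation (\<lambda>\<omega>. S n \<omega> ^ (2 * m - 1) * Y (Suc n) \<omega>) = 0"
    by (intro orthogonal) simp
  note step = moment_step[OF S_measurable[of n] \<open>Y (Suc n) \<in> borel_measurable M\<close> m IH(1) Yi[of "Suc n"] a IH(2) c YE[of "Suc n"] orth pc]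
  have "a ^ (2 * m) * (1 + 2 * (real (2 * m) * c / a)\<^sup>2) = a ^ (2 * m) * (1 + real m * (8 * real m * c\<^sup>2 / a\<^sup>2))"
    by (simp add: power2_eq_square)
  also have "\<dots> \<le> a ^ (2 * m) * (1 + 8 * real m * c\<^sup>2 / a\<^sup>2) ^ m"
    using a by (intro mult_left_mono Bernoulli_inequality) (auto intro: order_trans[of _ 0])
  also have "\<dots> = (a\<^sup>2 * (1 + 8 * real m * c\<^sup>2 / a\<^sup>2)) ^ m" by (simp add: power_mult power_mult_distrib)
  also have "a\<^sup>2 * (1 + 8 * real m * c\<^sup>2 / a\<^sup>2) = a\<^sup>2 + 8 * real m * c\<^sup>2" using a by (simp add: distrib_left)
  also have "\<dots> = 8 * real m * c\<^sup>2 * real (Suc n + 2 * m)" unfolding a2 by (simp add: algebra_simps)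
  finally have "a ^ (2 * m) * (1 + 2 * (real (2 * m) * c / a)\<^sup>2) \<le> (8 * real m * c\<^sup>2 * real (Suc n + 2 * m)) ^ m" .
  then show ?case using step by (auto simp: S_Suc[abs_def] intro: order_trans)
qed

text \<open>
  For \<open>n \<ge> 2m\<close> the shift in \<open>martingale_moment_aux\<close> at most doubles the bound. For \<open>n < 2m\<close> no cancellation
  has to be used: bounding the sum by its largest term gives \<open>n (nc) ^ (2m)\<close>, and
  \<open>n \<le> 2 ^ (2m)\<close>.
\<close>

theorem martingale_even_moment:
  assumes m: "1 \<le> m" and n: "1 \<le> n" and c: "0 < c"
    and Yi: "\<And>i. 1 \<le> i \<Longrightarrow> integrable M (\<lambda>\<omega>. Y i \<omega> ^ (2 * m))"
    and YE: "\<And>i. 1 \<le> i \<Longrightarrow> expectation (\<lambda>\<omega>. Y i \<omega> ^ (2 * m)) \<le> c ^ (2 * m)"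
  shows "integrable M (\<lambda>\<omega>. S n \<omega> ^ (2 * m))"
    and "expectation (\<lambda>\<omega>. S n \<omega> ^ (2 * m)) \<le> (16 * real m * real n * c\<^sup>2) ^ m"
proof -
  note aux = martingale_moment_aux[OF m c Yi YE, of n]
  then show int: "integrable M (\<lambda>\<omega>. S n \<omega> ^ (2 * m))" by simp
  show "expectation (\<lambda>\<omega>. S n \<omega> ^ (2 * m)) \<le> (16 * real m * real n * c\<^sup>2) ^ m"
  proof (cases "2 * m \<le> n")
    case True
    have "8 * real m * c\<^sup>2 * real (n + 2 * m) \<le> 8 * real m * c\<^sup>2 * (2 * real n)"
      using True by (intro mult_left_mono) auto
    then have "(8 * real m * c\<^sup>2 * real (n + 2 * m)) ^ m \<le> (16 * real m * real n * c\<^sup>2) ^ m"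
      by (intro power_mono) (auto simp: mult_ac)
    then show ?thesis using aux by linarith
  next
    case False
    have "expectation (\<lambda>\<omega>. S n \<omega> ^ (2 * m)) \<le> expectation (\<lambda>\<omega>. real n ^ (2 * m) * (\<Sum>i=1..n. Y i \<omega> ^ (2 * m)))"
      unfolding S_def using int[unfolded S_def]
      by (intro integral_mono sum_power_le m integrable_mult_right Bochner_Integration.integrable_sum Yi) auto
    also have "\<dots> = real n ^ (2 * m) * (\<Sum>i=1..n. expectation (\<lambda>\<omega>. Y i \<omega> ^ (2 * m)))"
      by (subst Bochner_Integration.integral_mult_right)
         (auto intro!: Bochner_Integration.integrable_sum Bochner_Integration.integral_sum Yi)
    also have "\<dots> \<le> real n ^ (2 * m) * (\<Sum>i=1..n. c ^ (2 * m))"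
      by (intro mult_left_mono sum_mono YE) auto
    also have "\<dots> = real n * (real n * c) ^ (2 * m)" by (simp add: power_mult_distrib)
    also have "\<dots> \<le> 2 ^ (2 * m) * (real n * c) ^ (2 * m)"
    proof (intro mult_right_mono)
      have "real n < 2 ^ n" by (rule of_nat_less_two_power)
      also have "(2::real) ^ n \<le> 2 ^ (2 * m)" using False by (intro power_increasing) auto
      finally show "real n \<le> 2 ^ (2 * m)" by simp
    qed (use c in auto)
    also have "\<dots> = (4 * (real n * real n) * c\<^sup>2) ^ m"
      by (simp add: power_mult power_mult_distrib power2_eq_square)
    also have "\<dots> \<le> (16 * real m * real n * c\<^sup>2) ^ m"
    proof (intro power_mono mult_right_mono)
      have "real n * real n \<le> (2 * real m) * real n" using False by (intro mult_right_mono) auto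
      moreover have "0 \<le> real m * real n" by simp
      ultimately show "4 * (real n * real n) \<le> 16 * real m * real n" unfolding mult.assoc by linarith
    qed auto
    finally show ?thesis .
  qed
qed

end

lemma even_moment_integrable:
  assumes [measurable]: "f \<in> borel_measurable M" and a: "0 \<le> a"
    and le: "(\<integral>\<^sup>+ \<omega>. ennreal (f \<omega> ^ (2 * m)) \<partial>M) \<le> ennreal a"
  shows "integrable M (\<lambda>\<omega>. f \<omega> ^ (2 * m) :: real)" "integral\<^sup>L M (\<lambda>\<omega>. f \<omega> ^ (2 * m)) \<le> a"
proof -
  show int: "integrable M (\<lambda>\<omega>. f \<omega> ^ (2 * m))"
    using le by (intro integrableI_nonneg) (auto intro: le_less_trans)
  have "ennreal (integral\<^sup>L M (\<lambda>\<omega>. f \<omega> ^ (2 * m))) \<le> ennreal a"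
    using le by (subst nn_integral_eq_integral[symmetric, OF int]) auto
  then show "integral\<^sup>L M (\<lambda>\<omega>. f \<omega> ^ (2 * m)) \<le> a" using a by (simp add: ennreal_le_iff)
qed

lemma Lp_norm_finite_integrable:
  assumes [measurable]: "f \<in> borel_measurable M" and fin: "Lp_norm M 1 f < \<infinity>"
  shows "integrable M f"
proof -
  obtain c where c: "0 \<le> c" "Lp_norm M 1 f = ennreal c" using fin by (metis ennreal_cases less_irrefl infinity_ennreal_def)
  then have "(\<integral>\<^sup>+ \<omega>. ennreal (\<bar>f \<omega>\<bar> powr 1) \<partial>M) \<le> ennreal (c powr 1)"
    by (subst Lp_norm_le_iff[symmetric]) auto
  then show ?thesis by (intro integrableI_bounded) (auto intro: le_less_trans)
qed

lemma (in martingale_differences) normalized_even_moment: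
  assumes m: "1 \<le> m" and n: "1 \<le> n" and c: "0 < c"
    and YE: "\<And>i. 1 \<le> i \<Longrightarrow> (\<integral>\<^sup>+ \<omega>. ennreal (Y i \<omega> ^ (2 * m)) \<partial>M) \<le> ennreal (c ^ (2 * m))"
  shows "(\<integral>\<^sup>+ \<omega>. ennreal ((real n powr (- 1 / 2) * S n \<omega>) ^ (2 * m)) \<partial>M) \<le> ennreal ((16 * real m * c\<^sup>2) ^ m)"
proof -
  have c0: "0 \<le> c ^ (2 * m)" using c by simp
  note Ym = even_moment_integrable[OF Y_measurable c0 YE]
  note S = martingale_even_moment[OF m n c Ym]
  have nm: "(real n powr (- 1 / 2)) ^ (2 * m) = 1 / real n ^ m"
  proof -
    have "(real n powr (- 1 / 2)) ^ 2 = 1 / real n"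
      using n by (simp add: power2_eq_square powr_add[symmetric] powr_minus_divide)
    then show ?thesis by (simp add: power_mult power_one_over)
  qed
  have int: "integrable M (\<lambda>\<omega>. (real n powr (- 1 / 2) * S n \<omega>) ^ (2 * m))"
    using S(1) by (simp add: power_mult_distrib)
  have "(\<integral>\<^sup>+ \<omega>. ennreal ((real n powr (- 1 / 2) * S n \<omega>) ^ (2 * m)) \<partial>M) =
      ennreal (expectation (\<lambda>\<omega>. (real n powr (- 1 / 2) * S n \<omega>) ^ (2 * m)))"
    by (rule nn_integral_eq_integral[OF int]) simp
  also have "expectation (\<lambda>\<omega>. (real n powr (- 1 / 2) * S n \<omega>) ^ (2 * m)) = expectation (\<lambda>\<omega>. S n \<omega> ^ (2 * m)) / real n ^ m"
    by (simp only: power_mult_distrib nm) simp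
  also have "\<dots> \<le> (16 * real m * real n * c\<^sup>2) ^ m / real n ^ m"
    by (rule divide_right_mono[OF S(2)]) auto
  also have "\<dots> = (16 * real m * c\<^sup>2) ^ m"
    using n by (simp add: power_mult_distrib)
  finally show ?thesis by (simp add: ennreal_leI)
qed

section \<open>Weak compactness of the normalized sums\<close>

text \<open>
  The constant \<open>3\<close> serves for both families: for the single fields \<open>(2m) powr (1/q) \<le> (2m) powr \<gamma>\<close>, and for
  the normalized sums \<open>16 m \<le> 3\<^sup>2 * 2m\<close>.
\<close>

theorem theorem2p2:
  fixes M :: "'w measure"
    and F :: "nat \<Rightarrow> 'w measure"
    and X :: "'x set"
    and \<xi> :: "nat \<Rightarrow> 'x \<Rightarrow> 'w \<Rightarrow> real"
    and B :: ereal
    and q :: real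
  defines "\<rho> \<equiv> rho_dist M \<xi> q"
  assumes "prob_space M"
    and "\<And>k. subalgebra M (F k)"
    and "\<And>k l. k \<le> l \<Longrightarrow> sets (F k) \<subseteq> sets (F l)"
    and "sets (F 0) = {{}, space M}"
    and "\<And>i x. 1 \<le> i \<Longrightarrow> x \<in> X \<Longrightarrow> \<xi> i x \<in> borel_measurable M"
    and "\<And>i k x. k < i \<Longrightarrow> x \<in> X \<Longrightarrow> AE \<omega> in M. real_cond_exp M (F k) (\<xi> i x) \<omega> = 0"
    and "\<And>i x. 1 \<le> i \<Longrightarrow> x \<in> X \<Longrightarrow> AE \<omega> in M. real_cond_exp M (F i) (\<xi> i x) \<omega> = \<xi> i x \<omega>"
    and "2 < B"
    and "\<And>p::real. 1 \<le> p \<Longrightarrow> ereal p < B \<Longrightarrow> (SUP i\<in>{1..}. SUP x\<in>X. Lp_norm M p (\<xi> i x)) < \<infinity>"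
    and "0 < q"
    and "semidist_diameter X \<rho> < \<infinity>"
    and "compact_space (semidist_topology X \<rho>)"
    and "(INF x\<in>X. SUP n\<in>{1::nat..}.
            ennreal (1 / real n * (\<Sum>k=1..n. prob_space.variance M (\<xi> k x)))) < \<infinity>"
    and "(\<integral>\<^sup>+ \<epsilon>\<in>{0..enn2real (semidist_diameter X \<rho>)}.
            ennreal_rpow (entropy_fun X \<rho> \<epsilon>) ((2 + q) / (2 * q)) \<partial>lborel) < \<infinity>"
  shows "(\<forall>i\<ge>1. \<exists>Y. continuous_modification M X \<rho> (\<xi> i) Y) \<and>
         (\<forall>n\<ge>1. \<exists>Z. continuous_modification M X \<rho> (normalized_sum \<xi> n) Z) \<and>
         (\<forall>Z. (\<forall>n\<ge>1. continuous_modification M X \<rho> (normalized_sum \<xi> n) (Z n)) \<longrightarrow>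
              weakly_rel_compact (C_space X \<rho>)
                {distr M (borel_of (C_space X \<rho>)) (Z n) | n. 1 \<le> n})"
proof -
  interpret prob_space M by (rule assms(2))
  define \<gamma> where "\<gamma> = (2 + q) / (2 * q)"
  have q: "0 < q" by (rule assms(11))
  have \<gamma>: "0 < \<gamma>" and \<gamma>q: "\<gamma> = 1 / 2 + 1 / q" using q by (auto simp: \<gamma>_def field_simps)
  have meas: "\<xi> i x \<in> borel_measurable M" if "1 \<le> i" "x \<in> X" for i x using assms(6) that by blast
  have Xne: "X \<noteq> {}" using assms(14) by auto
  interpret compact_semidist X \<rho>
    by unfold_locales
       (use rho_dist_triangle[of X \<xi> M] meas assms(13) Xne in
         \<open>auto simp: \<rho>_def rho_dist_refl rho_dist_sym\<close>)
  obtain \<delta> A where chain: "net_chain X \<rho> \<delta> A \<gamma>"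
    using net_chain_exists[OF assms(12) \<gamma>] assms(15) unfolding \<gamma>_def by blast
  have norm_fin: "Lp_norm M p (\<xi> i x) \<le> (SUP i\<in>{1..}. SUP x\<in>X. Lp_norm M p (\<xi> i x))" if "1 \<le> i" "x \<in> X" for p i x
    using that by (meson SUP_upper2 SUP_upper atLeast_iff)
  have int: "integrable M (\<xi> i x)" if "1 \<le> i" "x \<in> X" for i x
  proof (rule Lp_norm_finite_integrable[OF meas[OF that]])
    have "ereal 1 < B" using assms(9) by (rule less_trans[rotated]) simp
    then have "(SUP i\<in>{1..}. SUP x\<in>X. Lp_norm M 1 (\<xi> i x)) < \<infinity>" using assms(10)[of 1] by simp
    then show "Lp_norm M 1 (\<xi> i x) < \<infinity>" by (rule le_less_trans[OF norm_fin[OF that]])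
  qed
  have cond: "sigma_finite_subalgebra M (F k)" for k
  proof -
    interpret finite_measure_subalgebra M "F k" by unfold_locales (rule assms(3))
    show ?thesis by (rule sigma_finite_subalgebra_axioms)
  qed
  have md_diff: "martingale_differences M F (\<lambda>i \<omega>. \<xi> i x \<omega> - \<xi> i y \<omega>)" if x: "x \<in> X" and y: "y \<in> X" for x y
  proof unfold_locales
    fix i k :: nat assume ki: "k < i"
    then have i: "1 \<le> i" by simp
    show "AE \<omega> in M. real_cond_exp M (F k) (\<lambda>\<omega>. \<xi> i x \<omega> - \<xi> i y \<omega>) \<omega> = 0"
      using sigma_finite_subalgebra.real_cond_exp_diff[OF cond int[OF i x] int[OF i y], of k]
        assms(7)[OF ki x] assms(7)[OF ki y] by eventually_elim simp
  next
    fix i :: nat assume i: "1 \<le> i"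
    show "AE \<omega> in M. real_cond_exp M (F i) (\<lambda>\<omega>. \<xi> i x \<omega> - \<xi> i y \<omega>) \<omega> = \<xi> i x \<omega> - \<xi> i y \<omega>"
      using sigma_finite_subalgebra.real_cond_exp_diff[OF cond int[OF i x] int[OF i y], of i]
        assms(8)[OF i x] assms(8)[OF i y] by eventually_elim simp
    show "(\<lambda>\<omega>. \<xi> i x \<omega> - \<xi> i y \<omega>) \<in> borel_measurable M" using meas[OF i x] meas[OF i y] by measurable
  qed (use assms(3,4) in auto)
  have md: "martingale_differences M F (\<lambda>i. \<xi> i x)" if x: "x \<in> X" for x
    by unfold_locales (use assms(3,4,7,8) meas x in auto)
  have sqrt_eq: "(2 * real m) powr (1 / q) * sqrt (2 * real m) = (2 * real m) powr \<gamma>" if "1 \<le> m" for m :: nat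
    using that by (simp add: \<gamma>q powr_add powr_half_sqrt)
  have inc_\<xi>: "increments_bounded M X \<rho> \<gamma> 3 (\<xi> i)" if i: "1 \<le> i" for i
    unfolding increments_bounded_def
  proof (intro conjI ballI allI impI)
    fix x y and r :: real and m :: nat
    assume xy: "x \<in> X" "y \<in> X" "0 < r" "1 \<le> m" "\<rho> x y \<le> ennreal r"
    have "(2 * real m) powr (1 / q) \<le> (2 * real m) powr \<gamma>" using xy(4) by (intro powr_mono) (auto simp: \<gamma>q)
    then have le: "(2 * real m) powr (1 / q) * r \<le> 3 * (2 * real m) powr \<gamma> * r"
      using xy(3) by (intro mult_right_mono) (auto intro: order_trans)
    have "(\<integral>\<^sup>+ \<omega>. ennreal ((\<xi> i x \<omega> - \<xi> i y \<omega>) ^ (2 * m)) \<partial>M) \<le> ennreal (((2 * real m) powr (1 / q) * r) ^ (2 * m))"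
      using xy i by (intro rho_dist_even_moment) (auto simp: \<rho>_def)
    also have "\<dots> \<le> ennreal ((3 * (2 * real m) powr \<gamma> * r) ^ (2 * m))"
      using xy by (intro ennreal_leI power_mono le) auto
    finally show "(\<integral>\<^sup>+ \<omega>. ennreal ((\<xi> i x \<omega> - \<xi> i y \<omega>) ^ (2 * m)) \<partial>M) \<le> ennreal ((3 * (2 * real m) powr \<gamma> * r) ^ (2 * m))" .
  qed (use meas i in auto)
  have inc_\<eta>: "increments_bounded M X \<rho> \<gamma> 3 (normalized_sum \<xi> n)" if n: "1 \<le> n" for n
    unfolding increments_bounded_def
  proof (intro conjI ballI allI impI)
    fix x assume "x \<in> X"
    then show "normalized_sum \<xi> n x \<in> borel_measurable M"
      unfolding normalized_sum_def[abs_def] by (intro borel_measurable_times borel_measurable_sum meas) auto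
  next
    fix x y and r :: real and m :: nat
    assume xy: "x \<in> X" "y \<in> X" "0 < r" "1 \<le> m" "\<rho> x y \<le> ennreal r"
    interpret D: martingale_differences M F "\<lambda>i \<omega>. \<xi> i x \<omega> - \<xi> i y \<omega>" by (rule md_diff[OF xy(1,2)])
    define c where "c = (2 * real m) powr (1 / q) * r"
    have c: "0 < c" using xy by (simp add: c_def)
    have "normalized_sum \<xi> n x \<omega> - normalized_sum \<xi> n y \<omega> = real n powr (- 1 / 2) * D.S n \<omega>" for \<omega>
      by (simp add: normalized_sum_def D.S_def sum_subtractf right_diff_distrib)
    then have "(\<integral>\<^sup>+ \<omega>. ennreal ((normalized_sum \<xi> n x \<omega> - normalized_sum \<xi> n y \<omega>) ^ (2 * m)) \<partial>M) \<le>
        ennreal ((16 * real m * c\<^sup>2) ^ m)"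
      using D.normalized_even_moment[OF xy(4) n c] rho_dist_even_moment[of M \<xi> q x y r _ m] xy
      by (simp add: c_def \<rho>_def)
    also have "\<dots> \<le> ennreal ((3 * (2 * real m) powr \<gamma> * r) ^ (2 * m))"
    proof (rule ennreal_leI)
      have "(3 * (2 * real m) powr \<gamma> * r) ^ 2 = (3 * c * sqrt (2 * real m)) ^ 2"
        unfolding sqrt_eq[OF xy(4), symmetric] c_def by (simp only: mult_ac)
      also have "\<dots> = 18 * real m * c\<^sup>2" by (simp add: power_mult_distrib)
      finally have "(3 * (2 * real m) powr \<gamma> * r) ^ 2 = 18 * real m * c\<^sup>2" .
      moreover have "16 * real m * c\<^sup>2 \<le> 18 * real m * c\<^sup>2" by (intro mult_right_mono) auto
      ultimately show "(16 * real m * c\<^sup>2) ^ m \<le> (3 * (2 * real m) powr \<gamma> * r) ^ (2 * m)"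
        unfolding power_mult by (intro power_mono) auto
    qed
    finally show "(\<integral>\<^sup>+ \<omega>. ennreal ((normalized_sum \<xi> n x \<omega> - normalized_sum \<xi> n y \<omega>) ^ (2 * m)) \<partial>M) \<le>
        ennreal ((3 * (2 * real m) powr \<gamma> * r) ^ (2 * m))" .
  qed
  have modif: "\<exists>Z. continuous_modification M X \<rho> \<zeta> Z" if "increments_bounded M X \<rho> \<gamma> 3 \<zeta>" for \<zeta>
  proof -
    interpret net_chain X \<rho> \<delta> A \<gamma> by (rule chain)
    interpret chained_field X \<rho> \<delta> A \<gamma> M \<zeta> 3 by unfold_locales (use that in auto)
    show ?thesis by (rule continuous_modification_exists)
  qed
  obtain x0 where x0: "x0 \<in> X" using Xne by blast
  define c where "c = 1 + enn2real (SUP i\<in>{1..}. SUP x\<in>X. Lp_norm M 2 (\<xi> i x))"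
  have c: "0 < c" by (simp add: c_def add_pos_nonneg)
  have sq: "(\<integral>\<^sup>+ \<omega>. ennreal (\<xi> i x0 \<omega> ^ (2 * 1)) \<partial>M) \<le> ennreal (c ^ (2 * 1))" if i: "1 \<le> i" for i
  proof -
    have "(SUP i\<in>{1..}. SUP x\<in>X. Lp_norm M 2 (\<xi> i x)) < \<infinity>" using assms(9) assms(10)[of 2] by simp
    then have "(SUP i\<in>{1..}. SUP x\<in>X. Lp_norm M 2 (\<xi> i x)) \<le> ennreal c"
      by (cases "SUP i\<in>{1..}. SUP x\<in>X. Lp_norm M 2 (\<xi> i x)") (auto simp: c_def intro!: ennreal_leI)
    then have "Lp_norm M 2 (\<xi> i x0) \<le> ennreal c" by (rule order_trans[OF norm_fin[OF i x0]])
    then have "(\<integral>\<^sup>+ \<omega>. ennreal (\<bar>\<xi> i x0 \<omega>\<bar> powr 2) \<partial>M) \<le> ennreal (c powr 2)"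
      using c by (subst (asm) Lp_norm_le_iff) auto
    moreover have "\<bar>u\<bar> powr 2 = u ^ (2 * 1)" for u :: real using powr_even[of 1 u] by simp
    ultimately show ?thesis using c by (simp add: powr_numeral)
  qed
  have V: "(\<integral>\<^sup>+ \<omega>. ennreal ((normalized_sum \<xi> n x0 \<omega>)\<^sup>2) \<partial>M) \<le> ennreal (16 * c\<^sup>2)" if n: "1 \<le> n" for n
  proof -
    interpret D: martingale_differences M F "\<lambda>i. \<xi> i x0" by (rule md[OF x0])
    show ?thesis
      using D.normalized_even_moment[OF order_refl n c sq] by (simp add: normalized_sum_def D.S_def)
  qed
  show ?thesis
  proof (intro conjI allI impI)
    fix i :: nat assume "1 \<le> i"
    then show "\<exists>Y. continuous_modification M X \<rho> (\<xi> i) Y" by (intro modif inc_\<xi>)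
  next
    fix n :: nat assume "1 \<le> n"
    then show "\<exists>Z. continuous_modification M X \<rho> (normalized_sum \<xi> n) Z" by (intro modif inc_\<eta>)
  next
    fix Z assume Z: "\<forall>n\<ge>1. continuous_modification M X \<rho> (normalized_sum \<xi> n) (Z n)"
    have "weakly_rel_compact (C_space X \<rho>) ((\<lambda>n. distr M (borel_of (C_space X \<rho>)) (Z n)) ` {1..})"
      by (rule chaining_weakly_rel_compact[where C=3 and V="16 * c\<^sup>2" and \<zeta>="normalized_sum \<xi>", OF chain assms(2) _ _ x0])
         (use inc_\<eta> V Z in auto)
    also have "(\<lambda>n. distr M (borel_of (C_space X \<rho>)) (Z n)) ` {1..} =
        {distr M (borel_of (C_space X \<rho>)) (Z n) | n. 1 \<le> n}" by auto
    finally show "weakly_rel_compact (C_space X \<rho>) {distr M (borel_of (C_space X \<rho>)) (Z n) | n. 1 \<le> n}" .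
  qed
qed

end
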